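(* Let $a$ be a weak composition of length $n$ that sorts to the partition $\lambda$, and let $w\in S_n$ be the minimal length permutation that sorts $a$ to $\lambda$. Then the raising and lowering operators $e_i,f_i$ ($1\leqslant i<n$) on the set $\mathrm{SSKT}(a)$ of semi-standard key tableaux of shape $a$ give the Demazure crystal $B_w(\lambda)$; that is, there is a weight-preserving bijection $\mathrm{SSKT}(a)\to B_w(\lambda)$ that intertwines the operators $e_i$ and $f_i$ for all $1\leqslant i<n$ (including when they take the value $0$).
   Context: **Key tableaux.** Let $a=(a_1,\dots,a_n)$ be a weak composition (nonnegative integers). The key diagram of shape $a$ is the left-justified array with $a_i$ cells in row $i$, rows numbered $1,\dots,n$ from bottom to top. A key tableau of shape $a$ is a filling of this diagram with positive integers such that columns have distinct entries, rows weakly decrease left to right, and whenever an entry $i$ is above and in the same column as an entry $k$ with $i<k$, there is an entry $j$ immediately to the right of $k$ with $i<j$. It is semi-standard if no entry exceeds its row index. $\mathrm{SSKT}(a)$ is the set of semi-standard key tableaux of shape $a$. The weight $\mathrm{wt}(T)$ has $i$th part the number of $i$'s in $T$. The column reading word $w(T)=w_1\cdots w_k$ of a key tableau reads each column from top to bottom, taking the columns from right to left. For a word $w=w_1\cdots w_k$ with letters in $\{1,\dots,n\}$, let $m_i(w,r)$ be the number of $(i+1)$'s minus the number of $i$'s in $w_rw_{r+1}\cdots w_k$ and $m_i(w)=\max_r m_i(w,r)$. **Raising operator** $e_i$ on $\mathrm{SSKT}(a)$: if $m_i(w(T))\leqslant 0$ then $e_i(T)=0$. Otherwise let $q$ be the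 largest index with $m_i(w(T),q)=m_i(w(T))$ and let $x$ be the cell corresponding to $w(T)_q$; then $e_i(T)$ is obtained from $T$ by changing all entries $i+1$ in the row of $x$ weakly to the right of $x$ to $i$, and changing all $i$'s in the same columns as these entries to $i+1$'s. **Lowering operator** $f_i$ on $\mathrm{SSKT}(a)$: $f_i$ is the partial inverse of $e_i$, i.e. $f_i(T)=S$ if there is a (necessarily unique) $S\in\mathrm{SSKT}(a)$ with $e_i(S)=T$, and $f_i(T)=0$ otherwise. **Demazure crystals.** Partitions are padded with zeros to length $n$. $B(\lambda)$ is the type $A_{n-1}$ highest weight crystal of highest weight $\lambda$, realized on semi-standard Young tableaux of shape $\lambda$ with entries in $\{1,\dots,n\}$, with raising operators $e_i$ and lowering operators $f_i$ ($1\leqslant i<n$), weight = content, and highest weight element $u_\lambda$. For $X\subseteq B(\lambda)$ let $\mathfrak D_iX=\{b\in B(\lambda)\mid e_i^k(b)\in X\text{ for some }k\geqslant0\}$. For $w\in S_n$ with reduced expression $w=s_{i_1}\cdots s_{i_k}$ (composition of functions, $s_i$ the transposition of $i,i+1$) let $B_w(\lambda)=\mathfrak D_{i_1}\cdots\mathfrak D_{i_k}\{u_\lambda\}$. The operators on $B_w(\lambda)$ are those of $B(\lambda)$ when the result lies in $B_w(\lambda)$, and $0$ otherwise. The minimal length permutation sorting $a$ to $\lambda$ (its decreasing rearrangement) is the minimal length $w\in S_n$ with $\lambda_j=a_{w(j)}$ for all $j$. *)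

theory Defs
  imports "HOL-Combinatorics.Permutations"
begin

section \<open>Diagrams and fillings\<close>

text \<open>
  Compositions are functions \<open>nat \<Rightarrow> nat\<close> of which only the values on \<open>{1..n}\<close> matter.
  A cell is a pair (row, column), both counted from 1, rows from bottom to top.
  The same coordinates are used for key tableaux and for Young tableaux (French notation).
  A filling is a function on all cells that is 0 outside the diagram, so that
  equality of tableaux is equality of functions.
\<close>

type_synonym cell = "nat \<times> nat"
type_synonym filling = "cell \<Rightarrow> nat"

definition diagram :: "nat \<Rightarrow> (nat \<Rightarrow> nat) \<Rightarrow> cell set" where
  "diagram n a = {(r, c). 1 \<le> r \<and> r \<le> n \<and> 1 \<le> c \<and> c \<le> a r}"

definition is_filling :: "nat \<Rightarrow> (nat \<Rightarrow> nat) \<Rightarrow> filling \<Rightarrow> bool" where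
  "is_filling n a T \<longleftrightarrow>
     (\<forall>x \<in> diagram n a. 1 \<le> T x) \<and> (\<forall>x. x \<notin> diagram n a \<longrightarrow> T x = 0)"

definition weight :: "nat \<Rightarrow> (nat \<Rightarrow> nat) \<Rightarrow> filling \<Rightarrow> nat \<Rightarrow> nat" where
  "weight n a T i = card {x \<in> diagram n a. T x = i}"

definition max_column :: "nat \<Rightarrow> (nat \<Rightarrow> nat) \<Rightarrow> nat" where
  "max_column n a = Max (insert 0 (a ` {1..n}))"

definition column_cells :: "nat \<Rightarrow> (nat \<Rightarrow> nat) \<Rightarrow> nat \<Rightarrow> cell list" where
  "column_cells n a c = filter (\<lambda>x. x \<in> diagram n a) (map (\<lambda>r. (r, c)) (rev [1..<Suc n]))"

section \<open>Statistics on words\<close>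

text \<open>
  \<open>suffix_excess i w r\<close> is the excess of \<open>i + 1\<close> over \<open>i\<close> after deleting the first
  \<open>r\<close> letters. The empty suffix is admitted in the maximum, which makes it
  well defined for the empty word. It contributes the value 0 and thus affects neither
  whether the maximum is positive nor, in that case, where it is attained.
\<close>

definition suffix_excess :: "nat \<Rightarrow> nat list \<Rightarrow> nat \<Rightarrow> int" where
  "suffix_excess i w r = int (count_list (drop r w) (i + 1)) - int (count_list (drop r w) i)"

definition max_suffix_excess :: "nat \<Rightarrow> nat list \<Rightarrow> int" where
  "max_suffix_excess i w = Max (suffix_excess i w ` {..length w})"

definition raise_pos :: "nat \<Rightarrow> nat list \<Rightarrow> nat" where
  "raise_pos i w = Max {r \<in> {..length w}. suffix_excess i w r = max_suffix_excess i w}"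

definition prefix_excess :: "nat \<Rightarrow> nat list \<Rightarrow> nat \<Rightarrow> int" where
  "prefix_excess i w r = int (count_list (take r w) i) - int (count_list (take r w) (i + 1))"

definition max_prefix_excess :: "nat \<Rightarrow> nat list \<Rightarrow> int" where
  "max_prefix_excess i w = Max (prefix_excess i w ` {..length w})"

text \<open>The shortest prefix of maximal excess has positive length if that excess is
  positive; its last letter is the one to be lowered.\<close>

definition lower_pos :: "nat \<Rightarrow> nat list \<Rightarrow> nat" where
  "lower_pos i w = Min {r \<in> {..length w}. prefix_excess i w r = max_prefix_excess i w} - 1"

section \<open>Semi-standard key tableaux\<close>

definition key_tableau :: "nat \<Rightarrow> (nat \<Rightarrow> nat) \<Rightarrow> filling \<Rightarrow> bool" where
  "key_tableau n a T \<longleftrightarrow>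
     is_filling n a T \<and>
     (\<forall>r s c. (r, c) \<in> diagram n a \<and> (s, c) \<in> diagram n a \<and> r \<noteq> s \<longrightarrow> T (r, c) \<noteq> T (s, c)) \<and>
     (\<forall>r c d. (r, c) \<in> diagram n a \<and> (r, d) \<in> diagram n a \<and> c \<le> d \<longrightarrow> T (r, d) \<le> T (r, c)) \<and>
     (\<forall>r s c. (r, c) \<in> diagram n a \<and> (s, c) \<in> diagram n a \<and> s < r \<and> T (r, c) < T (s, c) \<longrightarrow>
        (s, c + 1) \<in> diagram n a \<and> T (r, c) < T (s, c + 1))"

definition SSKT :: "nat \<Rightarrow> (nat \<Rightarrow> nat) \<Rightarrow> filling set" where
  "SSKT n a = {T. key_tableau n a T \<and> (\<forall>r c. (r, c) \<in> diagram n a \<longrightarrow> T (r, c) \<le> r)}"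

definition key_cells :: "nat \<Rightarrow> (nat \<Rightarrow> nat) \<Rightarrow> cell list" where
  "key_cells n a = concat (map (column_cells n a) (rev [1..<Suc (max_column n a)]))"

definition key_word :: "nat \<Rightarrow> (nat \<Rightarrow> nat) \<Rightarrow> filling \<Rightarrow> nat list" where
  "key_word n a T = map T (key_cells n a)"

text \<open>Operators take values in an option type; \<open>None\<close> is the value 0 of crystal operators.\<close>

definition key_raise :: "nat \<Rightarrow> (nat \<Rightarrow> nat) \<Rightarrow> nat \<Rightarrow> filling \<Rightarrow> filling option" where
  "key_raise n a i T =
     (if max_suffix_excess i (key_word n a T) \<le> 0 then None
      else let (r, c) = key_cells n a ! raise_pos i (key_word n a T);
               C = {d. c \<le> d \<and> T (r, d) = i + 1}
           in Some (\<lambda>(s, d).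
                if d \<in> C \<and> s = r then i
                else if d \<in> C \<and> T (s, d) = i then i + 1
                else T (s, d)))"

definition key_lower :: "nat \<Rightarrow> (nat \<Rightarrow> nat) \<Rightarrow> nat \<Rightarrow> filling \<Rightarrow> filling option" where
  "key_lower n a i T =
     (if \<exists>S \<in> SSKT n a. key_raise n a i S = Some T
      then Some (THE S. S \<in> SSKT n a \<and> key_raise n a i S = Some T)
      else None)"

section \<open>The crystal of semi-standard Young tableaux\<close>

definition is_partition :: "nat \<Rightarrow> (nat \<Rightarrow> nat) \<Rightarrow> bool" where
  "is_partition n lam \<longleftrightarrow> (\<forall>i \<in> {1..n}. \<forall>j \<in> {1..n}. i \<le> j \<longrightarrow> lam j \<le> lam i)"

definition SSYT :: "nat \<Rightarrow> (nat \<Rightarrow> nat) \<Rightarrow> filling set" where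
  "SSYT n lam = {T. is_filling n lam T \<and> (\<forall>x \<in> diagram n lam. T x \<le> n) \<and>
     (\<forall>r c d. (r, c) \<in> diagram n lam \<and> (r, d) \<in> diagram n lam \<and> c \<le> d \<longrightarrow> T (r, c) \<le> T (r, d)) \<and>
     (\<forall>r s c. (r, c) \<in> diagram n lam \<and> (s, c) \<in> diagram n lam \<and> r < s \<longrightarrow> T (r, c) < T (s, c))}"

text \<open>
  The operators are given by the usual signature rule on the column reading word, in which
  each \<open>i + 1\<close> is paired with a later \<open>i\<close>. Raising changes the leftmost unpaired \<open>i + 1\<close>
  to \<open>i\<close>, lowering changes the rightmost unpaired \<open>i\<close> to \<open>i + 1\<close>.
  Columns are read from top to bottom as for key tableaux, but are taken from left to right.
\<close>

definition young_cells :: "nat \<Rightarrow> (nat \<Rightarrow> nat) \<Rightarrow> cell list" where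
  "young_cells n lam = concat (map (column_cells n lam) [1..<Suc (max_column n lam)])"

definition young_word :: "nat \<Rightarrow> (nat \<Rightarrow> nat) \<Rightarrow> filling \<Rightarrow> nat list" where
  "young_word n lam T = map T (young_cells n lam)"

definition young_raise :: "nat \<Rightarrow> (nat \<Rightarrow> nat) \<Rightarrow> nat \<Rightarrow> filling \<Rightarrow> filling option" where
  "young_raise n lam i T =
     (if max_suffix_excess i (young_word n lam T) \<le> 0 then None
      else Some (T(young_cells n lam ! raise_pos i (young_word n lam T) := i)))"

definition young_lower :: "nat \<Rightarrow> (nat \<Rightarrow> nat) \<Rightarrow> nat \<Rightarrow> filling \<Rightarrow> filling option" where
  "young_lower n lam i T =
     (if max_prefix_excess i (young_word n lam T) \<le> 0 then None
      else Some (T(young_cells n lam ! lower_pos i (young_word n lam T) := i + 1)))"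

definition highest_weight_tableau :: "nat \<Rightarrow> (nat \<Rightarrow> nat) \<Rightarrow> filling" where
  "highest_weight_tableau n lam = (\<lambda>(r, c). if (r, c) \<in> diagram n lam then r else 0)"

section \<open>Reduced words\<close>

definition word_perm :: "nat list \<Rightarrow> nat \<Rightarrow> nat" where
  "word_perm ws = foldr (\<lambda>i p. transpose i (i + 1) \<circ> p) ws id"

definition perm_length :: "nat \<Rightarrow> (nat \<Rightarrow> nat) \<Rightarrow> nat" where
  "perm_length n w = (LEAST k. \<exists>ws. set ws \<subseteq> {1..<n} \<and> word_perm ws = w \<and> length ws = k)"

definition reduced_word :: "nat \<Rightarrow> nat list \<Rightarrow> (nat \<Rightarrow> nat) \<Rightarrow> bool" where
  "reduced_word n ws w \<longleftrightarrow>
     set ws \<subseteq> {1..<n} \<and> word_perm ws = w \<and> length ws = perm_length n w"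

definition sorting_perm :: "nat \<Rightarrow> (nat \<Rightarrow> nat) \<Rightarrow> (nat \<Rightarrow> nat) \<Rightarrow> (nat \<Rightarrow> nat) \<Rightarrow> bool" where
  "sorting_perm n a lam w \<longleftrightarrow> w permutes {1..n} \<and> (\<forall>j \<in> {1..n}. lam j = a (w j))"

definition min_sorting_perm :: "nat \<Rightarrow> (nat \<Rightarrow> nat) \<Rightarrow> (nat \<Rightarrow> nat) \<Rightarrow> (nat \<Rightarrow> nat) \<Rightarrow> bool" where
  "min_sorting_perm n a lam w \<longleftrightarrow>
     sorting_perm n a lam w \<and>
     (\<forall>v. sorting_perm n a lam v \<longrightarrow> perm_length n w \<le> perm_length n v)"

lemma word_perm_append: "word_perm (us @ vs) = word_perm us \<circ> word_perm vs"
  by (induction us) (simp_all add: word_perm_def comp_assoc)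

lemma transpose_word_exists:
  assumes "1 \<le> i" "i < j" "j \<le> n"
  shows "\<exists>ws. set ws \<subseteq> {1..<n} \<and> word_perm ws = transpose i j"
  using assms(2,3)
proof (induction j)
  case (Suc j)
  have s: "word_perm [j] = transpose j (Suc j)"
    by (simp add: word_perm_def)
  show ?case
  proof (cases "i = j")
    case True
    then show ?thesis using Suc.prems assms(1) s by (intro exI[of _ "[j]"]) auto
  next
    case False
    then obtain ws where ws: "set ws \<subseteq> {1..<n}" "word_perm ws = transpose i j"
      using Suc by auto
    have "word_perm ([j] @ ws @ [j]) = transpose i (Suc j)"
      using False Suc.prems
      by (simp only: word_perm_append s ws) (auto simp: fun_eq_iff transpose_def)
    then show ?thesis using ws Suc.prems assms(1) by (intro exI[of _ "[j] @ ws @ [j]"]) auto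
  qed
qed simp

lemma reduced_word_exists:
  assumes "w permutes {1..n}"
  shows "\<exists>ws. reduced_word n ws w"
proof -
  have "\<exists>ws. set ws \<subseteq> {1..<n} \<and> word_perm ws = w"
    using assms finite_atLeastAtMost[of 1 n]
  proof (induction rule: permutes_induct)
    case id
    show ?case by (intro exI[of _ "[]"]) (simp add: word_perm_def)
  next
    case (swap a b p)
    have "\<exists>us. set us \<subseteq> {1..<n} \<and> word_perm us = transpose a b"
      using swap.hyps transpose_word_exists[of a b n] transpose_word_exists[of b a n]
      by (cases a b rule: linorder_cases) (auto simp: transpose_commute)
    with swap.IH swap.hyps show ?case
      by (metis word_perm_append set_append Un_least)
  qed
  then have "\<exists>k ws. set ws \<subseteq> {1..<n} \<and> word_perm ws = w \<and> length ws = k"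
    by blast
  from LeastI_ex[OF this] show ?thesis
    unfolding reduced_word_def perm_length_def by blast
qed

section \<open>Demazure crystals\<close>

definition iter_raise :: "nat \<Rightarrow> (nat \<Rightarrow> nat) \<Rightarrow> nat \<Rightarrow> nat \<Rightarrow> filling \<Rightarrow> filling option" where
  "iter_raise n lam i k b = ((\<lambda>x. Option.bind x (young_raise n lam i)) ^^ k) (Some b)"

definition demazure_op ::
    "nat \<Rightarrow> (nat \<Rightarrow> nat) \<Rightarrow> nat \<Rightarrow> filling set \<Rightarrow> filling set" where
  "demazure_op n lam i X = {b \<in> SSYT n lam. \<exists>k. \<exists>x \<in> X. iter_raise n lam i k b = Some x}"

text \<open>The crystal \<open>B\<^sub>w(\<lambda>)\<close>, given by a reduced word of \<open>w\<close>.\<close>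

definition demazure_crystal :: "nat \<Rightarrow> (nat \<Rightarrow> nat) \<Rightarrow> nat list \<Rightarrow> filling set" where
  "demazure_crystal n lam ws = foldr (demazure_op n lam) ws {highest_weight_tableau n lam}"

definition restrict_op :: "'a set \<Rightarrow> ('a \<Rightarrow> 'a option) \<Rightarrow> 'a \<Rightarrow> 'a option" where
  "restrict_op X g b = (case g b of None \<Rightarrow> None | Some b' \<Rightarrow> if b' \<in> X then Some b' else None)"

end

theory Submission
  imports Defs
begin

text \<open>
  Forget in which rows the entries of a key tableau stand and keep only the set \<open>K c\<close> of
  entries of each column \<open>c\<close>. Reading the columns from right to left, each in decreasing
  order, gives the sorted word of the tableau. Because rows decrease, the sets satisfy the
  dominance condition of \<open>anti_cols\<close>: they are the columns of a semi-standard Young tableau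
  turned by 180 degrees.

  First, nothing is lost. For any shape \<open>a\<close> that sorts to \<open>\<lambda>\<close> the column sets
  determine the key tableau (\<open>key_tableau_eqI\<close>), every dominated system of column sets occurs
  (\<open>exists_key_tableau\<close>), and the raising operator of key tableaux is the signature rule
  on sorted words (\<open>key_raise_step\<close>). So the key tableaux of all these shapes live in
  one and the same crystal of words; the shape matters only through the requirement that the first
  entry of row \<open>r\<close> is at most \<open>r\<close>, which cuts out the semi-standard ones.

  Secondly, let \<open>a i < a (i + 1)\<close> and let \<open>b\<close> be \<open>a\<close> with these two parts
  exchanged. The sorted words for \<open>a\<close> include those for \<open>b\<close> (\<open>SSKT_swap_subset\<close>),
  they are closed under lowering by \<open>i\<close> (\<open>SSKT_lower_closed\<close>), and those
  that cannot be raised by \<open>i\<close> are words for \<open>b\<close> (\<open>SSKT_highest_in_swap\<close>).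
  Hence the Demazure operator of \<open>i\<close> takes the set for \<open>b\<close> to the set for \<open>a\<close>. This
  rests on a construction that turns a key tableau of one shape into the one of the other shape with
  the same columns (\<open>swap_rows\<close>). The shape \<open>\<lambda>\<close> has a
  single semi-standard key tableau, and a reduced word of the minimal sorting permutation leads from
  \<open>\<lambda>\<close> to \<open>a\<close> through exchanges of exactly this kind
  (\<open>min_sorting_perm_step\<close>). This identifies the words for \<open>a\<close> with a Demazure
  subset of the crystal of words (\<open>demazure_crystal_SSKT\<close>).

  Thirdly, that crystal of words is isomorphic to the crystal of semi-standard Young tableaux, by
  Knuth equivalence. The operators commute with Knuth moves (\<open>plactic_raise\<close>,
  \<open>plactic_lower\<close>). Both sets of words are closed under the operators, both contain a single
  word of highest weight, and these two words are equivalent because the words of initial columns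
  commute (\<open>plactic_columns_rev\<close>). The bijection of the theorem therefore sends \<open>T\<close>
  to the one Young tableau whose reading word is Knuth equivalent to the sorted word of \<open>T\<close>.
\<close>

section \<open>Signature rule on words\<close>

text \<open>
  Each \<open>i + 1\<close> is paired with a later \<open>i\<close>; \<open>word_phi\<close> and \<open>word_eps\<close>
  count the unpaired \<open>i\<close> and \<open>i + 1\<close>. A new first letter only interacts with the unpaired
  \<open>i\<close> behind it, which is why both counts, and the operators, are recursive from the front. In this
  form they are easy to compute on concatenations, unlike the maxima over suffixes and prefixes.
\<close>

primrec word_phi :: "nat \<Rightarrow> nat list \<Rightarrow> nat" where
  "word_phi i [] = 0"
| "word_phi i (x # v) =
     (if x = i then Suc (word_phi i v) else if x = Suc i then word_phi i v - 1 else word_phi i v)"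

primrec word_eps :: "nat \<Rightarrow> nat list \<Rightarrow> nat" where
  "word_eps i [] = 0"
| "word_eps i (x # v) =
     (if x = Suc i \<and> word_phi i v = 0 then Suc (word_eps i v) else word_eps i v)"

primrec word_raise :: "nat \<Rightarrow> nat list \<Rightarrow> nat list option" where
  "word_raise i [] = None"
| "word_raise i (x # v) =
     (if x = Suc i \<and> word_phi i v = 0 then Some (i # v) else map_option (Cons x) (word_raise i v))"

primrec word_lower :: "nat \<Rightarrow> nat list \<Rightarrow> nat list option" where
  "word_lower i [] = None"
| "word_lower i (x # v) =
     (if (if x = Suc i then 1 else 0) < word_phi i v then map_option (Cons x) (word_lower i v)
      else if x = i then Some (Suc i # v) else None)"

lemma map_option_append_Nil: "map_option ((@) []) z = z"
  by (cases z) auto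

text \<open>
  The tensor product rule: the unpaired \<open>i + 1\<close> of \<open>u\<close> are paired with the unpaired \<open>i\<close>
  of \<open>v\<close> as far as possible.
\<close>

lemma word_phi_append: "word_phi i (u @ v) = word_phi i u + (word_phi i v - word_eps i u)"
  by (induction u) auto

lemma word_eps_append: "word_eps i (u @ v) = word_eps i v + (word_eps i u - word_phi i v)"
  by (induction u) (auto simp: word_phi_append)

lemma word_raise_None_iff: "word_raise i w = None \<longleftrightarrow> word_eps i w = 0"
  by (induction w) auto

lemma word_lower_None_iff: "word_lower i w = None \<longleftrightarrow> word_phi i w = 0"
  by (induction w) auto

lemma word_raise_append:
  "word_raise i (u @ v) =
     (if word_phi i v < word_eps i u then map_option (\<lambda>x. x @ v) (word_raise i u)
      else map_option (append u) (word_raise i v))"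
  by (induction u) (auto simp: word_phi_append option.map_comp comp_def option.map_ident
      map_option_append_Nil word_raise_None_iff[symmetric])

lemma word_lower_append:
  "word_lower i (u @ v) =
     (if word_eps i u < word_phi i v then map_option (append u) (word_lower i v)
      else map_option (\<lambda>x. x @ v) (word_lower i u))"
  by (induction u) (auto simp: word_phi_append option.map_comp comp_def option.map_ident
      map_option_append_Nil word_lower_None_iff)

text \<open>
  The word is cut at its leftmost unpaired \<open>i + 1\<close>. The \<open>i + 1\<close> before the cut are paired
  among the letters before it, since pairs do not cross an unpaired letter; an \<open>i\<close> after the cut that is
  unpaired there would be paired with the letter at the cut. The rightmost unpaired \<open>i\<close> is surrounded by the
  same conditions, so raising and lowering undo each other.
\<close>

lemma unpaired_upper_split:
  "word_eps i w \<noteq> 0 \<Longrightarrow> \<exists>u v. w = u @ Suc i # v \<and> word_eps i u = 0 \<and> word_phi i v = 0"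
proof (induction w)
  case (Cons x w)
  show ?case
  proof (cases "x = Suc i \<and> word_phi i w = 0")
    case True
    then show ?thesis by (intro exI[of _ "[]"] exI[of _ w]) auto
  next
    case False
    then obtain u v where uv: "w = u @ Suc i # v" "word_eps i u = 0" "word_phi i v = 0"
      using Cons by auto
    then have "word_eps i (x # u) = 0" using False by (auto simp: word_phi_append)
    then show ?thesis using uv by (intro exI[of _ "x # u"] exI[of _ v]) auto
  qed
qed simp

lemma unpaired_lower_split:
  "word_phi i w \<noteq> 0 \<Longrightarrow> \<exists>u v. w = u @ i # v \<and> word_eps i u = 0 \<and> word_phi i v = 0"
proof (induction w)
  case (Cons x w)
  show ?case
  proof (cases "(if x = Suc i then 1 else 0) < word_phi i w")
    case False
    then show ?thesis using Cons.prems
      by (intro exI[of _ "[]"] exI[of _ w]) (auto split: if_splits)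
  next
    case True
    then obtain u v where uv: "w = u @ i # v" "word_eps i u = 0" "word_phi i v = 0"
      using Cons.IH by auto
    then have "word_eps i (x # u) = 0" using True by (auto simp: word_phi_append)
    then show ?thesis using uv by (intro exI[of _ "x # u"] exI[of _ v]) auto
  qed
qed simp

lemma word_raise_iff:
  "word_raise i w = Some w' \<longleftrightarrow>
     (\<exists>u v. w = u @ Suc i # v \<and> w' = u @ i # v \<and> word_eps i u = 0 \<and> word_phi i v = 0)"
  using unpaired_upper_split[of i w] word_raise_None_iff[of i w]
  by (auto simp: word_raise_append) blast

lemma word_lower_iff:
  "word_lower i w' = Some w \<longleftrightarrow>
     (\<exists>u v. w = u @ Suc i # v \<and> w' = u @ i # v \<and> word_eps i u = 0 \<and> word_phi i v = 0)"
  using unpaired_lower_split[of i w'] word_lower_None_iff[of i w']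
  by (auto simp: word_lower_append) blast

lemma word_raise_lower_inverse: "word_raise i w = Some w' \<longleftrightarrow> word_lower i w' = Some w"
  by (simp add: word_raise_iff word_lower_iff)

lemma word_eps_minus_phi:
  "int (count_list w (Suc i)) - int (count_list w i) = int (word_eps i w) - int (word_phi i w)"
  by (induction w) auto

lemma word_eps_phi_eq_0:
  "i \<notin> set w \<Longrightarrow> Suc i \<notin> set w \<Longrightarrow> word_eps i w = 0 \<and> word_phi i w = 0"
  by (induction w) auto

lemma suffix_excess_eq:
  "suffix_excess i w r = int (word_eps i (drop r w)) - int (word_phi i (drop r w))"
  using word_eps_minus_phi[of "drop r w" i] by (simp add: suffix_excess_def)

lemma word_eps_drop_le: "word_eps i (drop r w) \<le> word_eps i w"
  using word_eps_append[of i "take r w" "drop r w"] by simp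

lemma prefix_excess_eq:
  "prefix_excess i w r = int (word_phi i (take r w)) - int (word_eps i (take r w))"
  using word_eps_minus_phi[of "take r w" i] by (simp add: prefix_excess_def)

lemma word_phi_take_le: "word_phi i (take r w) \<le> word_phi i w"
  using word_phi_append[of i "take r w" "drop r w"] by simp

text \<open>
  The excess of a suffix is its number of unpaired \<open>i + 1\<close> minus that of unpaired \<open>i\<close>. The
  first number only grows with the suffix, and the second vanishes at the leftmost unpaired \<open>i + 1\<close>.
\<close>

lemma max_suffix_excess_eq: "max_suffix_excess i w = int (word_eps i w)"
  unfolding max_suffix_excess_def
proof (rule Max_eqI)
  show "y \<le> int (word_eps i w)" if "y \<in> suffix_excess i w ` {..length w}" for y
  proof -
    from that obtain r where "y = suffix_excess i w r" by blast
    then show ?thesis using word_eps_drop_le[of i r w] suffix_excess_eq[of i w r] by linarith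
  qed
  show "int (word_eps i w) \<in> suffix_excess i w ` {..length w}"
  proof (cases "word_eps i w = 0")
    case True
    then show ?thesis by (intro image_eqI[of _ _ "length w"]) (auto simp: suffix_excess_eq)
  next
    case False
    then obtain u v where "w = u @ Suc i # v" "word_eps i u = 0" "word_phi i v = 0"
      using unpaired_upper_split by blast
    then show ?thesis
      by (intro image_eqI[of _ _ "length u"]) (auto simp: suffix_excess_eq word_eps_append)
  qed
qed simp

lemma raise_pos_eq:
  assumes "w = u @ Suc i # v" "word_eps i u = 0" "word_phi i v = 0"
  shows "raise_pos i w = length u"
  unfolding raise_pos_def max_suffix_excess_eq
proof (rule Max_eqI)
  fix r assume r: "r \<in> {r \<in> {..length w}. suffix_excess i w r = int (word_eps i w)}"
  show "r \<le> length u"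
  proof (rule ccontr)
    assume "\<not> r \<le> length u"
    then obtain k where "r = Suc (length u + k)"
      using less_imp_Suc_add[of "length u" r] by auto
    then have d: "drop r w = drop k v" using assms(1) by simp
    have "word_eps i w = Suc (word_eps i v)" using assms by (simp add: word_eps_append)
    then show False using r word_eps_drop_le[of i k v] by (simp add: suffix_excess_eq d)
  qed
qed (use assms in \<open>auto simp: suffix_excess_eq word_eps_append\<close>)

lemma max_prefix_excess_eq: "max_prefix_excess i w = int (word_phi i w)"
  unfolding max_prefix_excess_def
proof (rule Max_eqI)
  show "y \<le> int (word_phi i w)" if "y \<in> prefix_excess i w ` {..length w}" for y
  proof -
    from that obtain r where "y = prefix_excess i w r" by blast
    then show ?thesis using word_phi_take_le[of i r w] prefix_excess_eq[of i w r] by linarith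
  qed
  show "int (word_phi i w) \<in> prefix_excess i w ` {..length w}"
  proof (cases "word_phi i w = 0")
    case True
    then show ?thesis by (intro image_eqI[of _ _ 0]) (auto simp: prefix_excess_eq)
  next
    case False
    then obtain u v where "w = u @ i # v" "word_eps i u = 0" "word_phi i v = 0"
      using unpaired_lower_split by blast
    then show ?thesis
      by (intro image_eqI[of _ _ "Suc (length u)"])
        (auto simp: prefix_excess_eq word_eps_append word_phi_append)
  qed
qed simp

lemma lower_pos_eq:
  assumes "w = u @ i # v" "word_eps i u = 0" "word_phi i v = 0"
  shows "lower_pos i w = length u"
proof -
  have "Min {r \<in> {..length w}. prefix_excess i w r = int (word_phi i w)} = Suc (length u)"
  proof (rule Min_eqI)
    fix r assume r: "r \<in> {r \<in> {..length w}. prefix_excess i w r = int (word_phi i w)}"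
    show "Suc (length u) \<le> r"
    proof (rule ccontr)
      assume "\<not> Suc (length u) \<le> r"
      then have d: "take r w = take r u" using assms(1) by simp
      have "word_phi i w = Suc (word_phi i u)" using assms by (simp add: word_phi_append)
      then show False using r word_phi_take_le[of i r u] by (simp add: prefix_excess_eq d)
    qed
  qed (use assms in \<open>auto simp: prefix_excess_eq word_eps_append word_phi_append\<close>)
  then show ?thesis by (simp add: lower_pos_def max_prefix_excess_eq)
qed

section \<open>Plactic equivalence\<close>

inductive plactic :: "nat list \<Rightarrow> nat list \<Rightarrow> bool" where
  plactic_refl: "plactic w w"
| plactic_sym: "plactic v w \<Longrightarrow> plactic w v"
| plactic_trans: "plactic u v \<Longrightarrow> plactic v w \<Longrightarrow> plactic u w"
| plactic_cong: "plactic v w \<Longrightarrow> plactic (u @ v @ u') (u @ w @ u')"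
| knuth1: "x < y \<Longrightarrow> y \<le> z \<Longrightarrow> plactic [y, x, z] [y, z, x]"
| knuth2: "x \<le> y \<Longrightarrow> y < z \<Longrightarrow> plactic [x, z, y] [z, x, y]"

lemma plactic_count: "plactic v w \<Longrightarrow> count_list v k = count_list w k"
  by (induction rule: plactic.induct) auto

lemma plactic_phi_eps: "plactic v w \<Longrightarrow> word_phi i v = word_phi i w \<and> word_eps i v = word_eps i w"
  by (induction rule: plactic.induct) (auto simp: word_phi_append word_eps_append)

lemma rel_option_plactic_refl: "rel_option plactic x x"
  by (cases x) (auto intro: plactic_refl)

lemma rel_option_plactic_sym: "rel_option plactic x y \<Longrightarrow> rel_option plactic y x"
  by (auto elim!: option.rel_cases intro: plactic_sym)

lemma rel_option_plactic_trans:
  "rel_option plactic x y \<Longrightarrow> rel_option plactic y z \<Longrightarrow> rel_option plactic x z"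
  by (auto elim!: option.rel_cases intro: plactic_trans)

lemma plactic_append_left: "plactic v w \<Longrightarrow> plactic (u @ v) (u @ w)"
  using plactic_cong[of v w u "[]"] by simp

lemma plactic_append_right: "plactic v w \<Longrightarrow> plactic (v @ u) (w @ u)"
  using plactic_cong[of v w "[]" u] by simp

lemma plactic_Cons: "plactic v w \<Longrightarrow> plactic (x # v) (x # w)"
  using plactic_append_left[of v w "[x]"] by simp

text \<open>
  The tensor product rule looks at a factor only through the number of its unpaired letters, which is the
  same for equivalent words. Both operators obey a rule of this form, with \<open>\<le>\<close> and \<open><\<close>
  for \<open>P\<close>.
\<close>

lemma tensor_operator_plactic_cong:
  assumes tensor: "\<And>u v. f (u @ v) = (if P (word_eps i u) (word_phi i v) then map_option (append u) (f v)
      else map_option (\<lambda>x. x @ v) (f u))"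
    and vw: "plactic v w" and f: "rel_option plactic (f v) (f w)"
  shows "rel_option plactic (f (u @ v @ u')) (f (u @ w @ u'))"
proof -
  have e: "word_phi i v = word_phi i w" "word_eps i v = word_eps i w"
    using plactic_phi_eps[OF vw, of i] by auto
  have A: "rel_option plactic (f (v @ u')) (f (w @ u'))"
  proof (cases "P (word_eps i w) (word_phi i u')")
    case True
    then show ?thesis using e plactic_append_right[OF vw]
      by (simp add: tensor option.rel_map option.rel_refl_strong)
  next
    case False
    have "rel_option (\<lambda>x y. plactic (x @ u') (y @ u')) (f v) (f w)"
      using plactic_append_right by (intro option.rel_mono_strong[OF f]) auto
    then show ?thesis using False e by (simp add: tensor option.rel_map)
  qed
  show ?thesis
  proof (cases "P (word_eps i u) (word_phi i (w @ u'))")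
    case True
    have "rel_option (\<lambda>x y. plactic (u @ x) (u @ y)) (f (v @ u')) (f (w @ u'))"
      using plactic_append_left by (intro option.rel_mono_strong[OF A]) auto
    then show ?thesis using True e
      by (simp add: tensor[of u] word_phi_append option.rel_map)
  next
    case False
    then show ?thesis using e plactic_cong[OF vw]
      by (simp add: tensor[of u] word_phi_append option.rel_map option.rel_refl_strong)
  qed
qed

lemma plactic_raise: "plactic v w \<Longrightarrow> rel_option plactic (word_raise i v) (word_raise i w)"
proof (induction rule: plactic.induct)
  case (plactic_cong v w u u')
  show ?case
    by (rule tensor_operator_plactic_cong[where P = "(\<le>)" and i = i, OF _ plactic_cong])
      (simp add: word_raise_append)
  \<comment> \<open>Only the triples over \<open>i\<close> and \<open>i + 1\<close> are interesting; there an operator may turn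
    one Knuth relation into the other.\<close>
qed (auto intro: rel_option_plactic_refl rel_option_plactic_sym rel_option_plactic_trans
    knuth1 knuth2 knuth1[THEN plactic_sym] knuth2[THEN plactic_sym])

lemma plactic_lower: "plactic v w \<Longrightarrow> rel_option plactic (word_lower i v) (word_lower i w)"
proof (induction rule: plactic.induct)
  case (plactic_cong v w u u')
  show ?case
    by (rule tensor_operator_plactic_cong[where P = "(<)" and i = i, OF _ plactic_cong])
      (simp add: word_lower_append)
qed (auto intro: rel_option_plactic_refl rel_option_plactic_sym rel_option_plactic_trans
    knuth1 knuth2 knuth1[THEN plactic_sym] knuth2[THEN plactic_sym])

text \<open>
  The letter \<open>x\<close> passes the smaller letters of the column with the first Knuth relation, and then
  (in \<open>plactic_insert_column\<close>) the larger ones with the second.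
\<close>

lemma plactic_insert_below:
  assumes "1 \<le> j" "j \<le> x"
  shows "plactic (rev [1..<Suc j] @ [x]) (j # x # rev [1..<j])"
  using assms
proof (induction j rule: dec_induct)
  case base
  show ?case by (simp add: plactic_refl)
next
  case (step j)
  have "plactic (Suc j # (rev [1..<Suc j] @ [x])) (Suc j # j # x # rev [1..<j])"
    using step by (intro plactic_Cons) simp
  also have "plactic (Suc j # j # x # rev [1..<j]) (Suc j # x # j # rev [1..<j])"
    using plactic_append_right[OF knuth1[of j "Suc j" x], of "rev [1..<j]"] step by simp
  finally (plactic_trans) show ?case using step by simp
qed

lemma plactic_insert_column:
  assumes "1 \<le> x" "x \<le> p"
  shows "plactic (rev [1..<Suc p] @ [x]) (x # rev [1..<Suc p])"
  using assms(2)
proof (induction p rule: dec_induct)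
  case base
  show ?case using plactic_insert_below[of x x] assms(1) by simp
next
  case (step p)
  have "plactic (Suc p # (rev [1..<Suc p] @ [x])) (Suc p # x # p # rev [1..<p])"
    using step assms(1) by (intro plactic_Cons) simp
  also have "plactic (Suc p # x # p # rev [1..<p]) (x # Suc p # p # rev [1..<p])"
    using plactic_append_right[OF knuth2[of x p "Suc p", THEN plactic_sym], of "rev [1..<p]"] step
    by simp
  finally (plactic_trans) show ?case using step assms(1) by simp
qed

lemma plactic_columns_commute_le:
  "q \<le> p \<Longrightarrow> plactic (rev [1..<Suc p] @ rev [1..<Suc q]) (rev [1..<Suc q] @ rev [1..<Suc p])"
proof (induction q)
  case 0
  show ?case by (simp add: plactic_refl)
next
  case (Suc q)
  have "plactic ((rev [1..<Suc p] @ [Suc q]) @ rev [1..<Suc q])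
      ((Suc q # rev [1..<Suc p]) @ rev [1..<Suc q])"
    using Suc.prems by (intro plactic_append_right plactic_insert_column) auto
  also have "plactic \<dots> (Suc q # rev [1..<Suc q] @ rev [1..<Suc p])"
    using plactic_Cons[OF Suc.IH, of "Suc q"] Suc.prems by simp
  finally (plactic_trans) show ?case by simp
qed

lemma plactic_columns_commute:
  "plactic (rev [1..<Suc p] @ rev [1..<Suc q]) (rev [1..<Suc q] @ rev [1..<Suc p])"
  using plactic_columns_commute_le[of q p] plactic_columns_commute_le[of p q] plactic_sym
  by (meson nat_le_linear)

lemma plactic_column_concat_commute:
  "plactic (rev [1..<Suc p] @ concat (map (\<lambda>k. rev [1..<Suc k]) ks))
     (concat (map (\<lambda>k. rev [1..<Suc k]) ks) @ rev [1..<Suc p])"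
proof (induction ks)
  case Nil
  show ?case by (simp add: plactic_refl)
next
  case (Cons k ks)
  let ?W = "concat (map (\<lambda>k. rev [1..<Suc k]) ks)"
  have "plactic ((rev [1..<Suc p] @ rev [1..<Suc k]) @ ?W)
      ((rev [1..<Suc k] @ rev [1..<Suc p]) @ ?W)"
    by (intro plactic_append_right plactic_columns_commute)
  also have "plactic \<dots> (rev [1..<Suc k] @ (?W @ rev [1..<Suc p]))"
    using plactic_append_left[OF Cons.IH, of "rev [1..<Suc k]"] by simp
  finally (plactic_trans) show ?case by simp
qed

text \<open>
  Taken from left to right and from right to left, initial columns give equivalent words. This is what
  relates the highest weight words of the two crystals.
\<close>

lemma plactic_columns_rev:
  "plactic (concat (map (\<lambda>k. rev [1..<Suc k]) ks)) (concat (map (\<lambda>k. rev [1..<Suc k]) (rev ks)))"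
proof (induction ks)
  case Nil
  show ?case by (simp add: plactic_refl)
next
  case (Cons k ks)
  have "plactic (concat (map (\<lambda>k. rev [1..<Suc k]) (k # ks)))
      (rev [1..<Suc k] @ concat (map (\<lambda>k. rev [1..<Suc k]) (rev ks)))"
    using plactic_append_left[OF Cons.IH, of "rev [1..<Suc k]"] by simp
  also have "plactic \<dots> (concat (map (\<lambda>k. rev [1..<Suc k]) (rev ks)) @ rev [1..<Suc k])"
    by (rule plactic_column_concat_commute)
  finally (plactic_trans) show ?case by simp
qed

section \<open>Sets of words closed under the operators\<close>

lemma word_raise_sum: "word_raise i w = Some w' \<Longrightarrow> sum_list w = Suc (sum_list w')"
  by (auto simp: word_raise_iff)

text \<open>
  Equivalent words can be raised in parallel until both are of highest weight, where they coincide; raising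
  is injective. The sum of the letters decreases on the way.
\<close>

lemma plactic_unique:
  assumes closed: "\<And>w i w'. w \<in> W \<Longrightarrow> i \<in> I \<Longrightarrow> word_raise i w = Some w' \<Longrightarrow> w' \<in> W"
    and highest: "\<And>w. w \<in> W \<Longrightarrow> \<forall>i\<in>I. word_eps i w = 0 \<Longrightarrow> w = h"
    and "plactic u v" "u \<in> W" "v \<in> W"
  shows "u = v"
  using assms(3-)
proof (induction "sum_list u" arbitrary: u v rule: less_induct)
  case less
  show ?case
  proof (cases "\<forall>i\<in>I. word_eps i u = 0")
    case True
    then have "\<forall>i\<in>I. word_eps i v = 0"
      using plactic_phi_eps[OF less.prems(1)] by auto
    then show ?thesis using True highest less.prems by metis
  next
    case False
    then obtain i u' where i: "i \<in> I" "word_raise i u = Some u'"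
      using word_raise_None_iff by (metis not_None_eq)
    then obtain v' where v': "word_raise i v = Some v'" "plactic u' v'"
      using plactic_raise[OF less.prems(1), of i] by (auto simp: option_rel_Some1)
    have "u' = v'"
      using less.hyps[of u' v'] word_raise_sum[OF i(2)] closed[OF _ i] closed[OF _ i(1) v'(1)]
        v'(2) less.prems by auto
    then show ?thesis using i v' by (simp add: word_raise_lower_inverse)
  qed
qed

text \<open>
  A word is raised to highest weight, replaced by its counterpart in \<open>V\<close>, and lowered again along the
  same path.
\<close>

lemma plactic_transfer:
  assumes raise: "\<And>w i w'. w \<in> U \<Longrightarrow> i \<in> I \<Longrightarrow> word_raise i w = Some w' \<Longrightarrow> w' \<in> U"
    and lower: "\<And>w i w'. w \<in> V \<Longrightarrow> i \<in> I \<Longrightarrow> word_lower i w = Some w' \<Longrightarrow> w' \<in> V"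
    and highest: "\<And>w. w \<in> U \<Longrightarrow> \<forall>i\<in>I. word_eps i w = 0 \<Longrightarrow> \<exists>v\<in>V. plactic w v"
    and "u \<in> U"
  shows "\<exists>v\<in>V. plactic u v"
  using assms(4)
proof (induction "sum_list u" arbitrary: u rule: less_induct)
  case less
  show ?case
  proof (cases "\<forall>i\<in>I. word_eps i u = 0")
    case True
    then show ?thesis using highest less.prems by blast
  next
    case False
    then obtain i u' where i: "i \<in> I" "word_raise i u = Some u'"
      using word_raise_None_iff by (metis not_None_eq)
    then obtain v' where v': "v' \<in> V" "plactic u' v'"
      using less.hyps[of u'] word_raise_sum[OF i(2)] raise[OF less.prems i] by auto
    have "word_lower i u' = Some u" using i(2) by (simp add: word_raise_lower_inverse)
    then obtain v where "word_lower i v' = Some v" "plactic u v"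
      using plactic_lower[OF v'(2), of i] by (auto simp: option_rel_Some1)
    then show ?thesis using lower[OF v'(1) i(1)] by blast
  qed
qed

section \<open>Column words\<close>

definition desc :: "nat set \<Rightarrow> nat list" where
  "desc A = rev (sorted_list_of_set A)"

definition col_word :: "(nat \<Rightarrow> nat set) \<Rightarrow> nat list \<Rightarrow> nat list" where
  "col_word K cs = concat (map (\<lambda>c. desc (K c)) cs)"

lemma col_word_simps [simp]:
  "col_word K [] = []" "col_word K (c # cs) = desc (K c) @ col_word K cs"
  "col_word K (cs @ ds) = col_word K cs @ col_word K ds"
  by (simp_all add: col_word_def)

lemma set_desc [simp]: "finite A \<Longrightarrow> set (desc A) = A"
  by (simp add: desc_def)

lemma length_desc [simp]: "length (desc A) = card A"
  by (simp add: desc_def)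

lemma desc_unique: "sorted_wrt (>) l \<Longrightarrow> desc (set l) = l"
proof -
  assume "sorted_wrt (>) l"
  then have "sorted_wrt (<) (rev l)" by (simp add: sorted_wrt_rev)
  then have "sorted_list_of_set (set (rev l)) = rev l"
    by (metis strict_sorted_iff sorted_list_of_set.idem_if_sorted_distinct)
  then show ?thesis by (simp add: desc_def)
qed

lemma sorted_desc: "sorted_wrt (>) (desc A)"
proof -
  have "sorted_wrt (<) (sorted_list_of_set A)" by simp
  then show ?thesis by (simp add: desc_def sorted_wrt_rev)
qed

lemma desc_split:
  assumes "finite A"
  shows "desc A = desc {x \<in> A. Suc i < x} @ (if Suc i \<in> A then [Suc i] else []) @
    (if i \<in> A then [i] else []) @ desc {x \<in> A. x < i}" (is "_ = ?R")
proof -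
  have fin: "finite {x \<in> A. P x}" for P using assms by simp
  have "sorted_wrt (>) ?R"
    using sorted_desc by (auto simp: sorted_wrt_append set_desc[OF fin])
  moreover have "set ?R = A"
  proof -
    have "x < i \<or> x = i \<or> x = Suc i \<or> Suc i < x" for x by arith
    then show ?thesis by (auto simp: set_desc[OF fin])
  qed
  ultimately show ?thesis using desc_unique[of ?R] by simp
qed

lemma desc_initial: "desc {1..k} = rev [1..<Suc k]"
proof -
  have "sorted_wrt (>) (rev [1..<Suc k])"
    using sorted_wrt_upt[of 1 "Suc k"] by (simp only: sorted_wrt_rev)
  from desc_unique[OF this] show ?thesis
    by (simp only: set_rev set_upt atLeastLessThanSuc_atLeastAtMost)
qed

text \<open>
  In a decreasing column \<open>i + 1\<close> stands directly before \<open>i\<close>, so a column containing both is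
  neutral.
\<close>

lemma eps_phi_desc:
  assumes "finite A"
  shows "word_eps i (desc A) = (if Suc i \<in> A \<and> i \<notin> A then 1 else 0)"
    and "word_phi i (desc A) = (if i \<in> A \<and> Suc i \<notin> A then 1 else 0)"
proof -
  have fin: "finite {x \<in> A. P x}" for P using assms by simp
  have "word_eps i (desc {x \<in> A. Suc i < x}) = 0 \<and> word_phi i (desc {x \<in> A. Suc i < x}) = 0"
    "word_eps i (desc {x \<in> A. x < i}) = 0 \<and> word_phi i (desc {x \<in> A. x < i}) = 0"
    by (intro word_eps_phi_eq_0; simp add: set_desc[OF fin])+
  then show "word_eps i (desc A) = (if Suc i \<in> A \<and> i \<notin> A then 1 else 0)"
    and "word_phi i (desc A) = (if i \<in> A \<and> Suc i \<notin> A then 1 else 0)"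
    by (subst desc_split[OF assms, of i]; simp add: word_eps_append word_phi_append)+
qed

lemma raise_desc:
  assumes "finite A" "Suc i \<in> A" "i \<notin> A"
  shows "word_raise i (desc A) = Some (desc (insert i (A - {Suc i})))"
proof -
  have fin: "finite {x \<in> A. P x}" for P using assms by simp
  have *: "{x \<in> insert i (A - {Suc i}). Suc i < x} = {x \<in> A. Suc i < x}"
    "{x \<in> insert i (A - {Suc i}). x < i} = {x \<in> A. x < i}"
    by auto
  have 1: "desc A = desc {x \<in> A. Suc i < x} @ Suc i # desc {x \<in> A. x < i}"
    using desc_split[OF assms(1), of i] assms by simp
  have 2: "desc (insert i (A - {Suc i})) = desc {x \<in> A. Suc i < x} @ i # desc {x \<in> A. x < i}"
    using desc_split[of "insert i (A - {Suc i})" i] assms * by simp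
  have "word_eps i (desc {x \<in> A. Suc i < x}) = 0 \<and> word_phi i (desc {x \<in> A. Suc i < x}) = 0"
    "word_eps i (desc {x \<in> A. x < i}) = 0 \<and> word_phi i (desc {x \<in> A. x < i}) = 0"
    by (intro word_eps_phi_eq_0; simp add: set_desc[OF fin])+
  then show ?thesis using 1 2 unfolding word_raise_iff by blast
qed

lemma lower_desc:
  assumes "finite A" "i \<in> A" "Suc i \<notin> A"
  shows "word_lower i (desc A) = Some (desc (insert (Suc i) (A - {i})))"
proof -
  have "insert i (insert (Suc i) (A - {i}) - {Suc i}) = A" using assms by auto
  then show ?thesis
    using raise_desc[of "insert (Suc i) (A - {i})" i] assms by (simp add: word_raise_lower_inverse)
qed

lemma col_word_cong: "(\<And>c. c \<in> set cs \<Longrightarrow> K c = K' c) \<Longrightarrow> col_word K cs = col_word K' cs"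
  by (simp add: col_word_def cong: map_cong)

lemma col_word_upd: "c \<notin> set cs \<Longrightarrow> col_word (K(c := A)) cs = col_word K cs"
  by (rule col_word_cong) auto

lemma col_word_upd_Cons:
  "c \<notin> set cs \<Longrightarrow> col_word (K(c := A)) (c # cs) = desc A @ col_word K cs"
  by (simp add: col_word_upd del: fun_upd_apply) simp

text \<open>
  The conditions on \<open>xs\<close> and \<open>ys\<close> say that column \<open>c\<close> holds the leftmost unpaired
  \<open>i + 1\<close>. What matters later is their consequence for the column read just before \<open>c\<close>: it
  cannot contain \<open>i + 1\<close> without \<open>i\<close>.
\<close>

lemma col_word_raise_elim:
  assumes "word_raise i (col_word K cs) = Some w'" "distinct cs" "\<And>c. finite (K c)"
  shows "\<exists>xs c ys. cs = xs @ c # ys \<and> Suc i \<in> K c \<and> i \<notin> K c \<and>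
    word_eps i (col_word K xs) = 0 \<and> word_phi i (col_word K ys) = 0 \<and>
    w' = col_word (K(c := insert i (K c - {Suc i}))) cs"
  using assms(1,2)
proof (induction cs arbitrary: w')
  case (Cons c cs)
  show ?case
  proof (cases "word_phi i (col_word K cs) < word_eps i (desc (K c))")
    case True
    then have *: "Suc i \<in> K c" "i \<notin> K c" "word_phi i (col_word K cs) = 0"
      using eps_phi_desc(1)[OF assms(3)] by (auto split: if_splits)
    then have w': "w' = desc (insert i (K c - {Suc i})) @ col_word K cs"
      using Cons.prems(1) True raise_desc[OF assms(3), of i c] by (simp add: word_raise_append)
    show ?thesis
    proof (rule exI[of _ "[]"], rule exI[of _ c], rule exI[of _ cs], intro conjI)
      show "w' = col_word (K(c := insert i (K c - {Suc i}))) (c # cs)"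
        using Cons.prems(2) by (subst col_word_upd_Cons) (auto simp: w')
    qed (use * in auto)
  next
    case False
    then obtain w1 where w1: "word_raise i (col_word K cs) = Some w1" "w' = desc (K c) @ w1"
      using Cons.prems(1) by (auto simp: word_raise_append)
    then obtain xs d ys where d: "cs = xs @ d # ys" "Suc i \<in> K d" "i \<notin> K d"
      "word_eps i (col_word K xs) = 0" "word_phi i (col_word K ys) = 0"
      "w1 = col_word (K(d := insert i (K d - {Suc i}))) cs"
      using Cons.IH Cons.prems(2) by (metis distinct.simps(2))
    have "word_phi i (col_word K cs) = word_phi i (col_word K xs)"
      using d eps_phi_desc[OF assms(3)] by (simp add: word_phi_append)
    then have e: "word_eps i (col_word K (c # xs)) = 0" using d False by (simp add: word_eps_append)
    have "c \<noteq> d" using d Cons.prems(2) by auto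
    show ?thesis
    proof (rule exI[of _ "c # xs"], rule exI[of _ d], rule exI[of _ ys], intro conjI)
      show "w' = col_word (K(d := insert i (K d - {Suc i}))) (c # cs)"
        unfolding col_word_simps(2) d(6)[symmetric] using w1(2) \<open>c \<noteq> d\<close> by simp
    qed (use d e in auto)
  qed
qed simp

lemma col_word_lower_elim:
  assumes "word_lower i (col_word K cs) = Some w'" "distinct cs" "\<And>c. finite (K c)"
  shows "\<exists>xs c ys. cs = xs @ c # ys \<and> i \<in> K c \<and> Suc i \<notin> K c \<and>
    word_eps i (col_word K xs) = 0 \<and> word_phi i (col_word K ys) = 0 \<and>
    w' = col_word (K(c := insert (Suc i) (K c - {i}))) cs"
  using assms(1,2)
proof (induction cs arbitrary: w')
  case (Cons c cs)
  show ?case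
  proof (cases "word_eps i (desc (K c)) < word_phi i (col_word K cs)")
    case False
    have "word_lower i (desc (K c)) \<noteq> None"
      using Cons.prems(1) False by (auto simp: word_lower_append)
    then have *: "i \<in> K c" "Suc i \<notin> K c" "word_phi i (col_word K cs) = 0"
      using eps_phi_desc[OF assms(3), of i c] False
      by (auto simp: word_lower_None_iff split: if_splits)
    then have w': "w' = desc (insert (Suc i) (K c - {i})) @ col_word K cs"
      using Cons.prems(1) False lower_desc[OF assms(3), of i c] by (simp add: word_lower_append)
    show ?thesis
    proof (rule exI[of _ "[]"], rule exI[of _ c], rule exI[of _ cs], intro conjI)
      show "w' = col_word (K(c := insert (Suc i) (K c - {i}))) (c # cs)"
        using Cons.prems(2) by (subst col_word_upd_Cons) (auto simp: w')
    qed (use * in auto)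
  next
    case True
    then obtain w1 where w1: "word_lower i (col_word K cs) = Some w1" "w' = desc (K c) @ w1"
      using Cons.prems(1) by (auto simp: word_lower_append)
    then obtain xs d ys where d: "cs = xs @ d # ys" "i \<in> K d" "Suc i \<notin> K d"
      "word_eps i (col_word K xs) = 0" "word_phi i (col_word K ys) = 0"
      "w1 = col_word (K(d := insert (Suc i) (K d - {i}))) cs"
      using Cons.IH Cons.prems(2) by (metis distinct.simps(2))
    have "word_phi i (col_word K cs) = Suc (word_phi i (col_word K xs))"
      using d eps_phi_desc[OF assms(3)] by (simp add: word_phi_append)
    then have e: "word_eps i (col_word K (c # xs)) = 0" using d True by (simp add: word_eps_append)
    have "c \<noteq> d" using d Cons.prems(2) by auto
    show ?thesis
    proof (rule exI[of _ "c # xs"], rule exI[of _ d], rule exI[of _ ys], intro conjI)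
      show "w' = col_word (K(d := insert (Suc i) (K d - {i}))) (c # cs)"
        unfolding col_word_simps(2) d(6)[symmetric] using w1(2) \<open>c \<noteq> d\<close> by simp
    qed (use d e in auto)
  qed
qed simp

lemma col_word_raise:
  assumes "cs = xs @ c # ys" "distinct cs" "\<And>c. finite (K c)" "Suc i \<in> K c" "i \<notin> K c"
    "word_eps i (col_word K xs) = 0" "word_phi i (col_word K ys) = 0"
  shows "word_raise i (col_word K cs) = Some (col_word (K(c := insert i (K c - {Suc i}))) cs)"
  using assms raise_desc[of "K c" i] eps_phi_desc[of "K c" i]
  by (simp add: word_raise_append word_phi_append col_word_upd)

lemma col_word_inj:
  assumes "col_word K cs = col_word K' cs" "\<And>c. finite (K c)" "\<And>c. finite (K' c)"
    "\<And>c. card (K c) = card (K' c)" "c \<in> set cs"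
  shows "K c = K' c"
  using assms(1,5)
proof (induction cs)
  case (Cons d cs)
  have "desc (K d) = desc (K' d) \<and> col_word K cs = col_word K' cs"
    using Cons.prems(1) assms(4) by (simp add: append_eq_append_conv)
  then show ?case using Cons assms(2,3) by (metis set_ConsD set_desc)
qed simp

section \<open>Column dominance\<close>

definition count_ge :: "nat set \<Rightarrow> nat \<Rightarrow> nat" where
  "count_ge A t = card {x \<in> A. t \<le> x}"

definition count_le :: "nat set \<Rightarrow> nat \<Rightarrow> nat" where
  "count_le A t = card {x \<in> A. x \<le> t}"

lemma count_ge_step: "finite A \<Longrightarrow> count_ge A t = (if t \<in> A then 1 else 0) + count_ge A (Suc t)"
proof -
  assume fin: "finite A"
  have "{x \<in> A. t \<le> x} = (if t \<in> A then insert t {x \<in> A. Suc t \<le> x} else {x \<in> A. Suc t \<le> x})"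
    by (auto simp: Suc_le_eq order_le_less)
  then show ?thesis using fin by (simp add: count_ge_def)
qed

lemma count_le_step:
  "finite A \<Longrightarrow> count_le A (Suc t) = (if Suc t \<in> A then 1 else 0) + count_le A t"
proof -
  assume fin: "finite A"
  have "{x \<in> A. x \<le> Suc t} =
      (if Suc t \<in> A then insert (Suc t) {x \<in> A. x \<le> t} else {x \<in> A. x \<le> t})"
    by (auto simp: le_Suc_eq)
  then show ?thesis using fin by (simp add: count_le_def)
qed

lemma count_ge_raise_column:
  assumes "finite A" "Suc i \<in> A" "i \<notin> A"
  shows "count_ge A t = count_ge (insert i (A - {Suc i})) t + (if t = Suc i then 1 else 0)"
proof -
  define X where "X = {x \<in> A. t \<le> x} - {Suc i}"
  have 1: "{x \<in> A. t \<le> x} = (if t \<le> Suc i then insert (Suc i) X else X)"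
    and 2: "{x \<in> insert i (A - {Suc i}). t \<le> x} = (if t \<le> i then insert i X else X)"
    using assms by (auto simp: X_def)
  have "finite X" "Suc i \<notin> X" "i \<notin> X" using assms by (auto simp: X_def)
  then show ?thesis unfolding count_ge_def 1 2 by (cases "t \<le> i"; cases "t = Suc i") auto
qed

lemma count_ge_le_card: "finite A \<Longrightarrow> count_ge A (Suc t) + count_le A t = card A"
proof -
  assume fin: "finite A"
  have "{x \<in> A. Suc t \<le> x} \<union> {x \<in> A. x \<le> t} = A" "{x \<in> A. Suc t \<le> x} \<inter> {x \<in> A. x \<le> t} = {}"
    by auto
  then show ?thesis using card_Un_disjoint[of "{x \<in> A. Suc t \<le> x}" "{x \<in> A. x \<le> t}"] fin
    by (simp add: count_ge_def count_le_def)
qed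

lemma card_replace: "finite A \<Longrightarrow> x \<in> A \<Longrightarrow> y \<notin> A \<Longrightarrow> card (insert y (A - {x})) = card A"
  using card_gt_0_iff[of A] by (auto simp: card_insert_disjoint)

lemma count_le_raise_column:
  assumes "finite A" "Suc i \<in> A" "i \<notin> A"
  shows "count_le (insert i (A - {Suc i})) t = count_le A t + (if t = i then 1 else 0)"
  using count_ge_raise_column[OF assms, of "Suc t"] count_ge_le_card[of A t]
    count_ge_le_card[of "insert i (A - {Suc i})" t] assms card_replace[of A "Suc i" i]
  by simp

lemma count_ge_lower_column:
  assumes "finite A" "i \<in> A" "Suc i \<notin> A"
  shows "count_ge (insert (Suc i) (A - {i})) t = count_ge A t + (if t = Suc i then 1 else 0)"
proof -
  have "insert i (insert (Suc i) (A - {i}) - {Suc i}) = A" using assms by auto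
  then show ?thesis using count_ge_raise_column[of "insert (Suc i) (A - {i})" i t] assms by simp
qed

lemma count_le_lower_column:
  assumes "finite A" "i \<in> A" "Suc i \<notin> A"
  shows "count_le A t = count_le (insert (Suc i) (A - {i})) t + (if t = i then 1 else 0)"
proof -
  have "insert i (insert (Suc i) (A - {i}) - {Suc i}) = A" using assms by auto
  then show ?thesis using count_le_raise_column[of "insert (Suc i) (A - {i})" i t] assms by simp
qed

definition cols_in :: "nat \<Rightarrow> (nat \<Rightarrow> nat) \<Rightarrow> (nat \<Rightarrow> nat set) \<Rightarrow> bool" where
  "cols_in n h K \<longleftrightarrow> (\<forall>c. K c \<subseteq> {1..n} \<and> card (K c) = h c)"

text \<open>
  In terms of the elements in decreasing order: the \<open>k\<close>-th element of \<open>K (c + 1)\<close> exists only if that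
  of \<open>K c\<close> does, and is at most as large. Counting makes this accessible without sorting.
  The condition for Young tableaux is the mirror image for elements in increasing order.
\<close>

definition anti_cols :: "nat \<Rightarrow> (nat \<Rightarrow> nat) \<Rightarrow> (nat \<Rightarrow> nat set) \<Rightarrow> bool" where
  "anti_cols n h K \<longleftrightarrow>
     cols_in n h K \<and> (\<forall>c\<ge>1. \<forall>t. count_ge (K (Suc c)) t \<le> count_ge (K c) t)"

definition young_cols :: "nat \<Rightarrow> (nat \<Rightarrow> nat) \<Rightarrow> (nat \<Rightarrow> nat set) \<Rightarrow> bool" where
  "young_cols n h K \<longleftrightarrow>
     cols_in n h K \<and> (\<forall>c\<ge>1. \<forall>t. count_le (K (Suc c)) t \<le> count_le (K c) t)"

lemma cols_in_finite: "cols_in n h K \<Longrightarrow> finite (K c)"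
  unfolding cols_in_def by (meson finite_atLeastAtMost finite_subset)

lemma cols_in_raise:
  assumes "cols_in n h K" "1 \<le> i" "Suc i \<in> K c" "i \<notin> K c"
  shows "cols_in n h (K(c := insert i (K c - {Suc i})))"
  using assms card_replace[OF cols_in_finite[OF assms(1)], of "Suc i" c i]
  unfolding cols_in_def by (auto simp: subset_iff) (meson Suc_leD)

lemma cols_in_lower:
  assumes "cols_in n h K" "i < n" "i \<in> K c" "Suc i \<notin> K c"
  shows "cols_in n h (K(c := insert (Suc i) (K c - {i})))"
  using assms card_replace[OF cols_in_finite[OF assms(1)], of i c "Suc i"]
  unfolding cols_in_def by auto

lemma rev_upt_split_at:
  "1 \<le> c \<Longrightarrow> c \<le> m \<Longrightarrow> rev [1..<Suc m] = rev [Suc c..<Suc m] @ c # rev [1..<c]"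
  using upt_add_eq_append[of 1 c "Suc m - c"] by (simp add: upt_conv_Cons)

lemma rev_upt_split:
  assumes "rev [1..<Suc m] = xs @ c # ys"
  shows "1 \<le> c" "c \<le> m" "xs = rev [Suc c..<Suc m]" "ys = rev [1..<c]"
proof -
  have "c \<in> set (rev [1..<Suc m])" using assms by simp
  then show "1 \<le> c" "c \<le> m" by auto
  then have *: "xs @ c # ys = rev [Suc c..<Suc m] @ c # rev [1..<c]"
    using assms rev_upt_split_at by metis
  have "distinct (xs @ c # ys)" using assms distinct_rev distinct_upt by metis
  then have "c \<notin> set xs" "c \<notin> set ys" by simp_all
  then have "xs = rev [Suc c..<Suc m] \<and> ys = rev [1..<c]"
    using * append_Cons_eq_iff by metis
  then show "xs = rev [Suc c..<Suc m]" "ys = rev [1..<c]" by blast+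
qed

lemma upt_split:
  assumes "[1..<Suc m] = xs @ c # ys"
  shows "1 \<le> c" "c \<le> m" "xs = [1..<c]" "ys = [Suc c..<Suc m]"
proof -
  have "rev [1..<Suc m] = rev ys @ c # rev xs" using assms by simp
  from rev_upt_split[OF this] show "1 \<le> c" "c \<le> m" "xs = [1..<c]" "ys = [Suc c..<Suc m]"
    by (simp_all add: rev_swap)
qed

lemma word_eps_snoc_col:
  assumes "finite (K c)" "word_eps i (col_word K (xs @ [c])) = 0"
  shows "\<not> (Suc i \<in> K c \<and> i \<notin> K c)"
  using assms eps_phi_desc[OF assms(1), of i] by (auto simp: word_eps_append split: if_splits)

lemma word_phi_Cons_col:
  assumes "finite (K c)" "word_phi i (col_word K (c # ys)) = 0"
  shows "\<not> (i \<in> K c \<and> Suc i \<notin> K c)"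
  using assms eps_phi_desc[OF assms(1), of i] by (auto simp: word_phi_append split: if_splits)

text \<open>
  Replacing \<open>i + 1\<close> by \<open>i\<close> in \<open>B\<close> affects only the count at \<open>i + 1\<close>. If
  the two counts were equal there, those at \<open>i\<close> and \<open>i + 2\<close> would force \<open>A\<close> to
  contain \<open>i + 1\<close> but not \<open>i\<close>; but \<open>A\<close> is the column read just before \<open>B\<close>, and
  the signature rule would have chosen it or an earlier column. The three lemmas that follow are variants for
  the lowering operator and for Young tableaux.
\<close>

lemma anti_pair_raise:
  assumes "finite A" "finite B" "\<And>t. count_ge A t \<le> count_ge B t" "Suc i \<in> B" "i \<notin> B"
    "\<not> (Suc i \<in> A \<and> i \<notin> A)"
  shows "count_ge A t \<le> count_ge (insert i (B - {Suc i})) t"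
proof -
  have "count_ge A (Suc i) < count_ge B (Suc i)"
    using assms(3)[of i] assms(3)[of "Suc (Suc i)"] assms(4-)
      count_ge_step[OF assms(1), of i] count_ge_step[OF assms(1), of "Suc i"]
      count_ge_step[OF assms(2), of i] count_ge_step[OF assms(2), of "Suc i"]
    by (cases "Suc i \<in> A"; cases "i \<in> A"; simp)
  then show ?thesis
    using assms(3)[of t] count_ge_raise_column[OF assms(2,4,5), of t] by (cases "t = Suc i") auto
qed

lemma anti_pair_lower:
  assumes "finite A" "finite B" "\<And>t. count_ge A t \<le> count_ge B t" "i \<in> A" "Suc i \<notin> A"
    "\<not> (i \<in> B \<and> Suc i \<notin> B)"
  shows "count_ge (insert (Suc i) (A - {i})) t \<le> count_ge B t"
proof -
  have "count_ge A (Suc i) < count_ge B (Suc i)"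
    using assms(3)[of i] assms(3)[of "Suc (Suc i)"] assms(4-)
      count_ge_step[OF assms(1), of i] count_ge_step[OF assms(1), of "Suc i"]
      count_ge_step[OF assms(2), of i] count_ge_step[OF assms(2), of "Suc i"]
    by (cases "Suc i \<in> B"; cases "i \<in> B"; simp)
  then show ?thesis
    using assms(3)[of t] count_ge_lower_column[OF assms(1,4,5), of t] by (cases "t = Suc i") auto
qed

lemma young_pair_raise:
  assumes "finite A" "finite B" "\<And>t. count_le B t \<le> count_le A t" "1 \<le> i" "Suc i \<in> B" "i \<notin> B"
    "\<not> (Suc i \<in> A \<and> i \<notin> A)"
  shows "count_le (insert i (B - {Suc i})) t \<le> count_le A t"
proof -
  obtain j where j: "i = Suc j" using assms(4) by (cases i) auto
  have "count_le B i < count_le A i"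
    using assms(3)[of j] assms(3)[of "Suc i"] assms(5-)
      count_le_step[OF assms(1), of i] count_le_step[OF assms(1), of j]
      count_le_step[OF assms(2), of i] count_le_step[OF assms(2), of j] unfolding j
    by (cases "Suc (Suc j) \<in> A"; cases "Suc j \<in> A"; simp)
  then show ?thesis
    using assms(3)[of t] count_le_raise_column[OF assms(2,5,6), of t] by (cases "t = i") auto
qed

lemma young_pair_lower:
  assumes "finite A" "finite B" "\<And>t. count_le B t \<le> count_le A t" "1 \<le> i" "i \<in> A" "Suc i \<notin> A"
    "\<not> (i \<in> B \<and> Suc i \<notin> B)"
  shows "count_le B t \<le> count_le (insert (Suc i) (A - {i})) t"
proof -
  obtain j where j: "i = Suc j" using assms(4) by (cases i) auto
  have "count_le B i < count_le A i"
    using assms(3)[of j] assms(3)[of "Suc i"] assms(5-)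
      count_le_step[OF assms(1), of i] count_le_step[OF assms(1), of j]
      count_le_step[OF assms(2), of i] count_le_step[OF assms(2), of j] unfolding j
    by (cases "Suc (Suc j) \<in> B"; cases "Suc j \<in> B"; simp)
  then show ?thesis
    using assms(3)[of t] count_le_lower_column[OF assms(1,5,6), of t] by (cases "t = i") auto
qed

lemma anti_cols_raise:
  assumes K: "anti_cols n h K" and h: "h (Suc m) = 0" and i: "1 \<le> i"
    and w: "word_raise i (col_word K (rev [1..<Suc m])) = Some w'"
  shows "\<exists>K'. anti_cols n h K' \<and> w' = col_word K' (rev [1..<Suc m])"
proof -
  have cin: "cols_in n h K" using K by (simp add: anti_cols_def)
  note fin = cols_in_finite[OF cin]
  have le: "count_ge (K (Suc d)) t \<le> count_ge (K d) t" if "1 \<le> d" for d t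
    using K that by (simp add: anti_cols_def)
  obtain xs c ys where c: "rev [1..<Suc m] = xs @ c # ys" "Suc i \<in> K c" "i \<notin> K c"
    "word_eps i (col_word K xs) = 0" "word_phi i (col_word K ys) = 0"
    and w': "w' = col_word (K(c := insert i (K c - {Suc i}))) (rev [1..<Suc m])"
    using col_word_raise_elim[OF w _ fin] distinct_rev distinct_upt by blast
  note sp = rev_upt_split[OF c(1)]
  have nplus: "\<not> (Suc i \<in> K (Suc c) \<and> i \<notin> K (Suc c))"
  proof (cases "c = m")
    case True
    then have "card (K (Suc c)) = 0" using cin h by (simp add: cols_in_def)
    then show ?thesis using fin[of "Suc c"] by simp
  next
    case False
    then have *: "xs = rev [Suc (Suc c)..<Suc m] @ [Suc c]"
      using sp by (simp add: upt_conv_Cons)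
    show ?thesis by (rule word_eps_snoc_col[OF fin c(4)[unfolded *]])
  qed
  have "anti_cols n h (K(c := insert i (K c - {Suc i})))"
    unfolding anti_cols_def
  proof (intro conjI allI impI cols_in_raise cin i c)
    fix d t :: nat assume d: "1 \<le> d"
    show "count_ge ((K(c := insert i (K c - {Suc i}))) (Suc d)) t
        \<le> count_ge ((K(c := insert i (K c - {Suc i}))) d) t"
      using le[OF d, of t] count_ge_raise_column[OF fin c(2,3), of t]
        anti_pair_raise[OF fin fin le[of c] c(2,3) nplus, of t] sp(1)
      by auto
  qed
  then show ?thesis using w' by blast
qed

lemma anti_cols_lower:
  assumes K: "anti_cols n h K" and h: "h 0 = 0" and i: "i < n"
    and w: "word_lower i (col_word K (rev [1..<Suc m])) = Some w'"
  shows "\<exists>K'. anti_cols n h K' \<and> w' = col_word K' (rev [1..<Suc m])"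
proof -
  have cin: "cols_in n h K" using K by (simp add: anti_cols_def)
  note fin = cols_in_finite[OF cin]
  have le: "count_ge (K (Suc d)) t \<le> count_ge (K d) t" if "1 \<le> d" for d t
    using K that by (simp add: anti_cols_def)
  obtain xs c ys where c: "rev [1..<Suc m] = xs @ c # ys" "i \<in> K c" "Suc i \<notin> K c"
    "word_eps i (col_word K xs) = 0" "word_phi i (col_word K ys) = 0"
    and w': "w' = col_word (K(c := insert (Suc i) (K c - {i}))) (rev [1..<Suc m])"
    using col_word_lower_elim[OF w _ fin] distinct_rev distinct_upt by blast
  note sp = rev_upt_split[OF c(1)]
  have nminus: "\<not> (i \<in> K d \<and> Suc i \<notin> K d)" if d: "c = Suc d" "1 \<le> d" for d
  proof -
    have *: "ys = d # rev [1..<d]" using sp d by simp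
    show ?thesis by (rule word_phi_Cons_col[OF fin c(5)[unfolded *]])
  qed
  have "anti_cols n h (K(c := insert (Suc i) (K c - {i})))"
    unfolding anti_cols_def
  proof (intro conjI allI impI cols_in_lower cin i c)
    fix d t :: nat assume d: "1 \<le> d"
    show "count_ge ((K(c := insert (Suc i) (K c - {i}))) (Suc d)) t
        \<le> count_ge ((K(c := insert (Suc i) (K c - {i}))) d) t"
      using le[OF d, of t] count_ge_lower_column[OF fin c(2,3), of t]
        anti_pair_lower[OF fin fin le[OF d], of i t] c(2,3) nminus[OF _ d]
      by auto
  qed
  then show ?thesis using w' by blast
qed

lemma young_cols_raise:
  assumes K: "young_cols n h K" and i: "1 \<le> i"
    and w: "word_raise i (col_word K [1..<Suc m]) = Some w'"
  shows "\<exists>K'. young_cols n h K' \<and> w' = col_word K' [1..<Suc m]"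
proof -
  have cin: "cols_in n h K" using K by (simp add: young_cols_def)
  note fin = cols_in_finite[OF cin]
  have le: "count_le (K (Suc d)) t \<le> count_le (K d) t" if "1 \<le> d" for d t
    using K that by (simp add: young_cols_def)
  obtain xs c ys where c: "[1..<Suc m] = xs @ c # ys" "Suc i \<in> K c" "i \<notin> K c"
    "word_eps i (col_word K xs) = 0" "word_phi i (col_word K ys) = 0"
    and w': "w' = col_word (K(c := insert i (K c - {Suc i}))) [1..<Suc m]"
    using col_word_raise_elim[OF w _ fin] distinct_upt by blast
  note sp = upt_split[OF c(1)]
  have nplus: "\<not> (Suc i \<in> K d \<and> i \<notin> K d)" if d: "c = Suc d" "1 \<le> d" for d
  proof -
    have *: "xs = [1..<d] @ [d]" using sp d by simp
    show ?thesis by (rule word_eps_snoc_col[OF fin c(4)[unfolded *]])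
  qed
  have "young_cols n h (K(c := insert i (K c - {Suc i})))"
    unfolding young_cols_def
  proof (intro conjI allI impI cols_in_raise cin i c)
    fix d t :: nat assume d: "1 \<le> d"
    show "count_le ((K(c := insert i (K c - {Suc i}))) (Suc d)) t
        \<le> count_le ((K(c := insert i (K c - {Suc i}))) d) t"
      using le[OF d, of t] count_le_raise_column[OF fin c(2,3), of t]
        young_pair_raise[OF fin fin le[OF d] i, of t] c(2,3) nplus[OF _ d]
      by auto
  qed
  then show ?thesis using w' by blast
qed

lemma young_cols_lower:
  assumes K: "young_cols n h K" and h: "h (Suc m) = 0" and i: "1 \<le> i" "i < n"
    and w: "word_lower i (col_word K [1..<Suc m]) = Some w'"
  shows "\<exists>K'. young_cols n h K' \<and> w' = col_word K' [1..<Suc m]"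
proof -
  have cin: "cols_in n h K" using K by (simp add: young_cols_def)
  note fin = cols_in_finite[OF cin]
  have le: "count_le (K (Suc d)) t \<le> count_le (K d) t" if "1 \<le> d" for d t
    using K that by (simp add: young_cols_def)
  obtain xs c ys where c: "[1..<Suc m] = xs @ c # ys" "i \<in> K c" "Suc i \<notin> K c"
    "word_eps i (col_word K xs) = 0" "word_phi i (col_word K ys) = 0"
    and w': "w' = col_word (K(c := insert (Suc i) (K c - {i}))) [1..<Suc m]"
    using col_word_lower_elim[OF w _ fin] distinct_upt by blast
  note sp = upt_split[OF c(1)]
  have nminus: "\<not> (i \<in> K (Suc c) \<and> Suc i \<notin> K (Suc c))"
  proof (cases "c = m")
    case True
    then have "card (K (Suc c)) = 0" using cin h by (simp add: cols_in_def)
    then show ?thesis using fin[of "Suc c"] by simp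
  next
    case False
    then have *: "ys = Suc c # [Suc (Suc c)..<Suc m]"
      using sp by (simp add: upt_conv_Cons)
    show ?thesis by (rule word_phi_Cons_col[OF fin c(5)[unfolded *]])
  qed
  have "young_cols n h (K(c := insert (Suc i) (K c - {i})))"
    unfolding young_cols_def
  proof (intro conjI allI impI cols_in_lower cin i c)
    fix d t :: nat assume d: "1 \<le> d"
    show "count_le ((K(c := insert (Suc i) (K c - {i}))) (Suc d)) t
        \<le> count_le ((K(c := insert (Suc i) (K c - {i}))) d) t"
      using le[OF d, of t] count_le_lower_column[OF fin c(2,3), of t]
        young_pair_lower[OF fin fin le[of c] i(1) c(2,3) nminus, of t] sp(1)
      by auto
  qed
  then show ?thesis using w' by blast
qed

section \<open>Highest weight words\<close>

lemma initial_segment: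
  fixes A :: "nat set"
  assumes "finite A" "0 \<notin> A" "\<And>i. 1 \<le> i \<Longrightarrow> Suc i \<in> A \<Longrightarrow> i \<in> A"
  shows "A = {1..card A}"
proof (cases "A = {}")
  case False
  have down: "k \<in> A \<Longrightarrow> 1 \<le> j \<Longrightarrow> j \<le> k \<Longrightarrow> j \<in> A" for j k
  proof (induction k)
    case (Suc k)
    then show ?case using assms(3)[of k] by (cases "j = Suc k") auto
  qed simp
  have "A = {1..Max A}"
  proof
    have "1 \<le> x" if "x \<in> A" for x using that assms(2) by (cases x) auto
    then show "A \<subseteq> {1..Max A}" using assms(1) by auto
    show "{1..Max A} \<subseteq> A" using down[OF Max_in[OF assms(1) False]] by auto
  qed
  then show ?thesis by (metis card_atLeastAtMost diff_Suc_1)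
qed simp

text \<open>
  An \<open>i + 1\<close> without \<open>i\<close> in the first column must be paired with an \<open>i\<close> behind it, and an
  initial column offers only its largest entry for that.
\<close>

lemma highest_word_column:
  assumes "word_eps i (col_word K (c # cs)) = 0" "finite (K c)"
    "\<And>d. d \<in> set cs \<Longrightarrow> K d = {1..k d}" "Suc i \<in> K c" "i \<notin> K c" "1 \<le> i"
  shows "\<exists>d\<in>set cs. k d = i"
proof (rule ccontr)
  assume none: "\<not> ?thesis"
  have "word_phi i (col_word K ds) = 0" if "set ds \<subseteq> set cs" for ds
    using that
  proof (induction ds)
    case (Cons d ds)
    then have "k d \<noteq> i" "K d = {1..k d}" using none assms(3) by auto
    then have "word_phi i (desc (K d)) = 0"
      using eps_phi_desc(2)[of "K d" i] by auto
    then show ?case using Cons by (simp add: word_phi_append)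
  qed simp
  from this[of cs] have "word_phi i (col_word K cs) = 0" by simp
  then show False using assms eps_phi_desc(1)[of "K c" i] by (simp add: word_eps_append)
qed

lemma word_eps_suffix: "word_eps i (u @ v) = 0 \<Longrightarrow> word_eps i v = 0"
  by (simp add: word_eps_append)

text \<open>
  The columns are initial segments, shown from column 1 onwards. Otherwise some column \<open>d < c\<close> would be
  \<open>{1..i}\<close>, although it dominates the column \<open>c\<close>, which contains \<open>i + 1\<close>.
\<close>

lemma anti_cols_highest:
  assumes K: "anti_cols n h K" and high: "\<And>i. i \<in> {1..<n} \<Longrightarrow> word_eps i (col_word K (rev [1..<Suc m])) = 0"
    and c: "c \<in> {1..m}"
  shows "K c = {1..h c}"
proof -
  have cin: "cols_in n h K" using K by (simp add: anti_cols_def)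
  note fin = cols_in_finite[OF cin]
  have sub: "K c \<subseteq> {1..n}" and card: "card (K c) = h c" for c using cin by (auto simp: cols_in_def)
  have chain: "count_ge (K (d + j)) t \<le> count_ge (K d) t" if "1 \<le> d" for d j t
  proof (induction j)
    case (Suc j)
    then show ?case using K that unfolding anti_cols_def
      by (metis add_Suc_right le_add1 le_trans)
  qed simp
  have "c \<le> m \<Longrightarrow> 1 \<le> c \<Longrightarrow> K c = {1..h c}" for c
  proof (induction c rule: less_induct)
    case (less c)
    have "K c = {1..card (K c)}"
    proof (rule initial_segment[OF fin])
      show "0 \<notin> K c" using sub[of c] by auto
      fix i assume i: "1 \<le> i" "Suc i \<in> K c"
      show "i \<in> K c"
      proof (rule ccontr)
        assume ni: "i \<notin> K c"
        have "rev [1..<Suc m] = rev [Suc c..<Suc m] @ c # rev [1..<c]"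
          using less.prems by (intro rev_upt_split_at)
        moreover have "i \<in> {1..<n}" using i sub[of c] by auto
        ultimately have e: "word_eps i (col_word K (c # rev [1..<c])) = 0"
          using high[of i] word_eps_suffix[of i "col_word K (rev [Suc c..<Suc m])"]
          by (metis col_word_simps(3))
        have IH: "K d = {1..h d}" if "d \<in> set (rev [1..<c])" for d
          using less.IH[of d] less.prems that by auto
        obtain d where d: "d \<in> set (rev [1..<c])" "h d = i"
          using highest_word_column[where k = h, OF e fin IH i(2) ni i(1)] by (rule bexE)
        then have "K d = {1..i}" using IH[OF d(1)] by simp
        then have "{x \<in> K d. Suc i \<le> x} = {}" by (simp add: set_eq_iff)
        then have "count_ge (K d) (Suc i) = 0" by (simp only: count_ge_def card.empty)
        moreover have "count_ge (K c) (Suc i) \<le> count_ge (K d) (Suc i)"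
          using chain[of d "c - d"] d by auto
        ultimately show False using count_ge_step[OF fin, of c "Suc i"] i by simp
      qed
    qed
    then show ?case using card by simp
  qed
  then show ?thesis using c by simp
qed

text \<open>
  Here the induction starts at the last column. If \<open>i + 1\<close> but not \<open>i\<close> belonged to
  column \<open>c\<close>, some column \<open>d > c\<close> would be \<open>{1..i}\<close>, and dominance would put all of
  \<open>{1..i}\<close> into column \<open>c\<close>.
\<close>

lemma young_cols_highest:
  assumes K: "young_cols n h K" and high: "\<And>i. i \<in> {1..<n} \<Longrightarrow> word_eps i (col_word K [1..<Suc m]) = 0"
    and c: "c \<in> {1..m}"
  shows "K c = {1..h c}"
proof -
  have cin: "cols_in n h K" using K by (simp add: young_cols_def)
  note fin = cols_in_finite[OF cin]
  have sub: "K c \<subseteq> {1..n}" and card: "card (K c) = h c" for c using cin by (auto simp: cols_in_def)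
  have chain: "count_le (K (d + j)) t \<le> count_le (K d) t" if "1 \<le> d" for d j t
  proof (induction j)
    case (Suc j)
    then show ?case using K that unfolding young_cols_def
      by (metis add_Suc_right le_add1 le_trans)
  qed simp
  have "c \<le> m \<Longrightarrow> 1 \<le> c \<Longrightarrow> K c = {1..h c}" for c
  proof (induction "m - c" arbitrary: c rule: less_induct)
    case (less c)
    have "K c = {1..card (K c)}"
    proof (rule initial_segment[OF fin])
      show "0 \<notin> K c" using sub[of c] by auto
      fix i assume i: "1 \<le> i" "Suc i \<in> K c"
      show "i \<in> K c"
      proof (rule ccontr)
        assume ni: "i \<notin> K c"
        have "[1..<Suc m] = [1..<c] @ c # [Suc c..<Suc m]"
          using less.prems upt_add_eq_append[of 1 c "Suc m - c"] by (simp add: upt_conv_Cons)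
        moreover have "i \<in> {1..<n}" using i sub[of c] by auto
        ultimately have e: "word_eps i (col_word K (c # [Suc c..<Suc m])) = 0"
          using high[of i] word_eps_suffix[of i "col_word K [1..<c]"]
          by (metis col_word_simps(3))
        have IH: "K d = {1..h d}" if "d \<in> set [Suc c..<Suc m]" for d
          using less.hyps[of d] less.prems that by auto
        obtain d where d: "d \<in> set [Suc c..<Suc m]" "h d = i"
          using highest_word_column[where k = h, OF e fin IH i(2) ni i(1)] by (rule bexE)
        then have "K d = {1..i}" using IH[OF d(1)] by simp
        then have "{x \<in> K d. x \<le> i} = {1..i}" by (simp add: set_eq_iff)
        then have "count_le (K d) i = i" by (simp add: count_le_def)
        moreover have "count_le (K d) i \<le> count_le (K c) i"
          using chain[of c "d - c"] d less.prems by auto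
        ultimately have "card {1..i} \<le> card {x \<in> K c. x \<le> i}" by (simp add: count_le_def)
        moreover have "{x \<in> K c. x \<le> i} \<subseteq> {1..i}" using sub[of c] by auto
        ultimately have "{x \<in> K c. x \<le> i} = {1..i}" using card_seteq finite_atLeastAtMost by blast
        moreover have "i \<in> {1..i}" using i(1) by simp
        ultimately show False using ni by blast
      qed
    qed
    then show ?case using card by simp
  qed
  then show ?thesis using c by simp
qed

section \<open>Key tableaux and their column sets\<close>

definition col_set :: "nat \<Rightarrow> (nat \<Rightarrow> nat) \<Rightarrow> filling \<Rightarrow> nat \<Rightarrow> nat set" where
  "col_set n a T c = (\<lambda>r. T (r, c)) ` {r. (r, c) \<in> diagram n a}"

definition col_height :: "nat \<Rightarrow> (nat \<Rightarrow> nat) \<Rightarrow> nat \<Rightarrow> nat" where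
  "col_height n a c = card {r. (r, c) \<in> diagram n a}"

lemma diagram_iff: "(r, c) \<in> diagram n a \<longleftrightarrow> 1 \<le> r \<and> r \<le> n \<and> 1 \<le> c \<and> c \<le> a r"
  by (simp add: diagram_def)

lemma finite_diagram_col [simp]: "finite {r. (r, c) \<in> diagram n a}"
  by (rule finite_subset[of _ "{..n}"]) (auto simp: diagram_iff)

lemma finite_col_set [simp]: "finite (col_set n a T c)"
  by (simp add: col_set_def)

lemma filling_eq_0_iff: "is_filling n a T \<Longrightarrow> T x = 0 \<longleftrightarrow> x \<notin> diagram n a"
  unfolding is_filling_def by (metis less_one linorder_not_less zero_less_iff_neq_zero)

text \<open>
  Since fillings vanish outside the diagram, membership in the diagram can be read off from the values. This
  removes the diagram from the defining conditions.
\<close>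

lemma key_tableau_iff:
  "key_tableau n a T \<longleftrightarrow> is_filling n a T \<and>
     (\<forall>r s c. r \<noteq> s \<longrightarrow> T (r, c) \<noteq> 0 \<longrightarrow> T (r, c) \<noteq> T (s, c)) \<and>
     (\<forall>r c. 1 \<le> c \<longrightarrow> T (r, Suc c) \<le> T (r, c)) \<and>
     (\<forall>r s c. s < r \<longrightarrow> T (r, c) \<noteq> 0 \<longrightarrow> T (r, c) < T (s, c) \<longrightarrow> T (r, c) < T (s, Suc c))"
    (is "?L \<longleftrightarrow> ?R")
proof
  assume L: ?L
  then have f: "is_filling n a T" by (simp add: key_tableau_def)
  note z = filling_eq_0_iff[OF f]
  show ?R
  proof (intro conjI f allI impI)
    fix r s c assume "r \<noteq> s" "T (r, c) \<noteq> 0"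
    then show "T (r, c) \<noteq> T (s, c)" using L z unfolding key_tableau_def by metis
  next
    fix r c :: nat assume c: "1 \<le> c"
    show "T (r, Suc c) \<le> T (r, c)"
    proof (cases "(r, Suc c) \<in> diagram n a")
      case True
      then have "(r, c) \<in> diagram n a" using c by (simp add: diagram_iff)
      then show ?thesis using True L unfolding key_tableau_def by (metis le_SucI order_refl)
    next
      case False
      then have "T (r, Suc c) = 0" using z by simp
      then show ?thesis by simp
    qed
  next
    fix r s c assume *: "s < r" "T (r, c) \<noteq> 0" "T (r, c) < T (s, c)"
    then have "(r, c) \<in> diagram n a" "(s, c) \<in> diagram n a"
      using z[of "(r, c)"] z[of "(s, c)"] by auto
    then show "T (r, c) < T (s, Suc c)" using L * unfolding key_tableau_def by auto
  qed
next
  assume R: ?R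
  then have f: "is_filling n a T" by blast
  note z = filling_eq_0_iff[OF f]
  show ?L
    unfolding key_tableau_def
  proof (intro conjI f allI impI)
    fix r s c assume "(r, c) \<in> diagram n a \<and> (s, c) \<in> diagram n a \<and> r \<noteq> s"
    then show "T (r, c) \<noteq> T (s, c)" using R z by metis
  next
    fix r c d assume *: "(r, c) \<in> diagram n a \<and> (r, d) \<in> diagram n a \<and> c \<le> d"
    then have "c \<le> d" by simp
    then show "T (r, d) \<le> T (r, c)"
    proof (induction rule: dec_induct)
      case (step k)
      then have "1 \<le> k" using * by (simp add: diagram_iff)
      then show ?case using R step.IH le_trans by blast
    qed simp
  next
    fix r s c assume *: "(r, c) \<in> diagram n a \<and> (s, c) \<in> diagram n a \<and> s < r \<and> T (r, c) < T (s, c)"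
    then have lt: "T (r, c) < T (s, Suc c)" using R z by blast
    then have "T (s, Suc c) \<noteq> 0" by simp
    then show "(s, c + 1) \<in> diagram n a" using z by auto
    show "T (r, c) < T (s, c + 1)" using lt by simp
  qed
qed

lemma key_tableauD:
  assumes "key_tableau n a T"
  shows "is_filling n a T"
    and "r \<noteq> s \<Longrightarrow> T (r, c) \<noteq> 0 \<Longrightarrow> T (r, c) \<noteq> T (s, c)"
    and "1 \<le> c \<Longrightarrow> T (r, Suc c) \<le> T (r, c)"
    and "s < r \<Longrightarrow> T (r, c) \<noteq> 0 \<Longrightarrow> T (r, c) < T (s, c) \<Longrightarrow> T (r, c) < T (s, Suc c)"
  using assms unfolding key_tableau_iff by blast+

lemma key_tableau_eq_0_iff: "key_tableau n a T \<Longrightarrow> T x = 0 \<longleftrightarrow> x \<notin> diagram n a"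
  by (rule filling_eq_0_iff[OF key_tableauD(1)])

lemma key_tableau_row_le:
  assumes "key_tableau n a T" "1 \<le> c" "c \<le> d"
  shows "T (r, d) \<le> T (r, c)"
  using assms(3)
proof (induction rule: dec_induct)
  case (step k)
  then show ?case using key_tableauD(3)[OF assms(1), of k r] assms(2) by auto
qed simp

lemma inj_on_column:
  assumes "is_filling n a T" "\<And>r s. r \<noteq> s \<Longrightarrow> T (r, c) \<noteq> 0 \<Longrightarrow> T (r, c) \<noteq> T (s, c)"
  shows "inj_on (\<lambda>r. T (r, c)) {r. (r, c) \<in> diagram n a}"
  using assms filling_eq_0_iff[OF assms(1)] by (intro inj_onI) blast

lemma card_col_set:
  assumes "is_filling n a T" "\<And>r s. r \<noteq> s \<Longrightarrow> T (r, c) \<noteq> 0 \<Longrightarrow> T (r, c) \<noteq> T (s, c)"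
  shows "card (col_set n a T c) = col_height n a c"
  unfolding col_set_def col_height_def by (rule card_image[OF inj_on_column[OF assms]])

lemma card_filter_col_set:
  assumes "is_filling n a T" "\<And>r s. r \<noteq> s \<Longrightarrow> T (r, c) \<noteq> 0 \<Longrightarrow> T (r, c) \<noteq> T (s, c)"
  shows "card {x \<in> col_set n a T c. P x} = card {r. (r, c) \<in> diagram n a \<and> P (T (r, c))}"
proof -
  have "{x \<in> col_set n a T c. P x} = (\<lambda>r. T (r, c)) ` {r. (r, c) \<in> diagram n a \<and> P (T (r, c))}"
    by (auto simp: col_set_def)
  then show ?thesis
    using card_image[OF inj_on_subset[OF inj_on_column[OF assms]], of "{r. (r, c) \<in> diagram n a \<and> P (T (r, c))}"]
    by auto
qed

lemma card_filter_col_set_mono: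
  assumes "is_filling n a T" "\<And>r s c. r \<noteq> s \<Longrightarrow> T (r, c) \<noteq> 0 \<Longrightarrow> T (r, c) \<noteq> T (s, c)"
    and "\<And>r. (r, d) \<in> diagram n a \<Longrightarrow> P (T (r, d)) \<Longrightarrow> (r, c) \<in> diagram n a \<and> P (T (r, c))"
  shows "card {x \<in> col_set n a T d. P x} \<le> card {x \<in> col_set n a T c. P x}"
proof -
  have "card {r. (r, d) \<in> diagram n a \<and> P (T (r, d))} \<le> card {r. (r, c) \<in> diagram n a \<and> P (T (r, c))}"
    using assms(3) by (intro card_mono) (auto intro: finite_subset[OF _ finite_diagram_col[of c n a]])
  then show ?thesis
    using card_filter_col_set[OF assms(1,2), of d P] card_filter_col_set[OF assms(1,2), of c P] by simp
qed

lemma count_gt_col_set: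
  assumes "key_tableau n a T"
  shows "count_ge (col_set n a T c) (Suc i) = card {r. i < T (r, c)}"
proof -
  have "{r. (r, c) \<in> diagram n a \<and> Suc i \<le> T (r, c)} = {r. i < T (r, c)}"
    using key_tableau_eq_0_iff[OF assms] by (auto simp: Suc_le_eq) (metis not_less_zero)
  then show ?thesis
    using card_filter_col_set[OF key_tableauD(1,2)[OF assms], of c "\<lambda>x. Suc i \<le> x"]
    by (simp add: count_ge_def)
qed

lemma mem_col_set_iff:
  assumes "is_filling n a T" "k \<noteq> 0"
  shows "k \<in> col_set n a T c \<longleftrightarrow> (\<exists>s. T (s, c) = k)"
  using filling_eq_0_iff[OF assms(1)] assms(2) unfolding col_set_def by force

text \<open>
  Rows decrease, so the bound by the row index need only be checked in the first column.
\<close>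

lemma SSKT_iff: "T \<in> SSKT n a \<longleftrightarrow> key_tableau n a T \<and> (\<forall>r. T (r, 1) \<le> r)"
proof
  assume T: "T \<in> SSKT n a"
  then have kt: "key_tableau n a T" by (simp add: SSKT_def)
  have "T (r, 1) \<le> r" for r
    using T key_tableau_eq_0_iff[OF kt, of "(r, 1)"]
    by (cases "(r, 1) \<in> diagram n a") (auto simp: SSKT_def)
  then show "key_tableau n a T \<and> (\<forall>r. T (r, 1) \<le> r)" using kt by blast
next
  assume T: "key_tableau n a T \<and> (\<forall>r. T (r, 1) \<le> r)"
  then have "T (r, c) \<le> r" if "(r, c) \<in> diagram n a" for r c
    using key_tableau_row_le[of n a T 1 c r] that
    by (metis diagram_iff le_trans order_refl)
  then show "T \<in> SSKT n a" using T by (simp add: SSKT_def)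
qed

lemma SSKT_le:
  assumes "T \<in> SSKT n a"
  shows "T x \<le> n"
proof (cases "x \<in> diagram n a")
  case True
  then show ?thesis using assms by (cases x) (fastforce simp: SSKT_def diagram_iff)
next
  case False
  then show ?thesis using assms key_tableau_eq_0_iff[of n a T x] by (simp add: SSKT_def)
qed

lemma anti_cols_col_set:
  assumes "T \<in> SSKT n a"
  shows "anti_cols n (col_height n a) (col_set n a T)"
proof -
  have kt: "key_tableau n a T" using assms by (simp add: SSKT_def)
  note fill = key_tableauD(1,2)[OF kt]
  have "col_set n a T c \<subseteq> {1..n}" for c
    using SSKT_le[OF assms] fill(1) by (auto simp: col_set_def is_filling_def)
  moreover have "count_ge (col_set n a T (Suc c)) t \<le> count_ge (col_set n a T c) t" if "1 \<le> c" for c t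
    unfolding count_ge_def using that key_tableauD(3)[OF kt that]
    by (intro card_filter_col_set_mono[OF fill]) (auto simp: diagram_iff intro: le_trans)
  ultimately show ?thesis using card_col_set[OF fill] by (auto simp: anti_cols_def cols_in_def)
qed

section \<open>Column sets determine a key tableau\<close>

lemma card_split_row:
  fixes f :: "nat \<Rightarrow> nat"
  assumes "finite {s. i < f s}"
  shows "card {s. i < f s} =
    card {s. s < r \<and> i < f s} + (if i < f r then 1 else 0) + card {s. r < s \<and> i < f s}"
proof -
  have fin: "finite {s. P s \<and> i < f s}" for P using assms by (rule rev_finite_subset) auto
  have 1: "{s. i < f s} = {s. s < r \<and> i < f s} \<union> ({s. s = r \<and> i < f s} \<union> {s. r < s \<and> i < f s})"
    by auto
  have 2: "{s. s = r \<and> i < f s} = (if i < f r then {r} else {})" by auto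
  have 3: "card {s. i < f s} =
      card {s. s < r \<and> i < f s} + card ({s. s = r \<and> i < f s} \<union> {s. r < s \<and> i < f s})"
    unfolding 1 using fin by (intro card_Un_disjoint) auto
  have 4: "card ({s. s = r \<and> i < f s} \<union> {s. r < s \<and> i < f s}) =
      card {s. s = r \<and> i < f s} + card {s. r < s \<and> i < f s}"
    using fin by (intro card_Un_disjoint) auto
  show ?thesis unfolding 3 4 2 using fin[of "\<lambda>s. r < s"] by simp
qed

text \<open>
  Put \<open>i = T (r, c)\<close> and count the entries greater than \<open>i\<close> below row \<open>r\<close>. In \<open>T\<close> the
  key condition continues each of them from column \<open>c\<close> to column \<open>c + 1\<close>, so their number does not
  decrease. In \<open>S\<close> it does not increase, because rows decrease. Both tableaux have the same number in
  column \<open>c + 1\<close>, but in column \<open>c\<close> there is one more in \<open>T\<close>, since \<open>S\<close>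
  spends one of these entries on row \<open>r\<close>.
\<close>

lemma key_tableau_no_first_difference:
  assumes T: "key_tableau n a T" and S: "key_tableau n a S"
    and cols: "\<And>c. col_set n a T c = col_set n a S c"
    and above: "\<And>s c. r < s \<Longrightarrow> T (s, c) = S (s, c)"
    and right: "T (r, Suc c) = S (r, Suc c)"
    and less: "T (r, c) < S (r, c)" and nz: "T (r, c) \<noteq> 0"
  shows False
proof -
  define i where "i = T (r, c)"
  note zT = key_tableau_eq_0_iff[OF T] and zS = key_tableau_eq_0_iff[OF S]
  have fin: "finite {s. i < T (s, d)}" "finite {s. i < S (s, d)}" for d
    by (rule finite_subset[OF _ finite_diagram_col[of d n a]]; use zT zS in force)+
  have eq: "card {s. i < T (s, d)} = card {s. i < S (s, d)}" for d
    using count_gt_col_set[OF T, of d i] count_gt_col_set[OF S, of d i] cols by simp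
  have ab: "{s. r < s \<and> i < T (s, d)} = {s. r < s \<and> i < S (s, d)}" for d
    using above by auto
  have 1: "card {s. s < r \<and> i < T (s, c)} = Suc (card {s. s < r \<and> i < S (s, c)})"
    using eq[of c] ab[of c] card_split_row[OF fin(1), of c r] card_split_row[OF fin(2), of c r] less
    by (simp add: i_def)
  have 2: "card {s. s < r \<and> i < T (s, Suc c)} = card {s. s < r \<and> i < S (s, Suc c)}"
    using eq[of "Suc c"] ab[of "Suc c"] card_split_row[OF fin(1), of "Suc c" r]
      card_split_row[OF fin(2), of "Suc c" r] right by simp
  have c: "1 \<le> c" using nz zT[of "(r, c)"] by (simp add: diagram_iff)
  have 3: "card {s. s < r \<and> i < T (s, c)} \<le> card {s. s < r \<and> i < T (s, Suc c)}"
    using key_tableauD(4)[OF T _ nz] by (intro card_mono) (auto simp: i_def)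
  have 4: "card {s. s < r \<and> i < S (s, Suc c)} \<le> card {s. s < r \<and> i < S (s, c)}"
    using key_tableauD(3)[OF S c] by (intro card_mono) (auto intro: less_le_trans)
  show False using 1 2 3 4 by simp
qed

lemma key_tableau_eqI:
  assumes T: "key_tableau n a T" and S: "key_tableau n a S"
    and cols: "\<And>c. col_set n a T c = col_set n a S c"
  shows "T = S"
proof (rule ccontr)
  assume "T \<noteq> S"
  note z = key_tableau_eq_0_iff[OF T] key_tableau_eq_0_iff[OF S]
  define R where "R = {r. \<exists>c. T (r, c) \<noteq> S (r, c)}"
  have "R \<subseteq> {..n}"
  proof
    fix r assume "r \<in> R"
    then obtain c where "T (r, c) \<noteq> S (r, c)" by (auto simp: R_def)
    then have "(r, c) \<in> diagram n a" using z[of "(r, c)"] by metis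
    then show "r \<in> {..n}" by (simp add: diagram_iff)
  qed
  then have finR: "finite R" using finite_subset by blast
  have "R \<noteq> {}" using \<open>T \<noteq> S\<close> by (auto simp: R_def)
  define r where "r = Max R"
  have rR: "r \<in> R" using finR \<open>R \<noteq> {}\<close> by (simp add: r_def)
  have above: "T (s, c) = S (s, c)" if "r < s" for s c
    using that Max_ge[OF finR, of s] by (auto simp: r_def R_def)
  define C where "C = {c. T (r, c) \<noteq> S (r, c)}"
  have sub: "(r, c) \<in> diagram n a" if "c \<in> C" for c
  proof (rule ccontr)
    assume "(r, c) \<notin> diagram n a"
    then have "T (r, c) = 0" "S (r, c) = 0" using z by auto
    then show False using that by (simp add: C_def)
  qed
  then have "C \<subseteq> {..a r}" by (auto simp: diagram_iff)
  then have finC: "finite C" using finite_subset by blast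
  have "C \<noteq> {}" using rR by (auto simp: R_def C_def)
  define c where "c = Max C"
  have cC: "c \<in> C" using finC \<open>C \<noteq> {}\<close> by (simp add: c_def)
  have right: "T (r, Suc c) = S (r, Suc c)"
    using Max_ge[OF finC, of "Suc c"] by (auto simp: c_def C_def)
  have nz: "T (r, c) \<noteq> 0" "S (r, c) \<noteq> 0" using sub[OF cC] z by auto
  have ne: "T (r, c) \<noteq> S (r, c)" using cC by (simp add: C_def)
  then consider "T (r, c) < S (r, c)" | "S (r, c) < T (r, c)" by linarith
  then show False
    using key_tableau_no_first_difference[OF T S cols above right _ nz(1)]
      key_tableau_no_first_difference[OF S T cols[symmetric] above[symmetric] right[symmetric] _ nz(2)]
    by cases blast+
qed

section \<open>Exchanging adjacent rows\<close>

text \<open>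
  By the key condition and the decrease of rows an inversion between the two rows reproduces itself in the
  next column, without end, as long as the upper row does not stop first.
\<close>

lemma no_adjacent_inversion:
  assumes T: "key_tableau n a T" and a: "a i \<le> a (Suc i)" and i: "1 \<le> i" "i < n" and c: "1 \<le> c"
    and nz: "T (Suc i, c) \<noteq> 0"
  shows "T (i, c) < T (Suc i, c)"
proof (rule ccontr)
  assume "\<not> ?thesis"
  then have start: "T (Suc i, c) < T (i, c)"
    using key_tableauD(2)[OF T, of "Suc i" i c] nz by simp
  note z = key_tableau_eq_0_iff[OF T]
  have "T (Suc i, c + k) \<noteq> 0 \<and> T (Suc i, c + k) < T (i, c + k)" for k
  proof (induction k)
    case (Suc k)
    then have 1: "T (Suc i, c + k) < T (i, Suc (c + k))"
      using key_tableauD(4)[OF T, of i "Suc i" "c + k"] by auto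
    then have "(i, Suc (c + k)) \<in> diagram n a" using z by (metis not_less_zero)
    then have "(Suc i, Suc (c + k)) \<in> diagram n a" using a i by (auto simp: diagram_iff)
    moreover have "T (Suc i, Suc (c + k)) \<le> T (Suc i, c + k)"
      using key_tableauD(3)[OF T, of "c + k"] c by simp
    ultimately show ?case using 1 z by auto
  qed (use start nz in simp)
  from this[of "a (Suc i)"] z[of "(Suc i, c + a (Suc i))"] c show False
    by (simp add: diagram_iff)
qed

lemma transpose_interval: "1 \<le> i \<Longrightarrow> i < n \<Longrightarrow> 1 \<le> transpose i (Suc i) r \<and> transpose i (Suc i) r \<le> n \<longleftrightarrow> 1 \<le> r \<and> r \<le> n"
  by (auto simp: transpose_def)

text \<open>
  The longer row \<open>i + 1\<close> must give its excess cells to row \<open>i\<close>. The two rows are exchanged in all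
  columns to the right of a column \<open>k\<close>, the last one where the exchanged tails still continue decreasing
  rows; to the right of \<open>k\<close> the inequality opposite to the one that defines \<open>k\<close> is
  precisely the key condition for the new inversions. If there is no such column, the rows are exchanged
  altogether, and only then does the first column change. The last clause of the statement
  describes this case.
\<close>

lemma swap_rows:
  assumes T: "key_tableau n b T" and b: "b i < b (Suc i)" and i: "1 \<le> i" "i < n"
  defines "a \<equiv> b \<circ> transpose i (Suc i)"
  shows "\<exists>S. key_tableau n a S \<and> (\<forall>c. col_set n a S c = col_set n b T c) \<and>
    (\<forall>r. r \<noteq> i \<longrightarrow> r \<noteq> Suc i \<longrightarrow> S (r, 1) = T (r, 1)) \<and>
    ((S (i, 1) = T (i, 1) \<and> S (Suc i, 1) = T (Suc i, 1)) \<or>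
     (S (i, 1) = T (Suc i, 1) \<and> S (Suc i, 1) = T (i, 1) \<and>
      (\<forall>c. 1 \<le> c \<longrightarrow> c \<le> b i \<longrightarrow> T (i, c) < T (Suc i, Suc c))))"
proof -
  let ?t = "transpose i (Suc i)"
  define k where "k = Max (insert 0 {c. 1 \<le> c \<and> c \<le> b i \<and> T (Suc i, Suc c) \<le> T (i, c)})"
  define S where "S = (\<lambda>(r, c). if k < c then T (?t r, c) else T (r, c))"
  have f: "is_filling n b T" using T key_tableauD(1) by blast
  note z = filling_eq_0_iff[OF f]
  have fin: "finite (insert 0 {c. 1 \<le> c \<and> c \<le> b i \<and> T (Suc i, Suc c) \<le> T (i, c)})"
    by (rule finite.insertI) (rule finite_subset[of _ "{..b i}"], auto)
  have k: "k = 0 \<or> (1 \<le> k \<and> k \<le> b i \<and> T (Suc i, Suc k) \<le> T (i, k))"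
    using Max_in[OF fin] by (auto simp: k_def)
  have gt: "T (i, c) < T (Suc i, Suc c)" if "k < c" "c \<le> b i" for c
  proof (rule ccontr)
    assume "\<not> ?thesis"
    then have "c \<le> k" using that unfolding k_def by (intro Max_ge[OF fin]) auto
    then show False using that by simp
  qed
  have noinv: "T (Suc i, c) \<noteq> 0 \<Longrightarrow> 1 \<le> c \<Longrightarrow> T (i, c) < T (Suc i, c)" for c
    using no_adjacent_inversion[OF T _ i] b by simp
  have S_gt: "S (r, c) = T (?t r, c)" if "k < c" for r c using that by (simp add: S_def)
  have S_le: "S (r, c) = T (r, c)" if "c \<le> k" for r c using that by (simp add: S_def)
  have dgt: "(r, c) \<in> diagram n a \<longleftrightarrow> (?t r, c) \<in> diagram n b" for r c
    using transpose_interval[OF i, of r] by (auto simp: diagram_iff a_def)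
  have dle: "(r, c) \<in> diagram n a \<longleftrightarrow> (r, c) \<in> diagram n b" if "c \<le> k" for r c
    using that k b i by (auto simp: diagram_iff a_def transpose_def)
  have fS: "is_filling n a S"
  proof -
    have "S x = 0 \<longleftrightarrow> x \<notin> diagram n a" for x
      using dgt dle z by (cases x; cases "k < snd x") (auto simp: S_gt S_le not_less)
    then show ?thesis unfolding is_filling_def by (metis One_nat_def Suc_leI gr_zeroI)
  qed
  have cols: "col_set n a S c = col_set n b T c" for c
  proof (cases "k < c")
    case True
    have "{r. (r, c) \<in> diagram n b} = ?t ` {r. (r, c) \<in> diagram n a}"
      using dgt by (auto simp: image_iff) (metis transpose_involutory)
    then show ?thesis using True by (simp add: col_set_def S_gt image_image)
  next
    case False
    then show ?thesis using dle by (simp add: col_set_def S_le)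
  qed
  have ktS: "key_tableau n a S"
    unfolding key_tableau_iff
  proof (intro conjI fS allI impI)
    fix r s c assume rs: "r \<noteq> s" "S (r, c) \<noteq> 0"
    then have "?t r \<noteq> ?t s" by (metis transpose_involutory)
    then show "S (r, c) \<noteq> S (s, c)"
      using rs key_tableauD(2)[OF T, of r s c] key_tableauD(2)[OF T, of "?t r" "?t s" c]
      by (cases "k < c") (auto simp: S_gt S_le)
  next
    fix r c :: nat assume c: "1 \<le> c"
    show "S (r, Suc c) \<le> S (r, c)"
    proof (cases "c = k")
      case False
      then have "k < c \<and> k < Suc c \<or> c \<le> k \<and> Suc c \<le> k" by auto
      then show ?thesis using key_tableauD(3)[OF T c] by (auto simp: S_gt S_le)
    next
      case True
      have "T (i, Suc c) \<le> T (Suc i, c)"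
        using key_tableauD(3)[OF T c, of i] noinv[of c] c k True
        by (cases "T (Suc i, c) = 0") (use z[of "(Suc i, c)"] b i in \<open>auto simp: diagram_iff\<close>)
      then show ?thesis
        using True key_tableauD(3)[OF T c, of r] k c by (auto simp: S_gt S_le transpose_def)
    qed
  next
    fix r s c assume sr: "s < r" and nz: "S (r, c) \<noteq> 0" and lt: "S (r, c) < S (s, c)"
    have c: "1 \<le> c" using nz filling_eq_0_iff[OF fS, of "(r, c)"] by (simp add: diagram_iff)
    show "S (r, c) < S (s, Suc c)"
    proof (cases "r = Suc i \<and> s = i")
      case True
      have "k < c"
      proof (rule ccontr)
        assume "\<not> k < c"
        then have "T (Suc i, c) \<noteq> 0" "T (Suc i, c) < T (i, c)"
          using True nz lt by (auto simp: S_le)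
        then show False using noinv[of c] c by simp
      qed
      moreover have "T (i, c) \<noteq> 0" using nz True \<open>k < c\<close> by (simp add: S_gt)
      then have "c \<le> b i" using z by (auto simp: diagram_iff)
      ultimately show ?thesis using gt[of c] True by (simp add: S_gt)
    next
      case False
      then have ts: "?t s < ?t r" using sr by (auto simp: transpose_def)
      consider "k < c" | "Suc c \<le> k" | "c = k" by linarith
      then show ?thesis
      proof cases
        case 1
        then show ?thesis using key_tableauD(4)[OF T ts, of c] nz lt by (simp add: S_gt)
      next
        case 2
        then show ?thesis using key_tableauD(4)[OF T sr, of c] nz lt by (simp add: S_le)
      next
        case 3
        \<comment> \<open>One of the two rows, as row \<open>s\<close>, is continued by the other one after column \<open>k\<close>, so
          both must continue with entries greater than \<open>T (r, k)\<close>.\<close>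
        have base: "T (r, c) < T (s, Suc c)"
          using key_tableauD(4)[OF T sr, of c] nz lt 3 by (simp add: S_le)
        have "T (r, c) < T (?t s, Suc c)"
        proof (cases "s = i \<or> s = Suc i")
          case True
          then have r: "Suc i < r" using sr False by auto
          have nz': "T (r, c) \<noteq> 0" and lt': "T (r, c) < T (s, c)" using nz lt 3 by (auto simp: S_le)
          have d: "T (Suc i, c) \<noteq> 0" using 3 k c b i z[of "(Suc i, c)"] by (auto simp: diagram_iff)
          then have "T (r, c) < T (Suc i, c)" using noinv[OF d c] True lt' by auto
          then have 4: "T (r, c) < T (Suc i, Suc c)" using key_tableauD(4)[OF T r nz'] by simp
          moreover have "T (Suc i, Suc c) \<le> T (i, c)" using k 3 c by auto
          ultimately have "T (r, c) < T (i, Suc c)"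
            using key_tableauD(4)[OF T _ nz', of i] r by auto
          then show ?thesis using 4 True by auto
        next
          case False
          then show ?thesis using base by simp
        qed
        then show ?thesis using 3 by (simp add: S_le S_gt)
      qed
    qed
  qed
  have "S (r, 1) = T (r, 1)" if "r \<noteq> i" "r \<noteq> Suc i" for r
    using that by (simp add: S_def transpose_def)
  moreover have "(S (i, 1) = T (i, 1) \<and> S (Suc i, 1) = T (Suc i, 1)) \<or>
     (S (i, 1) = T (Suc i, 1) \<and> S (Suc i, 1) = T (i, 1) \<and>
      (\<forall>c. 1 \<le> c \<longrightarrow> c \<le> b i \<longrightarrow> T (i, c) < T (Suc i, Suc c)))"
  proof (cases "k = 0")
    case True
    then show ?thesis using gt by (auto simp: S_def)
  next
    case False
    then show ?thesis by (auto simp: S_def)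
  qed
  ultimately show ?thesis using ktS cols by blast
qed

section \<open>Realizing column sets by key tableaux\<close>

lemma decreasing_nth_ge_iff:
  fixes l :: "nat list"
  assumes "sorted_wrt (>) l" "j < length l"
  shows "t \<le> l ! j \<longleftrightarrow> j < length (filter ((\<le>) t) l)"
  using assms
proof (induction l arbitrary: j)
  case (Cons x l)
  show ?case
  proof (cases "t \<le> x")
    case True
    then show ?thesis using Cons by (cases j) auto
  next
    case False
    then have none: "\<forall>y \<in> set (x # l). \<not> t \<le> y" using Cons.prems(1) by auto
    then have "\<not> t \<le> (x # l) ! j" using Cons.prems(2) nth_mem by blast
    moreover have "filter ((\<le>) t) (x # l) = []" using none by (simp only: filter_empty_conv)
    ultimately show ?thesis by simp
  qed
qed simp

lemma desc_nth_ge_iff: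
  assumes "finite A" "j < card A"
  shows "t \<le> desc A ! j \<longleftrightarrow> j < count_ge A t"
proof -
  have "length (filter ((\<le>) t) (desc A)) = count_ge A t"
    using distinct_length_filter[of "desc A" "(\<le>) t"] assms(1)
    by (simp add: desc_def count_ge_def Int_def conj_commute)
  then show ?thesis using decreasing_nth_ge_iff[OF sorted_desc, of j A t] assms(2) by simp
qed

lemma up_closed_mem_iff:
  assumes "S \<subseteq> {1..n}" "\<And>r s. r \<in> S \<Longrightarrow> r \<le> s \<Longrightarrow> s \<le> n \<Longrightarrow> s \<in> S" "1 \<le> r" "r \<le> n"
  shows "r \<in> S \<longleftrightarrow> n - r < card S"
proof
  have fin: "finite S" using assms(1) finite_subset by blast
  assume "r \<in> S"
  then have "{r..n} \<subseteq> S" using assms(2) by auto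
  then have "card {r..n} \<le> card S" using fin card_mono by blast
  then show "n - r < card S" using assms(4) by simp
next
  assume l: "n - r < card S"
  show "r \<in> S"
  proof (rule ccontr)
    assume "r \<notin> S"
    then have "S \<subseteq> {Suc r..n}"
      using assms(1,2,4) by (metis atLeastAtMost_iff not_less_eq_eq subset_iff)
    then have "card S \<le> card {Suc r..n}" by (intro card_mono) auto
    then show False using l by simp
  qed
qed

text \<open>
  If the row lengths increase upwards, each column can be filled in increasing order from bottom to top.
  Row \<open>n\<close> then holds the largest entries and there are no inversions.
\<close>

lemma exists_key_tableau_increasing:
  assumes K: "anti_cols n (col_height n a) K"
    and a: "\<And>r. 1 \<le> r \<Longrightarrow> r < n \<Longrightarrow> a r \<le> a (Suc r)"
  shows "\<exists>T. key_tableau n a T \<and> (\<forall>c. col_set n a T c = K c)"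
proof -
  have cin: "cols_in n (col_height n a) K" using K by (simp add: anti_cols_def)
  note fin = cols_in_finite[OF cin]
  have card: "card (K c) = col_height n a c" and sub: "K c \<subseteq> {1..n}" for c
    using cin by (auto simp: cols_in_def)
  have mono: "a r \<le> a s" if "1 \<le> r" "r \<le> s" "s \<le> n" for r s
    using that(2,3)
  proof (induction rule: dec_induct)
    case (step k)
    then show ?case using a[of k] that(1) by auto
  qed simp
  have diag: "(r, c) \<in> diagram n a \<longleftrightarrow> n - r < card (K c)" if "1 \<le> r" "r \<le> n" for r c
  proof -
    have "r \<in> {r. (r, c) \<in> diagram n a} \<longleftrightarrow> n - r < card {r. (r, c) \<in> diagram n a}"
      using that mono by (intro up_closed_mem_iff) (auto simp: diagram_iff intro: le_trans)
    then show ?thesis by (simp add: card col_height_def)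
  qed
  have diagD: "1 \<le> r \<and> r \<le> n \<and> 1 \<le> c \<and> n - r < card (K c)" if "(r, c) \<in> diagram n a" for r c
    using that diag[of r c] by (auto simp: diagram_iff)
  define T where "T = (\<lambda>(r, c). if (r, c) \<in> diagram n a then desc (K c) ! (n - r) else 0)"
  have T: "T (r, c) = desc (K c) ! (n - r)" if "(r, c) \<in> diagram n a" for r c
    using that by (simp add: T_def)
  have T0: "T (r, c) = 0" if "(r, c) \<notin> diagram n a" for r c
    using that by (simp add: T_def)
  have inK: "T (r, c) \<in> K c" if "(r, c) \<in> diagram n a" for r c
    using T[OF that] diagD[OF that] set_desc[OF fin] nth_mem[of "n - r" "desc (K c)"] by simp
  have f: "is_filling n a T"
    unfolding is_filling_def
  proof (intro conjI ballI allI impI)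
    fix x assume "x \<in> diagram n a"
    then show "1 \<le> T x" using inK sub by (cases x) fastforce
  next
    fix x assume "x \<notin> diagram n a"
    then show "T x = 0" using T0 by (cases x) auto
  qed
  note z = filling_eq_0_iff[OF f]
  have less: "T (s, c) < T (r, c)" if "s < r" "T (r, c) \<noteq> 0" for r s c
  proof (cases "(s, c) \<in> diagram n a")
    case True
    have r: "(r, c) \<in> diagram n a" using that z by auto
    have "n - r < n - s" "n - s < card (K c)" using that diagD[OF r] diagD[OF True] by auto
    then show ?thesis
      using T[OF r] T[OF True] sorted_desc[of "K c"] by (auto simp: sorted_wrt_iff_nth_less)
  next
    case False
    then show ?thesis using T0 that by simp
  qed
  have "key_tableau n a T"
    unfolding key_tableau_iff
  proof (intro conjI f allI impI)
    fix r s c assume rs: "r \<noteq> s" "T (r, c) \<noteq> 0"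
    show "T (r, c) \<noteq> T (s, c)"
    proof
      assume eq: "T (r, c) = T (s, c)"
      show False
        using less[of s r c] less[of r s c] rs unfolding eq by (meson less_irrefl linorder_neqE_nat)
    qed
  next
    fix r c :: nat assume c: "1 \<le> c"
    show "T (r, Suc c) \<le> T (r, c)"
    proof (cases "(r, Suc c) \<in> diagram n a")
      case True
      then have r: "(r, c) \<in> diagram n a" using c by (simp add: diagram_iff)
      have "n - r < count_ge (K (Suc c)) (T (r, Suc c))"
        using desc_nth_ge_iff[OF fin[of "Suc c"], of "n - r" "T (r, Suc c)"] T[OF True] diagD[OF True] by simp
      also have "\<dots> \<le> count_ge (K c) (T (r, Suc c))" using K c by (simp add: anti_cols_def)
      finally show ?thesis
        using desc_nth_ge_iff[OF fin[of c], of "n - r" "T (r, Suc c)"] T[OF r] diagD[OF r] by simp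
    qed (simp add: T0)
  next
    fix r s c assume "s < r" "T (r, c) \<noteq> 0" "T (r, c) < T (s, c)"
    then show "T (r, c) < T (s, Suc c)" using less[of s r c] by simp
  qed
  moreover have "col_set n a T c = K c" for c
  proof (rule card_subset_eq[OF fin])
    show "col_set n a T c \<subseteq> K c" using inK by (auto simp: col_set_def)
    show "card (col_set n a T c) = card (K c)"
      using card_col_set[OF key_tableauD(1,2)[OF \<open>key_tableau n a T\<close>]] card by simp
  qed
  ultimately show ?thesis by blast
qed

lemma col_height_swap:
  assumes "1 \<le> i" "i < n"
  shows "col_height n (a \<circ> transpose i (Suc i)) c = col_height n a c"
proof -
  let ?t = "transpose i (Suc i)"
  have "{r. (r, c) \<in> diagram n a} = ?t ` {r. (r, c) \<in> diagram n (a \<circ> ?t)}"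
    using transpose_interval[OF assms]
    by (auto simp: image_iff diagram_iff) (metis transpose_involutory)
  moreover have "inj_on ?t {r. (r, c) \<in> diagram n (a \<circ> ?t)}"
    by (rule inj_onI) (metis transpose_involutory)
  ultimately show ?thesis by (simp only: col_height_def card_image)
qed

text \<open>
  The shape is sorted into increasing order by exchanges of adjacent parts, and \<open>swap_rows\<close> leads back. The
  measure is a weighted sum that decreases when a larger part moves up.
\<close>

lemma exists_key_tableau:
  assumes "anti_cols n (col_height n a) K"
  shows "\<exists>T. key_tableau n a T \<and> (\<forall>c. col_set n a T c = K c)"
  using assms
proof (induction "\<Sum>r\<in>{1..n}. (n - r) * a r" arbitrary: a rule: less_induct)
  case less
  show ?case
  proof (cases "\<forall>r. 1 \<le> r \<longrightarrow> r < n \<longrightarrow> a r \<le> a (Suc r)")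
    case True
    then show ?thesis using exists_key_tableau_increasing[OF less.prems] by blast
  next
    case False
    then obtain i where i: "1 \<le> i" "i < n" "a (Suc i) < a i" by auto
    let ?t = "transpose i (Suc i)"
    let ?b = "a \<circ> ?t"
    have ba: "?b \<circ> ?t = a" by (simp add: comp_assoc)
    have "(\<Sum>r\<in>{1..n}. (n - r) * ?b r) < (\<Sum>r\<in>{1..n}. (n - r) * a r)"
    proof -
      have s: "{1..n} = insert i (insert (Suc i) ({1..n} - {i, Suc i}))" using i by auto
      have rest: "(\<Sum>r\<in>{1..n} - {i, Suc i}. (n - r) * ?b r) = (\<Sum>r\<in>{1..n} - {i, Suc i}. (n - r) * a r)"
        by (intro sum.cong) (auto simp: transpose_def)
      have sm: "(\<Sum>r\<in>{1..n}. (n - r) * f r) =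
          (n - i) * f i + ((n - Suc i) * f (Suc i) + (\<Sum>r\<in>{1..n} - {i, Suc i}. (n - r) * f r))" for f :: "nat \<Rightarrow> nat"
        by (subst s) (simp add: sum.insert_remove)
      obtain d where d: "n - i = Suc d" "n - Suc i = d" using i by (metis Suc_diff_Suc)
      show ?thesis unfolding sm rest d using i(3) by simp
    qed
    moreover have "anti_cols n (col_height n ?b) K"
      using less.prems i col_height_swap[of i n a] by (simp add: anti_cols_def cols_in_def)
    ultimately obtain T where T: "key_tableau n ?b T" "\<forall>c. col_set n ?b T c = K c"
      using less.hyps by blast
    obtain S where "key_tableau n (?b \<circ> ?t) S" "\<forall>c. col_set n (?b \<circ> ?t) S c = col_set n ?b T c"
      using swap_rows[OF T(1) _ i(1,2)] i(3) by auto
    then show ?thesis using T(2) unfolding ba by auto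
  qed
qed

section \<open>The unsorted column reading word\<close>

definition cells_above :: "nat \<Rightarrow> (nat \<Rightarrow> nat) \<Rightarrow> nat \<Rightarrow> nat \<Rightarrow> cell list" where
  "cells_above n a r c = filter (\<lambda>x. x \<in> diagram n a) (map (\<lambda>s. (s, c)) (rev [Suc r..<Suc n]))"

definition cells_below :: "nat \<Rightarrow> (nat \<Rightarrow> nat) \<Rightarrow> nat \<Rightarrow> nat \<Rightarrow> cell list" where
  "cells_below n a r c = filter (\<lambda>x. x \<in> diagram n a) (map (\<lambda>s. (s, c)) (rev [1..<r]))"

definition cells_of :: "nat \<Rightarrow> (nat \<Rightarrow> nat) \<Rightarrow> nat list \<Rightarrow> cell list" where
  "cells_of n a cs = concat (map (column_cells n a) cs)"

lemma cells_of_simps [simp]: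
  "cells_of n a [] = []" "cells_of n a (c # cs) = column_cells n a c @ cells_of n a cs"
  "cells_of n a (cs @ ds) = cells_of n a cs @ cells_of n a ds"
  by (simp_all add: cells_of_def)

lemma key_cells_eq: "key_cells n a = cells_of n a (rev [1..<Suc (max_column n a)])"
  by (simp only: key_cells_def cells_of_def)

lemma young_cells_eq: "young_cells n a = cells_of n a [1..<Suc (max_column n a)]"
  by (simp only: young_cells_def cells_of_def)

lemma set_column_cells: "set (column_cells n a c) = {(r, c) |r. (r, c) \<in> diagram n a}"
  by (auto simp: column_cells_def diagram_iff)

lemma set_map_column_cells: "set (map T (column_cells n a c)) = col_set n a T c"
  by (auto simp: set_column_cells col_set_def)

lemma distinct_column_cells: "distinct (column_cells n a c)"
  unfolding column_cells_def by (intro distinct_filter) (simp add: distinct_map inj_on_def)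

lemma set_cells_of: "set (cells_of n a cs) = {(r, c) |r c. c \<in> set cs \<and> (r, c) \<in> diagram n a}"
  by (auto simp: cells_of_def set_column_cells)

lemma distinct_cells_of: "distinct cs \<Longrightarrow> distinct (cells_of n a cs)"
  by (induction cs) (auto simp: distinct_column_cells set_column_cells set_cells_of)

lemma column_cells_split:
  assumes "(r, c) \<in> diagram n a"
  shows "column_cells n a c = cells_above n a r c @ (r, c) # cells_below n a r c"
proof -
  have r: "1 \<le> r" "r \<le> n" using assms by (auto simp: diagram_iff)
  have "rev [1..<Suc n] = rev [Suc r..<Suc n] @ r # rev [1..<r]"
    using r by (intro rev_upt_split_at)
  then show ?thesis using assms by (simp add: column_cells_def cells_above_def cells_below_def)
qed

lemma set_cells_above: "(s, d) \<in> set (cells_above n a r c) \<longleftrightarrow> d = c \<and> r < s \<and> (s, d) \<in> diagram n a"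
  by (auto simp: cells_above_def diagram_iff)

lemma set_cells_below: "(s, d) \<in> set (cells_below n a r c) \<longleftrightarrow> d = c \<and> s < r \<and> (s, d) \<in> diagram n a"
  by (auto simp: cells_below_def diagram_iff)

lemma max_column_le: "r \<in> {1..n} \<Longrightarrow> a r \<le> max_column n a"
  unfolding max_column_def by (intro Max_ge) auto

lemma diagram_max_column: "(r, c) \<in> diagram n a \<Longrightarrow> c \<le> max_column n a"
  using max_column_le[of r n a] by (auto simp: diagram_iff)

lemma diagram_subset_cells: "(r, c) \<in> diagram n a \<Longrightarrow> c \<in> set [1..<Suc (max_column n a)]"
  using diagram_max_column[of r c n a] by (auto simp: diagram_iff)

lemma set_key_cells: "set (key_cells n a) = diagram n a"
  using diagram_subset_cells[of _ _ n a] unfolding key_cells_eq set_cells_of set_rev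
  by (auto simp del: upt_Suc set_upt)

lemma set_young_cells: "set (young_cells n a) = diagram n a"
  using diagram_subset_cells[of _ _ n a] unfolding young_cells_eq set_cells_of
  by (auto simp del: upt_Suc set_upt)

lemma distinct_key_cells: "distinct (key_cells n a)"
  unfolding key_cells_eq by (intro distinct_cells_of) (simp only: distinct_rev distinct_upt)

lemma distinct_young_cells: "distinct (young_cells n a)"
  unfolding young_cells_eq by (intro distinct_cells_of) (simp only: distinct_upt)

section \<open>Comparing a column with its sorted version\<close>

lemma word_phi_le_count: "word_phi i w \<le> count_list w i"
  by (induction w) auto

lemma word_phi_eq_0_D:
  assumes "word_phi i w = 0" "w = p @ i # q"
  shows "Suc i \<in> set p"
proof (rule ccontr)
  assume n: "Suc i \<notin> set p"
  have "word_eps i p \<le> count_list p (Suc i)" for p by (induction p) auto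
  then have "word_eps i p = 0" using n by (metis count_list_0_iff le_zero_eq)
  then show False using assms by (simp add: word_phi_append)
qed

lemma word_eps_eq_0_D:
  assumes "word_eps i w = 0" "w = p @ Suc i # q"
  shows "i \<in> set q"
proof (rule ccontr)
  assume n: "i \<notin> set q"
  then have "word_phi i q = 0" using word_phi_le_count[of i q] by simp
  then show False using assms by (simp add: word_eps_append)
qed

lemma distinct_count_list: "distinct L \<Longrightarrow> count_list L x = (if x \<in> set L then 1 else 0)"
  by (induction L) auto

text \<open>
  Sorting turns an \<open>i\<close> above \<open>i + 1\<close> into a pair and changes nothing else, so it
  removes equally many unpaired letters of both kinds.
\<close>

lemma desc_eps_phi_le:
  assumes "distinct L"
  shows "word_eps i (desc (set L)) \<le> word_eps i L" "word_phi i (desc (set L)) \<le> word_phi i L"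
    "word_eps i (desc (set L)) + word_phi i L = word_eps i L + word_phi i (desc (set L))"
  using word_eps_minus_phi[of L i] eps_phi_desc[of "set L" i] distinct_count_list[OF assms]
  by (auto split: if_splits)

lemma col_word_phi_le:
  assumes "\<And>c. distinct (map T (column_cells n a c))"
  shows "word_phi i (col_word (col_set n a T) cs) \<le> word_phi i (map T (cells_of n a cs))"
proof (induction cs)
  case (Cons c cs)
  show ?case
    using set_map_column_cells[of T n a c] Cons desc_eps_phi_le[OF assms, of i c] by (simp add: word_phi_append)
qed simp

lemma col_word_eps_le:
  assumes "\<And>c. distinct (map T (column_cells n a c))"
  shows "word_eps i (col_word (col_set n a T) cs) \<le> word_eps i (map T (cells_of n a cs))"
proof (induction cs rule: rev_induct)
  case (snoc c cs)
  show ?case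
    using set_map_column_cells[of T n a c] snoc desc_eps_phi_le[OF assms, of i c] by (simp add: word_eps_append)
qed simp

lemma distinct_column:
  assumes "key_tableau n a T"
  shows "distinct (map T (column_cells n a c))"
  unfolding distinct_map
proof (intro conjI distinct_column_cells inj_onI)
  fix x y assume "x \<in> set (column_cells n a c)" "y \<in> set (column_cells n a c)" "T x = T y"
  then show "x = y"
    using key_tableauD(2)[OF assms] key_tableau_eq_0_iff[OF assms]
    by (fastforce simp: set_column_cells)
qed

section \<open>The raising operator on key tableaux\<close>

definition sorted_word :: "nat \<Rightarrow> (nat \<Rightarrow> nat) \<Rightarrow> filling \<Rightarrow> nat list" where
  "sorted_word n a T = col_word (col_set n a T) (rev [1..<Suc (max_column n a)])"

lemma key_raise_None:
  assumes "key_tableau n a T" "key_raise n a i T = None"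
  shows "word_raise i (sorted_word n a T) = None"
proof -
  have "word_eps i (key_word n a T) = 0"
    using assms(2) by (auto simp: key_raise_def max_suffix_excess_eq Let_def split: if_splits prod.splits)
  moreover have "word_eps i (sorted_word n a T) \<le> word_eps i (key_word n a T)"
    unfolding sorted_word_def key_word_def key_cells_eq
    by (rule col_word_eps_le[OF distinct_column[OF assms(1)]])
  ultimately show ?thesis by (simp add: word_raise_None_iff)
qed

text \<open>
  Let \<open>(r, c)\<close> be the cell chosen by the raising operator and \<open>c'\<close> the first column from
  \<open>c\<close> on without an entry \<open>i\<close>. If a column contains \<open>i\<close> above the \<open>i + 1\<close> of
  row \<open>r\<close>, the key condition continues row \<open>r\<close> with \<open>i + 1\<close>. Therefore, from
  \<open>c\<close> on, row \<open>r\<close> reads \<open>i + 1\<close> exactly up to \<open>c'\<close>, with an \<open>i\<close>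
  above it in each of these columns but the last. In the sorted word the columns from \<open>c\<close> up to \<open>c'\<close>, but not \<open>c'\<close>, are
  neutral, and the leftmost unpaired \<open>i + 1\<close> belongs to column \<open>c'\<close>. That no \<open>i\<close> stands above row \<open>r\<close> in column
  \<open>c - 1\<close> is needed to see that the raised filling has decreasing rows.
\<close>

lemma key_raise_segment:
  assumes T: "key_tableau n a T" and i: "1 \<le> i" and raise: "key_raise n a i T = Some S"
  obtains r c c' where "1 \<le> c" "c \<le> c'"
    "\<And>d. c \<le> d \<Longrightarrow> d \<le> c' \<Longrightarrow> T (r, d) = Suc i"
    "T (r, Suc c') \<noteq> Suc i"
    "\<And>s d. c \<le> d \<Longrightarrow> d \<le> c' \<Longrightarrow> T (s, d) = i \<Longrightarrow> r < s"
    "\<And>d. c \<le> d \<Longrightarrow> d < c' \<Longrightarrow> \<exists>s. T (s, d) = i"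
    "\<And>s. T (s, c') \<noteq> i"
    "\<And>s d. c = Suc d \<Longrightarrow> 1 \<le> d \<Longrightarrow> r < s \<Longrightarrow> T (s, d) \<noteq> i"
    "word_eps i (col_word (col_set n a T) (rev [Suc c'..<Suc (max_column n a)])) = 0"
    "word_phi i (col_word (col_set n a T) (rev [1..<c])) = 0"
    "S = (\<lambda>(s, d). if c \<le> d \<and> d \<le> c' then transpose i (Suc i) (T (s, d)) else T (s, d))"
proof -
  define m where "m = max_column n a"
  note z = key_tableau_eq_0_iff[OF T]
  note dist = distinct_column[OF T]
  have eps: "word_eps i (key_word n a T) \<noteq> 0"
    using raise by (auto simp: key_raise_def max_suffix_excess_eq split: if_splits)
  then obtain w' where "word_raise i (key_word n a T) = Some w'"
    using word_raise_None_iff[of i "key_word n a T"] by auto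
  then obtain u v where uv: "key_word n a T = u @ Suc i # v" "word_eps i u = 0" "word_phi i v = 0"
    by (auto simp: word_raise_iff)
  then have "raise_pos i (key_word n a T) = length u" by (intro raise_pos_eq)
  obtain xs x ys where xs: "key_cells n a = xs @ x # ys" "map T xs = u" "T x = Suc i" "map T ys = v"
    using uv(1) unfolding key_word_def by (auto simp: map_eq_append_conv map_eq_Cons_conv)
  obtain r c where x: "x = (r, c)" by (cases x)
  have rc: "(r, c) \<in> diagram n a" using xs(1) x set_key_cells[of n a] by auto
  then have c1: "1 \<le> c" and cm: "c \<le> m" using diagram_max_column[OF rc] by (auto simp: diagram_iff m_def)
  have nth: "key_cells n a ! raise_pos i (key_word n a T) = (r, c)"
    using \<open>raise_pos i (key_word n a T) = length u\<close> xs x by (metis length_map nth_append_length)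
  define U where "U d = map T (cells_of n a (rev [Suc d..<Suc m]))" for d
  define V where "V d = map T (cells_of n a (rev [1..<d]))" for d
  define up where "up d = map T (cells_above n a r d)" for d
  define dn where "dn d = map T (cells_below n a r d)" for d
  have col: "map T (column_cells n a d) = up d @ T (r, d) # dn d" if "T (r, d) \<noteq> 0" for d
    using column_cells_split[of r d n a] that z[of "(r, d)"] by (simp add: up_def dn_def)
  have mem_up: "k \<in> set (up d) \<longleftrightarrow> (\<exists>s. r < s \<and> T (s, d) = k)" if "k \<noteq> 0" for k d
    using that z unfolding up_def by (force simp: set_cells_above)
  have mem_dn: "k \<in> set (dn d) \<longleftrightarrow> (\<exists>s. s < r \<and> T (s, d) = k)" if "k \<noteq> 0" for k d
    using that z unfolding dn_def by (force simp: set_cells_below)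
  have only: "s = r" if "T (s, d) = Suc i" "T (r, d) = Suc i" for s d
    using key_tableauD(2)[OF T, of s r d] that by auto
  have Suc_up: "Suc i \<notin> set (up d)" "Suc i \<notin> set (dn d)" if "T (r, d) = Suc i" for d
    using only that mem_up[of "Suc i" d] mem_dn[of "Suc i" d] by auto
  have U_step: "U d = U (Suc d) @ map T (column_cells n a (Suc d))" if "Suc d \<le> m" for d
    using that by (simp add: U_def upt_conv_Cons del: upt_Suc)
  have V_step: "V (Suc d) = map T (column_cells n a d) @ V d" if "1 \<le> d" for d
    using that by (simp add: V_def)
  have dec: "xs = cells_of n a (rev [Suc c..<Suc m]) @ cells_above n a r c"
      "ys = cells_below n a r c @ cells_of n a (rev [1..<c])"
  proof -
    have "rev [1..<Suc m] = rev [Suc c..<Suc m] @ c # rev [1..<c]"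
      using c1 cm by (intro rev_upt_split_at)
    then have "key_cells n a = (cells_of n a (rev [Suc c..<Suc m]) @ cells_above n a r c) @ (r, c) #
        (cells_below n a r c @ cells_of n a (rev [1..<c]))"
      unfolding key_cells_eq m_def[symmetric] using column_cells_split[OF rc] by (simp del: upt_Suc)
    then have eq: "xs @ (r, c) # ys = (cells_of n a (rev [Suc c..<Suc m]) @ cells_above n a r c) @ (r, c) #
        (cells_below n a r c @ cells_of n a (rev [1..<c]))" using xs(1) x by simp
    have "distinct (xs @ (r, c) # ys)" using distinct_key_cells[of n a] xs(1) x by simp
    then have "(r, c) \<notin> set xs" "(r, c) \<notin> set ys" by simp_all
    from append_Cons_eq_iff[OF this] eq
    show "xs = cells_of n a (rev [Suc c..<Suc m]) @ cells_above n a r c"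
      "ys = cells_below n a r c @ cells_of n a (rev [1..<c])" by metis+
  qed
  have u: "u = U c @ up c" and v: "v = dn c @ V c"
    using xs(2,4) dec by (simp_all add: U_def V_def up_def dn_def)
  have Trc: "T (r, c) = Suc i" using xs(3) x by simp
  have no_below: "T (s, c) \<noteq> i" if "s < r" for s
  proof
    assume "T (s, c) = i"
    then have "i \<in> set (dn c)" using that mem_dn[of i c] i by auto
    then obtain p q where "dn c = p @ i # q" by (meson split_list)
    then have "Suc i \<in> set p" using word_phi_eq_0_D[OF uv(3), of p "q @ V c"] v by simp
    then show False using Suc_up(2)[OF Trc] \<open>dn c = p @ i # q\<close> by simp
  qed
  then have "i \<notin> set (dn c)" using mem_dn[of i c] i by auto
  then have "word_eps i (dn c) = 0 \<and> word_phi i (dn c) = 0"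
    using Suc_up(2)[OF Trc] by (intro word_eps_phi_eq_0)
  then have phiV: "word_phi i (V c) = 0" using uv(3) v by (simp add: word_phi_append)
  \<comment> \<open>An entry \<open>i\<close> there would have to be paired with an \<open>i + 1\<close> further up in its column,
    and that \<open>i + 1\<close> would contradict the key condition for row \<open>r\<close>.\<close>
  have left: "T (s, d) \<noteq> i" if d: "c = Suc d" "1 \<le> d" and s: "r < s" for s d
  proof
    assume Ts: "T (s, d) = i"
    then have sd: "(s, d) \<in> diagram n a" using z[of "(s, d)"] i by auto
    have "V c = map T (cells_above n a s d) @ i # (map T (cells_below n a s d) @ V d)"
      using V_step[OF d(2)] d(1) column_cells_split[OF sd] Ts by simp
    then have "Suc i \<in> set (map T (cells_above n a s d))" using word_phi_eq_0_D[OF phiV] by blast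
    then obtain s' where s': "s < s'" "T (s', d) = Suc i" by (auto simp: set_cells_above)
    have "Suc i \<le> T (r, d)" using key_tableauD(3)[OF T d(2), of r] Trc d(1) by simp
    moreover have "T (r, d) \<noteq> Suc i" using key_tableauD(2)[OF T, of s' r d] s' s by auto
    ultimately have "T (s', d) < T (r, Suc d)"
      using key_tableauD(4)[OF T, of r s' d] s' s by auto
    then show False using s'(2) Trc d(1) by simp
  qed
  have stays_above: "T (s, Suc d) \<noteq> i" if d: "1 \<le> d" "T (r, d) = Suc i" and s: "s < r"
    and noti: "\<And>s. s < r \<Longrightarrow> T (s, d) \<noteq> i" for s d
  proof
    assume Ts: "T (s, Suc d) = i"
    then have "i \<le> T (s, d)" using key_tableauD(3)[OF T d(1), of s] by simp
    moreover have "T (s, d) \<noteq> Suc i" using only[of s d] d(2) s by auto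
    ultimately have "T (r, d) < T (s, d)" using noti[OF s] d(2) by linarith
    then show False using key_tableauD(4)[OF T s, of d] d(2) Ts by simp
  qed
  define c' where "c' = (LEAST d. c \<le> d \<and> (\<forall>s. T (s, d) \<noteq> i))"
  have "c \<le> Suc m + c \<and> (\<forall>s. T (s, Suc m + c) \<noteq> i)"
  proof (intro conjI allI)
    fix s
    have "(s, Suc m + c) \<notin> diagram n a" using diagram_max_column[of s "Suc m + c" n a] by (auto simp: m_def)
    then have "T (s, Suc m + c) = 0" using z by simp
    then show "T (s, Suc m + c) \<noteq> i" using i by linarith
  qed simp
  then have c': "c \<le> c'" "T (s, c') \<noteq> i" for s
    unfolding c'_def by (rule LeastI2, blast)+
  have before: "\<exists>s. T (s, d) = i" if "c \<le> d" "d < c'" for d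
    using not_less_Least[of d "\<lambda>d. c \<le> d \<and> (\<forall>s. T (s, d) \<noteq> i)"] that unfolding c'_def by blast
  have run: "T (r, d) = Suc i \<and> (\<forall>s<r. T (s, d) \<noteq> i) \<and> word_eps i (U d @ up d) = 0"
    if "c \<le> d" "d \<le> c'" for d
    using that
  proof (induction rule: dec_induct)
    case base
    show ?case using Trc no_below uv(2) u by simp
  next
    case (step d)
    then have IH: "T (r, d) = Suc i" "\<And>s. s < r \<Longrightarrow> T (s, d) \<noteq> i" "word_eps i (U d @ up d) = 0"
      and d1: "1 \<le> d" using c1 by auto
    obtain s where s: "T (s, d) = i" using before[of d] step by auto
    then have "r < s" using IH by (metis linorder_neqE_nat n_not_Suc_n)
    then have "i < T (r, Suc d)" using key_tableauD(4)[OF T, of r s d] s IH(1) i by simp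
    then have Tr: "T (r, Suc d) = Suc i" using key_tableauD(3)[OF T d1, of r] IH(1) by simp
    have nb: "T (s, Suc d) \<noteq> i" if "s < r" for s
      using stays_above[OF d1 IH(1) that IH(2)] .
    then have "i \<notin> set (dn (Suc d))" using mem_dn[of i "Suc d"] i by auto
    then have dn0: "word_eps i (dn (Suc d)) = 0 \<and> word_phi i (dn (Suc d)) = 0"
      using Suc_up(2)[OF Tr] by (intro word_eps_phi_eq_0)
    have "(r, Suc d) \<in> diagram n a" using Tr z[of "(r, Suc d)"] by auto
    then have "Suc d \<le> m" using diagram_max_column[of r "Suc d" n a] by (simp add: m_def)
    then have Ud: "U d = U (Suc d) @ up (Suc d) @ Suc i # dn (Suc d)"
      using U_step[of d] col[of "Suc d"] Tr by simp
    have "distinct (up d)" using dist[of d] col[of d] IH(1) by simp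
    \<comment> \<open>The single \<open>i\<close> above row \<open>r\<close> absorbs at most one unpaired \<open>i + 1\<close>; the one in row
      \<open>r\<close> of the next column uses it up.\<close>
    then have "word_phi i (up d) \<le> 1"
      using word_phi_le_count[of i "up d"] distinct_count_list[of "up d" i] by (auto split: if_splits)
    then have "word_eps i (U d) \<le> 1" using IH(3) by (simp add: word_eps_append)
    moreover have "word_eps i (U d) = Suc (word_eps i (U (Suc d) @ up (Suc d)))"
      using dn0 unfolding Ud append_assoc[symmetric] by (subst word_eps_append) simp
    ultimately show ?case using Tr nb by simp
  qed
  have epsU: "word_eps i (U c') = 0"
  proof -
    have r: "T (r, c') = Suc i" "word_eps i (U c' @ up c') = 0" using run[OF c'(1)] by auto
    have "i \<notin> set (up c')" using mem_up[of i c'] c'(2) i by auto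
    then have "word_eps i (up c') = 0 \<and> word_phi i (up c') = 0"
      using Suc_up(1)[OF r(1)] by (intro word_eps_phi_eq_0)
    then show ?thesis using r(2) by (simp add: word_eps_append)
  qed
  have stop: "T (r, Suc c') \<noteq> Suc i"
  proof
    assume Tr: "T (r, Suc c') = Suc i"
    then have "(r, Suc c') \<in> diagram n a" using z[of "(r, Suc c')"] by auto
    then have "Suc c' \<le> m" using diagram_max_column[of r "Suc c'" n a] by (simp add: m_def)
    then have "U c' = (U (Suc c') @ up (Suc c')) @ Suc i # dn (Suc c')"
      using U_step[of c'] col[of "Suc c'"] Tr by simp
    then have "i \<in> set (dn (Suc c'))" using word_eps_eq_0_D[OF epsU] by blast
    then obtain s where "s < r" "T (s, Suc c') = i" using mem_dn[of i "Suc c'"] i by auto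
    then show False using stays_above[of c' s] run[OF c'(1)] c1 c'(1) by auto
  qed
  have 1: "word_eps i (col_word (col_set n a T) (rev [Suc c'..<Suc m])) = 0"
    using col_word_eps_le[OF dist, of i "rev [Suc c'..<Suc m]"] epsU by (simp add: U_def del: upt_Suc)
  have 2: "word_phi i (col_word (col_set n a T) (rev [1..<c])) = 0"
    using col_word_phi_le[OF dist, of i "rev [1..<c]"] phiV by (simp add: V_def)
  have above: "r < s" if "c \<le> d" "d \<le> c'" "T (s, d) = i" for s d
    using run[OF that(1,2)] that(3) by (metis linorder_neqE_nat n_not_Suc_n)
  \<comment> \<open>The row decreases and differs from \<open>i + 1\<close> just after \<open>c'\<close>, hence stays below it.\<close>
  have C: "{d. c \<le> d \<and> T (r, d) = i + 1} = {c..c'}"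
  proof -
    have "T (r, d) < Suc i" if "c' < d" for d
    proof -
      have "T (r, d) \<le> T (r, Suc c')" using key_tableau_row_le[OF T, of "Suc c'" d r] that by simp
      moreover have "T (r, Suc c') \<le> T (r, c')"
        using key_tableauD(3)[OF T, of c' r] c1 c'(1) by simp
      ultimately show ?thesis using stop run[of c'] c'(1) by simp
    qed
    then show ?thesis using run by (force simp: not_less)
  qed
  have "S = (\<lambda>(s, d). if d \<in> {d. c \<le> d \<and> T (r, d) = i + 1} \<and> s = r then i
                else if d \<in> {d. c \<le> d \<and> T (r, d) = i + 1} \<and> T (s, d) = i then i + 1
                else T (s, d))"
    using raise unfolding key_raise_def max_suffix_excess_eq Let_def nth prod.case
    by (simp only: of_nat_le_0_iff eps if_False option.inject)
  also have "\<dots> = (\<lambda>(s, d). if c \<le> d \<and> d \<le> c' then transpose i (Suc i) (T (s, d)) else T (s, d))"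
  proof (intro ext, clarify)
    fix s d
    have "s \<noteq> r \<Longrightarrow> T (s, d) \<noteq> Suc i" if "c \<le> d" "d \<le> c'" using only[of s d] run[OF that] by blast
    then show "(if d \<in> {d. c \<le> d \<and> T (r, d) = i + 1} \<and> s = r then i
        else if d \<in> {d. c \<le> d \<and> T (r, d) = i + 1} \<and> T (s, d) = i then i + 1 else T (s, d)) =
      (if c \<le> d \<and> d \<le> c' then transpose i (Suc i) (T (s, d)) else T (s, d))"
      using run[of d] unfolding C
      by (cases "s = r"; cases "T (s, d) = i") (auto simp: transpose_def)
  qed
  finally have S: "S = (\<lambda>(s, d). if c \<le> d \<and> d \<le> c' then transpose i (Suc i) (T (s, d)) else T (s, d))" .
  show thesis
  proof (rule that[OF c1 c'(1) _ stop _ _ c'(2) _ 1[unfolded m_def] 2 S])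
    show "T (r, d) = Suc i" if "c \<le> d" "d \<le> c'" for d using run[OF that] by blast
    show "r < s" if "c \<le> d" "d \<le> c'" "T (s, d) = i" for s d using above[OF that] .
    show "\<exists>s. T (s, d) = i" if "c \<le> d" "d < c'" for d using before[OF that] .
    show "T (s, d) \<noteq> i" if "c = Suc d" "1 \<le> d" "r < s" for s d using left[OF that] .
  qed
qed


text \<open>
  In the columns from \<open>c\<close> to \<open>c'\<close> the operator exchanges the values \<open>i\<close> and \<open>i + 1\<close>. This
  preserves every comparison of two entries except that between \<open>i\<close> and \<open>i + 1\<close>
  themselves, so the conditions need attention only there and at the two ends of the segment. The column sets change only at
  \<open>c'\<close>. The last two claims control the first column.
\<close>

lemma key_raise_step:
  assumes T: "key_tableau n a T" and i: "1 \<le> i" and raise: "key_raise n a i T = Some S"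
  shows "key_tableau n a S"
    and "word_raise i (sorted_word n a T) = Some (sorted_word n a S)"
    and "\<And>x. S x = T x \<or> (T x = Suc i \<and> S x = i) \<or> (T x = i \<and> S x = Suc i)"
    and "\<And>s d. T (s, d) = i \<Longrightarrow> S (s, d) = Suc i \<Longrightarrow> \<exists>r<s. T (r, d) = Suc i"
proof -
  obtain r c c' where c1: "1 \<le> c" "c \<le> c'"
    and run: "\<And>d. c \<le> d \<Longrightarrow> d \<le> c' \<Longrightarrow> T (r, d) = Suc i"
    and stop: "T (r, Suc c') \<noteq> Suc i"
    and above: "\<And>s d. c \<le> d \<Longrightarrow> d \<le> c' \<Longrightarrow> T (s, d) = i \<Longrightarrow> r < s"
    and before: "\<And>d. c \<le> d \<Longrightarrow> d < c' \<Longrightarrow> \<exists>s. T (s, d) = i"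
    and noi: "\<And>s. T (s, c') \<noteq> i"
    and left: "\<And>s d. c = Suc d \<Longrightarrow> 1 \<le> d \<Longrightarrow> r < s \<Longrightarrow> T (s, d) \<noteq> i"
    and eps: "word_eps i (col_word (col_set n a T) (rev [Suc c'..<Suc (max_column n a)])) = 0"
    and phi: "word_phi i (col_word (col_set n a T) (rev [1..<c])) = 0"
    and S: "S = (\<lambda>(s, d). if c \<le> d \<and> d \<le> c' then transpose i (Suc i) (T (s, d)) else T (s, d))"
    by (rule key_raise_segment[OF T i raise]) (rule that)
  note z = key_tableau_eq_0_iff[OF T]
  have only: "s = r" if "c \<le> d" "d \<le> c'" "T (s, d) = Suc i" for s d
    using key_tableauD(2)[OF T, of s r d] run[of d] that by auto
  let ?t = "transpose i (Suc i)"
  have S_out: "S (s, d) = T (s, d)" if "\<not> (c \<le> d \<and> d \<le> c')" for s d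
    using that by (auto simp: S)
  have S_in: "S (s, d) = ?t (T (s, d))" if "c \<le> d" "d \<le> c'" for s d
    using that by (simp add: S)
  show rel: "S x = T x \<or> (T x = Suc i \<and> S x = i) \<or> (T x = i \<and> S x = Suc i)" for x
    by (cases x; cases "c \<le> snd x \<and> snd x \<le> c'") (auto simp: S_in S_out transpose_def)
  show "\<exists>r<s. T (r, d) = Suc i" if "T (s, d) = i" "S (s, d) = Suc i" for s d
  proof -
    have "c \<le> d \<and> d \<le> c'" using that S_out[of d s] by force
    then show ?thesis using above[of d s] run[of d] that(1) by blast
  qed
  have fS: "is_filling n a S"
  proof -
    have "S x = 0 \<longleftrightarrow> T x = 0" for x using rel[of x] i by auto
    then have "S x = 0 \<longleftrightarrow> x \<notin> diagram n a" for x using z by simp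
    then show ?thesis unfolding is_filling_def by (metis One_nat_def Suc_leI gr_zeroI)
  qed
  show "key_tableau n a S"
    unfolding key_tableau_iff
  proof (intro conjI fS allI impI)
    fix r0 s d assume rs: "r0 \<noteq> s" "S (r0, d) \<noteq> 0"
    have "T (r0, d) \<noteq> 0" using rel[of "(r0, d)"] rs i by auto
    then have "T (r0, d) \<noteq> T (s, d)" using key_tableauD(2)[OF T rs(1)] by simp
    moreover have "S (r0, d) = S (s, d) \<Longrightarrow> T (r0, d) = T (s, d)"
      using S_in S_out by (cases "c \<le> d \<and> d \<le> c'") (metis transpose_involutory, metis)
    ultimately show "S (r0, d) \<noteq> S (s, d)" by blast
  next
    fix r0 d :: nat assume d: "1 \<le> d"
    have le: "T (r0, Suc d) \<le> T (r0, d)" using key_tableauD(3)[OF T d] .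
    consider "c \<le> d" "Suc d \<le> c'" | "d = c'" | "c = Suc d" | "Suc d < c \<or> c' < d" using c1 by linarith
    then show "S (r0, Suc d) \<le> S (r0, d)"
    proof cases
      case 1
      have "\<not> (T (r0, Suc d) = i \<and> T (r0, d) = Suc i)"
        using only[of d r0] run[of "Suc d"] 1 by (metis Suc_leD le_SucI n_not_Suc_n)
      then show ?thesis using 1 le by (auto simp: S_in transpose_def)
    next
      case 2
      have "T (r0, d) \<noteq> i" using noi 2 by simp
      moreover have "T (r0, Suc d) \<noteq> Suc i" if "T (r0, d) = Suc i"
        using only[of d r0] stop c1 2 that by blast
      ultimately show ?thesis using 2 le c1 by (auto simp: S_in S_out transpose_def)
    next
      case 3
      have "T (r0, d) \<noteq> i" if "T (r0, Suc d) = i"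
        using left[OF 3 d] above[of "Suc d" r0] that 3 c1 by auto
      then show ?thesis using 3 le c1 by (auto simp: S_in S_out transpose_def)
    next
      case 4
      then show ?thesis using le by (auto simp: S_out)
    qed
  next
    fix r0 s d assume sr: "s < r0" and nz: "S (r0, d) \<noteq> 0" and lt: "S (r0, d) < S (s, d)"
    have nzT: "T (r0, d) \<noteq> 0" using rel[of "(r0, d)"] nz i by auto
    then have d: "1 \<le> d" using z[of "(r0, d)"] by (simp add: diagram_iff)
    note key = key_tableauD(4)[OF T sr nzT]
    consider "c \<le> d" "Suc d \<le> c'" | "d = c'" | "c = Suc d" | "Suc d < c \<or> c' < d" using c1 by linarith
    then show "S (r0, d) < S (s, Suc d)"
    proof cases
      case 1
      have no: "\<not> (T (r0, d) = Suc i \<and> T (s, d) = i)"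
        using only[of d r0] above[of d s] sr 1 by (metis Suc_leD less_asym)
      then have lt': "T (r0, d) < T (s, d)" "\<not> (T (r0, d) = i \<and> T (s, d) = Suc i)"
        using lt 1 by (auto simp: S_in transpose_def split: if_splits)
      have "\<not> (T (r0, d) = i \<and> T (s, Suc d) = Suc i)"
        using only[of "Suc d" s] run[of d] lt' 1 by (metis Suc_leD le_SucI)
      then show ?thesis using 1 key[OF lt'(1)] by (auto simp: S_in transpose_def)
    next
      case 2
      have no: "T (r0, d) \<noteq> i" "T (s, d) \<noteq> i" using noi 2 by auto
      then have "T (r0, d) < T (s, d)"
        using lt 2 c1 by (auto simp: S_in transpose_def split: if_splits)
      then show ?thesis using 2 key no c1 by (auto simp: S_in S_out transpose_def)
    next
      case 3
      have lt': "T (r0, d) < T (s, d)" using lt 3 by (simp add: S_out)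
      have "\<not> (T (r0, d) = i \<and> T (s, Suc d) = Suc i)"
        using only[of "Suc d" s] left[OF 3 d, of r0] sr 3 c1 by blast
      then show ?thesis using 3 key[OF lt'] c1 by (auto simp: S_in S_out transpose_def)
    next
      case 4
      then show ?thesis using lt key by (auto simp: S_out)
    qed
  qed
  let ?K = "col_set n a T"
  have image: "col_set n a S d = ?t ` ?K d" if "c \<le> d" "d \<le> c'" for d
    using that by (simp add: col_set_def S_in image_image)
  note memK = mem_col_set_iff[OF key_tableauD(1)[OF T]]
  have Si: "Suc i \<in> ?K d" if "c \<le> d" "d \<le> c'" for d using memK run[OF that] by blast
  have i': "i \<in> ?K d" if "c \<le> d" "d < c'" for d using memK[of i d] before[OF that] i by simp
  have ni: "i \<notin> ?K c'" using memK[of i c'] noi i by simp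
  have cols: "col_set n a S = ?K(c' := insert i (?K c' - {Suc i}))"
  proof
    fix d
    consider "\<not> (c \<le> d \<and> d \<le> c')" | "c \<le> d" "d < c'" | "d = c'" by linarith
    then show "col_set n a S d = (?K(c' := insert i (?K c' - {Suc i}))) d"
    proof cases
      case 1
      then show ?thesis using c1 by (auto simp: col_set_def S_out)
    next
      case 2
      have "?t ` ?K d = ?K d"
        using i'[OF 2] Si[of d] 2 by (auto simp: transpose_def image_iff)
      then show ?thesis using image[of d] 2 by simp
    next
      case 3
      have "?t ` ?K c' = insert i (?K c' - {Suc i})"
        using ni Si[of c'] c1 by (auto simp: transpose_def image_iff)
      then show ?thesis using image[of c'] 3 c1 by simp
    qed
  qed
  have phi': "word_phi i (col_word ?K (rev [1..<d])) = 0" if "c \<le> d" "d \<le> c'" for d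
    using that
  proof (induction rule: dec_induct)
    case (step d)
    then have "word_phi i (desc (?K d)) = 0" "word_eps i (desc (?K d)) = 0"
      using eps_phi_desc[of "?K d" i] i'[of d] Si[of d] by auto
    then show ?case using step c1 by (simp add: word_phi_append)
  qed (use phi in simp)
  have "(r, c') \<in> diagram n a" using run[of c'] c1 z[of "(r, c')"] by auto
  then have c'm: "c' \<le> max_column n a" by (rule diagram_max_column)
  then have "rev [1..<Suc (max_column n a)] = rev [Suc c'..<Suc (max_column n a)] @ c' # rev [1..<c']"
    using c1 by (intro rev_upt_split_at) simp_all
  note split = this
  have "distinct (rev [1..<Suc (max_column n a)])" by (simp only: distinct_rev distinct_upt)
  from col_word_raise[OF split this finite_col_set Si[OF c1(2) order_refl] ni eps
      phi'[OF c1(2) order_refl]]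
  show "word_raise i (sorted_word n a T) = Some (sorted_word n a S)"
    unfolding sorted_word_def cols .
qed

section \<open>Semi-standard key tableaux under the operators\<close>

lemma col_set_outside: "c \<notin> set [1..<Suc (max_column n a)] \<Longrightarrow> col_set n a T c = {}"
  using diagram_subset_cells[of _ c n a] by (auto simp: col_set_def simp del: upt_Suc set_upt)

lemma col_height_outside:
  "col_height n a 0 = 0" "col_height n a (Suc (max_column n a)) = 0"
  using diagram_subset_cells[of _ "Suc (max_column n a)" n a]
  by (auto simp: col_height_def diagram_iff card_eq_0_iff)

lemma sorted_word_inj:
  assumes T: "key_tableau n a T" and S: "key_tableau n a S" and eq: "sorted_word n a T = sorted_word n a S"
  shows "T = S"
proof (rule key_tableau_eqI[OF T S])
  fix c
  show "col_set n a T c = col_set n a S c"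
  proof (cases "c \<in> set (rev [1..<Suc (max_column n a)])")
    case True
    show ?thesis
    proof (rule col_word_inj[OF eq[unfolded sorted_word_def] _ _ _ True])
      show "card (col_set n a T c) = card (col_set n a S c)" for c
        using card_col_set[OF key_tableauD(1,2)[OF T]] card_col_set[OF key_tableauD(1,2)[OF S]] by simp
    qed simp_all
  next
    case False
    then show ?thesis by (metis col_set_outside set_rev)
  qed
qed

text \<open>
  Only a change from \<open>i\<close> to \<open>i + 1\<close> in the first column could exceed the row index, but it takes
  place above a row that already holds \<open>i + 1\<close>.
\<close>

lemma SSKT_raise_closed:
  assumes T: "T \<in> SSKT n a" and i: "1 \<le> i" and raise: "key_raise n a i T = Some S"
  shows "S \<in> SSKT n a"
  unfolding SSKT_iff
proof (intro conjI allI)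
  have kt: "key_tableau n a T" and le: "\<And>r. T (r, 1) \<le> r" using T by (auto simp: SSKT_iff)
  note step = key_raise_step[OF kt i raise]
  show "key_tableau n a S" by (rule step(1))
  fix r
  show "S (r, 1) \<le> r"
    using step(3)[of "(r, 1)"]
  proof (elim disjE conjE)
    assume "T (r, 1) = i" "S (r, 1) = Suc i"
    then obtain r' where "r' < r" "T (r', 1) = Suc i" using step(4) by blast
    then show ?thesis using le[of r'] \<open>S (r, 1) = Suc i\<close> by simp
  qed (use le[of r] in simp_all)
qed

lemma key_tableau_lower:
  assumes T: "T \<in> SSKT n a" and i: "1 \<le> i" "i < n"
    and lower: "word_lower i (sorted_word n a T) = Some w'"
  shows "\<exists>S. key_tableau n a S \<and> sorted_word n a S = w' \<and> key_raise n a i S = Some T"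
proof -
  have kt: "key_tableau n a T" using T by (simp add: SSKT_def)
  obtain K where K: "anti_cols n (col_height n a) K" "w' = col_word K (rev [1..<Suc (max_column n a)])"
    using anti_cols_lower[OF anti_cols_col_set[OF T] col_height_outside(1) i(2)
        lower[unfolded sorted_word_def]] by blast
  obtain S where S: "key_tableau n a S" "\<forall>c. col_set n a S c = K c"
    using exists_key_tableau[OF K(1)] by blast
  have w: "sorted_word n a S = w'"
    using S(2) K(2) by (simp add: sorted_word_def ext del: upt_Suc) (metis ext)
  have raise: "word_raise i (sorted_word n a S) = Some (sorted_word n a T)"
    using lower w by (simp add: word_raise_lower_inverse)
  then obtain T' where T': "key_raise n a i S = Some T'"
    using key_raise_None[OF S(1), of i] by (cases "key_raise n a i S") auto
  have "T' = T"
    using key_raise_step(1,2)[OF S(1) i(1) T'] raise by (intro sorted_word_inj[OF _ kt]) simp_all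
  then show ?thesis using S(1) w T' by blast
qed

text \<open>
  The lowered word belongs to some key tableau \<open>S\<close>, and \<open>T\<close> is obtained from \<open>S\<close> by raising. If \<open>S\<close>
  is not semi-standard, row \<open>i\<close> begins with \<open>i + 1\<close>. Row \<open>i + 1\<close> then begins with a
  smaller entry, which is an inversion excluded by \<open>a i \<le> a (i + 1)\<close>.
\<close>

lemma SSKT_lower_closed:
  assumes T: "T \<in> SSKT n a" and i: "1 \<le> i" "i < n" and a: "a i \<le> a (Suc i)"
    and lower: "word_lower i (sorted_word n a T) = Some w'"
  shows "\<exists>S \<in> SSKT n a. sorted_word n a S = w'"
proof -
  obtain S where S: "key_tableau n a S" "sorted_word n a S = w'" "key_raise n a i S = Some T"
    using key_tableau_lower[OF T i lower] by blast
  have le: "T (r, 1) \<le> r" for r using T by (simp add: SSKT_iff)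
  note rel = key_raise_step(3)[OF S(1) i(1) S(3)]
  have "S (r, 1) \<le> r" for r
  proof (rule ccontr)
    assume gt: "\<not> S (r, 1) \<le> r"
    then have ST: "T (r, 1) = i" "S (r, 1) = Suc i" using rel[of "(r, 1)"] le[of r] by auto
    then have "r = i" using gt le[of r] by simp
    then have *: "S (i, 1) = Suc i" using ST(2) by simp
    have "(i, 1) \<in> diagram n a"
      using * key_tableau_eq_0_iff[OF S(1), of "(i, 1)"] by auto
    then have "(Suc i, 1) \<in> diagram n a" using a i by (auto simp: diagram_iff)
    then have "S (Suc i, 1) \<noteq> 0"
      using key_tableau_eq_0_iff[OF S(1), of "(Suc i, 1)"] by simp
    then have "S (i, 1) < S (Suc i, 1)"
      using no_adjacent_inversion[OF S(1) a i] by simp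
    then show False using * rel[of "(Suc i, 1)"] le[of "Suc i"] by auto
  qed
  then show ?thesis using S by (auto simp: SSKT_iff)
qed

lemma max_column_swap:
  assumes "1 \<le> i" "i < n"
  shows "max_column n (a \<circ> transpose i (Suc i)) = max_column n a"
proof -
  have "transpose i (Suc i) ` {1..n} = {1..n}"
    using assms by (simp add: transpose_image_eq)
  then have "(a \<circ> transpose i (Suc i)) ` {1..n} = a ` {1..n}" by (simp only: image_comp[symmetric])
  then show ?thesis by (simp only: max_column_def)
qed

text \<open>
  Let \<open>d\<close> be the last column in which row \<open>i + 1\<close> holds \<open>i + 1\<close>. All columns up to
  \<open>d\<close> contain \<open>i + 1\<close>, and column \<open>d\<close> does not contain \<open>i\<close>: row \<open>i\<close> is excluded by
  hypothesis, lower rows by semi-standardness, higher rows by the key condition. So the \<open>i + 1\<close> of column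
  \<open>d\<close> stays unpaired.
\<close>

lemma word_eps_pos_of_first_column:
  assumes T: "T \<in> SSKT n a" and i: "1 \<le> i" and first: "T (Suc i, 1) = Suc i"
    and lt: "\<And>c. 1 \<le> c \<Longrightarrow> c \<le> a i \<Longrightarrow> T (i, c) < T (Suc i, Suc c)"
  shows "word_eps i (sorted_word n a T) \<noteq> 0"
proof -
  have kt: "key_tableau n a T" and le: "\<And>r. T (r, 1) \<le> r" using T by (auto simp: SSKT_iff)
  note z = key_tableau_eq_0_iff[OF kt]
  let ?K = "col_set n a T"
  note memK = mem_col_set_iff[OF key_tableauD(1)[OF kt]]
  define d where "d = (LEAST d. T (Suc i, Suc d) \<noteq> Suc i)"
  have "T (Suc i, Suc (max_column n a)) = 0"
    using z[of "(Suc i, Suc (max_column n a))"] diagram_max_column[of "Suc i" "Suc (max_column n a)" n a] by auto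
  then have stop: "T (Suc i, Suc d) \<noteq> Suc i"
    using LeastI[of "\<lambda>d. T (Suc i, Suc d) \<noteq> Suc i" "max_column n a"] unfolding d_def by simp
  have run: "T (Suc i, c) = Suc i" if "1 \<le> c" "c \<le> d" for c
    using not_less_Least[of "c - 1" "\<lambda>d. T (Suc i, Suc d) \<noteq> Suc i"] that unfolding d_def[symmetric] by simp
  have d1: "1 \<le> d" using stop first by (cases d) auto
  have small: "T (Suc i, Suc d) \<le> i"
    using key_tableauD(3)[OF kt d1, of "Suc i"] run[OF d1 order_refl] stop by simp
  have "T (s, d) \<noteq> i" for s
  proof
    assume Ts: "T (s, d) = i"
    have sd: "(s, d) \<in> diagram n a" using Ts i z[of "(s, d)"] by auto
    have "i \<le> s" using key_tableau_row_le[OF kt _ d1, of s] le[of s] Ts by simp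
    moreover have "s \<noteq> i" using lt[OF d1] sd Ts small by (auto simp: diagram_iff)
    moreover have "s \<noteq> Suc i" using run[OF d1 order_refl] Ts by auto
    ultimately have "Suc i < s" by simp
    then show False using key_tableauD(4)[OF kt, of "Suc i" s d] run[OF d1 order_refl] Ts small i by simp
  qed
  then have ni: "i \<notin> ?K d" using memK[of i d] i by simp
  have Si: "Suc i \<in> ?K c" if "1 \<le> c" "c \<le> d" for c using memK[of "Suc i" c] run[OF that] by blast
  have phi: "word_phi i (col_word ?K (rev [1..<c])) = 0" if "1 \<le> c" "c \<le> d" for c
    using that
  proof (induction rule: dec_induct)
    case (step c)
    then have "word_phi i (desc (?K c)) = 0" using eps_phi_desc(2)[of "?K c" i] Si[of c] by auto
    then show ?case using step by (simp add: word_phi_append)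
  qed simp
  have "word_eps i (col_word ?K (d # rev [1..<d])) \<noteq> 0"
    using eps_phi_desc(1)[of "?K d" i] Si[OF d1 order_refl] ni phi[OF d1 order_refl]
    by (simp add: word_eps_append)
  moreover have "d \<le> max_column n a"
    using run[OF d1 order_refl] z[of "(Suc i, d)"] by (intro diagram_max_column[of "Suc i"]) auto
  then have "rev [1..<Suc (max_column n a)] = rev [Suc d..<Suc (max_column n a)] @ d # rev [1..<d]"
    using d1 by (intro rev_upt_split_at)
  ultimately show ?thesis
    using word_eps_suffix[of i "col_word ?K (rev [Suc d..<Suc (max_column n a)])"]
    unfolding sorted_word_def by (metis col_word_simps(3))
qed

text \<open>
  The exchange of rows \<open>i\<close> and \<open>i + 1\<close> can violate semi-standardness only if it moves an entry
  \<open>i + 1\<close> to the beginning of row \<open>i\<close>, and in that case \<open>T\<close> could be raised.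
\<close>

lemma SSKT_highest_in_swap:
  assumes T: "T \<in> SSKT n a" and i: "1 \<le> i" "i < n" and a: "a i < a (Suc i)"
    and eps: "word_eps i (sorted_word n a T) = 0"
  shows "\<exists>S \<in> SSKT n (a \<circ> transpose i (Suc i)).
    sorted_word n (a \<circ> transpose i (Suc i)) S = sorted_word n a T"
proof -
  have kt: "key_tableau n a T" and le: "\<And>r. T (r, 1) \<le> r" using T by (auto simp: SSKT_iff)
  let ?a = "a \<circ> transpose i (Suc i)"
  obtain S where S: "key_tableau n ?a S" "\<And>c. col_set n ?a S c = col_set n a T c"
    "\<And>r. r \<noteq> i \<Longrightarrow> r \<noteq> Suc i \<Longrightarrow> S (r, 1) = T (r, 1)"
    "(S (i, 1) = T (i, 1) \<and> S (Suc i, 1) = T (Suc i, 1)) \<or>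
     (S (i, 1) = T (Suc i, 1) \<and> S (Suc i, 1) = T (i, 1) \<and>
      (\<forall>c. 1 \<le> c \<longrightarrow> c \<le> a i \<longrightarrow> T (i, c) < T (Suc i, Suc c)))"
    using swap_rows[OF kt a i] by blast
  have first: "S (i, 1) \<le> i \<and> S (Suc i, 1) \<le> Suc i"
    using S(4)
  proof
    assume *: "S (i, 1) = T (Suc i, 1) \<and> S (Suc i, 1) = T (i, 1) \<and>
      (\<forall>c. 1 \<le> c \<longrightarrow> c \<le> a i \<longrightarrow> T (i, c) < T (Suc i, Suc c))"
    then have "T (Suc i, 1) \<noteq> Suc i"
      using word_eps_pos_of_first_column[OF T i(1)] eps by blast
    then show ?thesis using * le[of "Suc i"] le[of i] by auto
  next
    assume "S (i, 1) = T (i, 1) \<and> S (Suc i, 1) = T (Suc i, 1)"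
    then show ?thesis using le by simp
  qed
  have "S (r, 1) \<le> r" for r
    using first S(3)[of r] le[of r] by (cases "r = i"; cases "r = Suc i") auto
  then have "S \<in> SSKT n ?a" using S(1) by (simp add: SSKT_iff)
  moreover have "sorted_word n ?a S = sorted_word n a T"
    unfolding sorted_word_def max_column_swap[OF i] using S(2) by (intro col_word_cong)
  ultimately show ?thesis by blast
qed

text \<open>
  The key tableau of shape \<open>a\<close> with the columns of \<open>S\<close> turns into \<open>S\<close> under the exchange of
  rows, so its first column is that of \<open>S\<close> with the entries of rows \<open>i\<close> and \<open>i + 1\<close> in
  increasing order.
\<close>

lemma SSKT_swap_subset:
  assumes i: "1 \<le> i" "i < n" and a: "a i < a (Suc i)" and S: "S \<in> SSKT n (a \<circ> transpose i (Suc i))"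
  shows "\<exists>T \<in> SSKT n a. sorted_word n a T = sorted_word n (a \<circ> transpose i (Suc i)) S"
proof -
  let ?a = "a \<circ> transpose i (Suc i)"
  have ktS: "key_tableau n ?a S" and le: "\<And>r. S (r, 1) \<le> r" using S by (auto simp: SSKT_iff)
  have "anti_cols n (col_height n a) (col_set n ?a S)"
    using anti_cols_col_set[OF S] col_height_swap[OF i, of a]
    by (auto simp: anti_cols_def cols_in_def)
  then obtain T where T: "key_tableau n a T" "\<And>c. col_set n a T c = col_set n ?a S c"
    using exists_key_tableau by blast
  obtain S' where S': "key_tableau n ?a S'" "\<And>c. col_set n ?a S' c = col_set n a T c"
    "\<And>r. r \<noteq> i \<Longrightarrow> r \<noteq> Suc i \<Longrightarrow> S' (r, 1) = T (r, 1)"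
    "(S' (i, 1) = T (i, 1) \<and> S' (Suc i, 1) = T (Suc i, 1)) \<or>
     (S' (i, 1) = T (Suc i, 1) \<and> S' (Suc i, 1) = T (i, 1))"
    using swap_rows[OF T(1) a i] by blast
  have eq: "S' = S" using T(2) S'(2) by (intro key_tableau_eqI[OF S'(1) ktS]) simp
  have "(Suc i, 1) \<in> diagram n a" using a i by (auto simp: diagram_iff)
  then have "T (Suc i, 1) \<noteq> 0" using key_tableau_eq_0_iff[OF T(1), of "(Suc i, 1)"] by simp
  then have lt: "T (i, 1) < T (Suc i, 1)" using no_adjacent_inversion[OF T(1) _ i] a by simp
  have "T (r, 1) \<le> r" for r
    using S'(3)[of r] S'(4) lt le[of r] le[of i] le[of "Suc i"] unfolding eq
    by (cases "r = i"; cases "r = Suc i") auto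
  then have "T \<in> SSKT n a" using T(1) by (simp add: SSKT_iff)
  moreover have "sorted_word n a T = sorted_word n ?a S"
    unfolding sorted_word_def max_column_swap[OF i] using T(2) by (intro col_word_cong)
  ultimately show ?thesis by blast
qed

section \<open>The highest weight element\<close>

lemma partition_column:
  assumes "is_partition n lam"
  shows "{r. (r, c) \<in> diagram n lam} = {1..col_height n lam c}"
  unfolding col_height_def
proof (rule initial_segment)
  show "0 \<notin> {r. (r, c) \<in> diagram n lam}" by (simp add: diagram_iff)
  fix i assume i: "1 \<le> i" "Suc i \<in> {r. (r, c) \<in> diagram n lam}"
  then have n: "Suc i \<le> n" "1 \<le> c" "c \<le> lam (Suc i)" by (simp_all add: diagram_iff)
  have "lam (Suc i) \<le> lam i"
    using assms i(1) n(1) unfolding is_partition_def by (auto intro: bspec)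
  then show "i \<in> {r. (r, c) \<in> diagram n lam}" using i(1) n by (simp add: diagram_iff)
qed simp

lemma key_tableau_highest: "is_partition n lam \<Longrightarrow> key_tableau n lam (highest_weight_tableau n lam)"
  unfolding key_tableau_iff is_filling_def
  by (auto simp: highest_weight_tableau_def diagram_iff)

text \<open>
  Columns of a partition shape are initial segments of rows, so distinctness and the bound by the row index
  force the entry \<open>r\<close> in row \<open>r\<close>, from the bottom upwards.
\<close>

lemma SSKT_partition:
  assumes lam: "is_partition n lam"
  shows "SSKT n lam = {highest_weight_tableau n lam}"
proof (intro equalityI subsetI)
  fix T assume T: "T \<in> SSKT n lam"
  then have kt: "key_tableau n lam T" by (simp add: SSKT_def)
  note z = key_tableau_eq_0_iff[OF kt]
  have "T (r, c) = r" if "(r, c) \<in> diagram n lam" for r c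
    using that
  proof (induction r rule: less_induct)
    case (less r)
    have "T (r, c) \<noteq> s" if "s < r" for s
    proof (cases "s = 0")
      case True
      then show ?thesis using z[of "(r, c)"] less.prems by simp
    next
      case False
      have "r \<in> {1..col_height n lam c}" using less.prems partition_column[OF lam, of c] by blast
      then have "s \<in> {r. (r, c) \<in> diagram n lam}"
        using that False unfolding partition_column[OF lam] by auto
      then have "T (s, c) = s" "T (s, c) \<noteq> 0" using less.IH[OF that] False by auto
      then show ?thesis using key_tableauD(2)[OF kt, of s r c] that by auto
    qed
    moreover have "T (r, c) \<le> r" using T less.prems by (simp add: SSKT_def)
    ultimately show ?case by (metis le_neq_implies_less)
  qed
  then show "T \<in> {highest_weight_tableau n lam}"
    using z by (auto simp: highest_weight_tableau_def fun_eq_iff)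
next
  fix T assume "T \<in> {highest_weight_tableau n lam}"
  then show "T \<in> SSKT n lam"
    using key_tableau_highest[OF lam] by (auto simp: SSKT_iff highest_weight_tableau_def diagram_iff)
qed

lemma col_set_highest:
  assumes "is_partition n lam"
  shows "col_set n lam (highest_weight_tableau n lam) c = {1..col_height n lam c}"
proof -
  have "col_set n lam (highest_weight_tableau n lam) c = (\<lambda>r. r) ` {r. (r, c) \<in> diagram n lam}"
    unfolding col_set_def by (intro image_cong) (auto simp: highest_weight_tableau_def)
  then show ?thesis using partition_column[OF assms, of c] by simp
qed

section \<open>Young tableaux\<close>

lemma SSYT_D:
  assumes "Y \<in> SSYT n lam"
  shows "is_filling n lam Y" and "r \<noteq> s \<Longrightarrow> Y (r, c) \<noteq> 0 \<Longrightarrow> Y (r, c) \<noteq> Y (s, c)"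
proof -
  show f: "is_filling n lam Y" using assms by (simp add: SSYT_def)
  have lt: "Y (p, c) < Y (q, c)" if "(p, c) \<in> diagram n lam" "(q, c) \<in> diagram n lam" "p < q" for p q
    using assms that by (simp add: SSYT_def)
  assume rs: "r \<noteq> s" "Y (r, c) \<noteq> 0"
  show "Y (r, c) \<noteq> Y (s, c)"
  proof
    assume eq: "Y (r, c) = Y (s, c)"
    then have "(r, c) \<in> diagram n lam" "(s, c) \<in> diagram n lam"
      using rs(2) filling_eq_0_iff[OF f, of "(r, c)"] filling_eq_0_iff[OF f, of "(s, c)"] by auto
    then show False using lt[of r s] lt[of s r] rs(1) eq by (cases "r < s") auto
  qed
qed

lemma young_cols_col_set:
  assumes Y: "Y \<in> SSYT n lam"
  shows "young_cols n (col_height n lam) (col_set n lam Y)"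
proof -
  note fill = SSYT_D[OF Y]
  have row: "Y (r, c) \<le> Y (r, Suc c)" if "1 \<le> c" "(r, Suc c) \<in> diagram n lam" for r c
    using Y that by (auto simp: SSYT_def diagram_iff)
  have "col_set n lam Y c \<subseteq> {1..n}" for c
    using Y by (auto simp: SSYT_def col_set_def is_filling_def)
  moreover have "count_le (col_set n lam Y (Suc c)) t \<le> count_le (col_set n lam Y c) t" if "1 \<le> c" for c t
    unfolding count_le_def using that row[OF that]
    by (intro card_filter_col_set_mono[OF fill]) (auto simp: diagram_iff intro: le_trans)
  ultimately show ?thesis using card_col_set[OF fill] by (auto simp: young_cols_def cols_in_def)
qed

lemma map_column_increasing:
  assumes "\<And>r s. (r, c) \<in> diagram n a \<Longrightarrow> (s, c) \<in> diagram n a \<Longrightarrow> r < s \<Longrightarrow> T (r, c) < T (s, c)"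
  shows "map T (column_cells n a c) = desc (col_set n a T c)"
proof -
  have "sorted_wrt (\<lambda>x y. fst y < fst x) (column_cells n a c)"
  proof -
    have "sorted_wrt (>) (rev [1..<Suc n])"
      using sorted_wrt_upt[of 1 "Suc n"] by (simp only: sorted_wrt_rev)
    then have "sorted_wrt (\<lambda>x y. fst y < fst x) (map (\<lambda>r. (r, c)) (rev [1..<Suc n]))"
      by (simp only: sorted_wrt_map fst_conv)
    then show ?thesis unfolding column_cells_def by (rule sorted_wrt_filter)
  qed
  then have "sorted_wrt (\<lambda>x y. T y < T x) (column_cells n a c)"
    by (rule sorted_wrt_mono_rel[rotated]) (auto simp: set_column_cells assms)
  then have "sorted_wrt (>) (map T (column_cells n a c))" by (simp add: sorted_wrt_map)
  from desc_unique[OF this] show ?thesis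
    by (simp add: set_column_cells col_set_def image_def)
qed

lemma young_word_eq:
  assumes Y: "Y \<in> SSYT n lam"
  shows "young_word n lam Y = col_word (col_set n lam Y) [1..<Suc (max_column n lam)]"
proof -
  have "map Y (column_cells n lam c) = desc (col_set n lam Y c)" for c
    using Y by (intro map_column_increasing) (auto simp: SSYT_def)
  then have "map Y (cells_of n lam cs) = col_word (col_set n lam Y) cs" for cs
    by (induction cs) simp_all
  then show ?thesis unfolding young_word_def young_cells_eq .
qed

lemma desc_nth_le_iff:
  assumes "finite A" "1 \<le> r" "r \<le> card A"
  shows "desc A ! (card A - r) \<le> t \<longleftrightarrow> r \<le> count_le A t"
  using desc_nth_ge_iff[OF assms(1), of "card A - r" "Suc t"] count_ge_le_card[OF assms(1), of t] assms
  by auto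

lemma exists_SSYT:
  assumes lam: "is_partition n lam" and K: "young_cols n (col_height n lam) K"
  shows "\<exists>Y \<in> SSYT n lam. \<forall>c. col_set n lam Y c = K c"
proof -
  have cin: "cols_in n (col_height n lam) K" using K by (simp add: young_cols_def)
  note fin = cols_in_finite[OF cin]
  have card: "card (K c) = col_height n lam c" and sub: "K c \<subseteq> {1..n}" for c
    using cin by (auto simp: cols_in_def)
  have diag: "(r, c) \<in> diagram n lam \<longleftrightarrow> 1 \<le> r \<and> r \<le> card (K c)" for r c
    using partition_column[OF lam, of c] card by auto
  define Y where "Y = (\<lambda>(r, c). if (r, c) \<in> diagram n lam then desc (K c) ! (card (K c) - r) else 0)"
  have Y: "Y (r, c) = desc (K c) ! (card (K c) - r)" if "(r, c) \<in> diagram n lam" for r c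
    using that by (simp add: Y_def)
  have inK: "Y (r, c) \<in> K c" if "(r, c) \<in> diagram n lam" for r c
  proof -
    have "card (K c) - r < length (desc (K c))" using that diag by auto
    then show ?thesis using Y[OF that] set_desc[OF fin] nth_mem by metis
  qed
  have f: "is_filling n lam Y"
    unfolding is_filling_def
  proof (intro conjI ballI allI impI)
    fix x assume "x \<in> diagram n lam"
    then show "1 \<le> Y x" using inK sub by (cases x) fastforce
  next
    fix x assume "x \<notin> diagram n lam"
    then show "Y x = 0" by (cases x) (simp add: Y_def)
  qed
  have col: "Y (r, c) < Y (s, c)" if "(r, c) \<in> diagram n lam" "(s, c) \<in> diagram n lam" "r < s" for r s c
    using that(3) Y[OF that(1)] Y[OF that(2)] diag[of r c] diag[of s c] that(1,2) sorted_desc[of "K c"]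
    by (auto simp: sorted_wrt_iff_nth_less)
  have row: "Y (r, c) \<le> Y (r, Suc c)" if d: "(r, Suc c) \<in> diagram n lam" "1 \<le> c" for r c
  proof -
    have d': "(r, c) \<in> diagram n lam" using d by (simp add: diagram_iff)
    have "r \<le> count_le (K (Suc c)) (Y (r, Suc c))"
      using desc_nth_le_iff[OF fin[of "Suc c"], of r "Y (r, Suc c)"] Y[OF d(1)] diag d(1) by simp
    also have "\<dots> \<le> count_le (K c) (Y (r, Suc c))" using K d(2) by (simp add: young_cols_def)
    finally show ?thesis
      using desc_nth_le_iff[OF fin[of c], of r "Y (r, Suc c)"] Y[OF d'] diag d' by simp
  qed
  have rows: "Y (r, c) \<le> Y (r, d)" if "c \<le> d" "(r, c) \<in> diagram n lam" "(r, d) \<in> diagram n lam" for r c d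
    using that
  proof (induction rule: dec_induct)
    case (step k)
    then have "(r, k) \<in> diagram n lam" "1 \<le> k" by (auto simp: diagram_iff)
    then show ?case using step row[of r k] by fastforce
  qed simp
  have SS: "Y \<in> SSYT n lam"
    unfolding SSYT_def using f col rows inK sub by fastforce
  moreover have "col_set n lam Y c = K c" for c
  proof (rule card_subset_eq[OF fin])
    show "col_set n lam Y c \<subseteq> K c" using inK by (auto simp: col_set_def)
    show "card (col_set n lam Y c) = card (K c)"
      using card_col_set[OF SSYT_D[OF SS]] card by simp
  qed
  ultimately show ?thesis by blast
qed

lemma young_raise_word:
  "map_option (young_word n lam) (young_raise n lam i Y) = word_raise i (young_word n lam Y)"
proof (cases "word_raise i (young_word n lam Y)")
  case None
  then have "word_eps i (young_word n lam Y) = 0" by (simp only: word_raise_None_iff)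
  then show ?thesis using None by (simp add: young_raise_def max_suffix_excess_eq)
next
  case (Some w')
  then obtain u v where uv: "young_word n lam Y = u @ Suc i # v" "w' = u @ i # v"
    "word_eps i u = 0" "word_phi i v = 0"
    by (auto simp: word_raise_iff)
  have pos: "raise_pos i (young_word n lam Y) = length u" using raise_pos_eq[OF uv(1,3,4)] .
  obtain xs x ys where xs: "young_cells n lam = xs @ x # ys" "map Y xs = u" "map Y ys = v"
    using uv(1) unfolding young_word_def by (auto simp: map_eq_append_conv map_eq_Cons_conv)
  have "x \<notin> set xs" "x \<notin> set ys" using distinct_young_cells[of n lam] xs(1) by auto
  then have "young_word n lam (Y(x := i)) = w'"
    using xs uv(2) by (simp add: young_word_def)
  moreover have "young_cells n lam ! length u = x" using xs by (metis length_map nth_append_length)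
  moreover have "word_eps i (young_word n lam Y) \<noteq> 0" using Some word_raise_None_iff[of i "young_word n lam Y"] by simp
  ultimately show ?thesis using Some pos by (simp add: young_raise_def max_suffix_excess_eq)
qed

lemma young_lower_word:
  "map_option (young_word n lam) (young_lower n lam i Y) = word_lower i (young_word n lam Y)"
proof (cases "word_lower i (young_word n lam Y)")
  case None
  then have "word_phi i (young_word n lam Y) = 0" by (simp only: word_lower_None_iff)
  then show ?thesis using None by (simp add: young_lower_def max_prefix_excess_eq)
next
  case (Some w')
  then obtain u v where uv: "young_word n lam Y = u @ i # v" "w' = u @ Suc i # v"
    "word_eps i u = 0" "word_phi i v = 0"
    by (auto simp: word_lower_iff)
  have pos: "lower_pos i (young_word n lam Y) = length u" using lower_pos_eq[OF uv(1,3,4)] .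
  obtain xs x ys where xs: "young_cells n lam = xs @ x # ys" "map Y xs = u" "map Y ys = v"
    using uv(1) unfolding young_word_def by (auto simp: map_eq_append_conv map_eq_Cons_conv)
  have "x \<notin> set xs" "x \<notin> set ys" using distinct_young_cells[of n lam] xs(1) by auto
  then have "young_word n lam (Y(x := Suc i)) = w'"
    using xs uv(2) by (simp add: young_word_def)
  moreover have "young_cells n lam ! length u = x" using xs by (metis length_map nth_append_length)
  moreover have "word_phi i (young_word n lam Y) \<noteq> 0" using Some word_lower_None_iff[of i "young_word n lam Y"] by simp
  ultimately show ?thesis using Some pos by (simp add: young_lower_def max_prefix_excess_eq)
qed

lemma young_word_inj:
  assumes "is_filling n lam Y" "is_filling n lam Z" "young_word n lam Y = young_word n lam Z"
  shows "Y = Z"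
proof
  fix x
  show "Y x = Z x"
  proof (cases "x \<in> diagram n lam")
    case True
    then show ?thesis using assms(3) set_young_cells[of n lam] by (simp add: young_word_def)
  next
    case False
    then show ?thesis using filling_eq_0_iff[OF assms(1), of x] filling_eq_0_iff[OF assms(2), of x] by simp
  qed
qed

lemma young_cells_nth: "p < length (young_word n lam Y) \<Longrightarrow> young_cells n lam ! p \<in> diagram n lam"
  using nth_mem[of p "young_cells n lam"] set_young_cells[of n lam] by (simp add: young_word_def)

lemma raise_pos_less: "word_eps i w \<noteq> 0 \<Longrightarrow> raise_pos i w < length w"
  using unpaired_upper_split[of i w] raise_pos_eq[of w _ i] by fastforce

lemma lower_pos_less: "word_phi i w \<noteq> 0 \<Longrightarrow> lower_pos i w < length w"
  using unpaired_lower_split[of i w] lower_pos_eq[of w _ i] by fastforce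

lemma is_filling_upd: "is_filling n lam Y \<Longrightarrow> x \<in> diagram n lam \<Longrightarrow> 1 \<le> k \<Longrightarrow> is_filling n lam (Y(x := k))"
  by (auto simp: is_filling_def)

lemma young_raise_filling:
  assumes "is_filling n lam Y" "1 \<le> i" "young_raise n lam i Y = Some Z"
  shows "is_filling n lam Z"
  using assms raise_pos_less[of i "young_word n lam Y"]
  by (auto simp: young_raise_def max_suffix_excess_eq split: if_splits intro!: is_filling_upd young_cells_nth)

lemma young_lower_filling:
  assumes "is_filling n lam Y" "young_lower n lam i Y = Some Z"
  shows "is_filling n lam Z"
  using assms lower_pos_less[of i "young_word n lam Y"]
  by (auto simp: young_lower_def max_prefix_excess_eq split: if_splits intro!: is_filling_upd young_cells_nth)

lemma SSYT_of_young_cols: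
  assumes lam: "is_partition n lam" and K: "young_cols n (col_height n lam) K" and Z: "is_filling n lam Z"
    and w: "young_word n lam Z = col_word K [1..<Suc (max_column n lam)]"
  shows "Z \<in> SSYT n lam"
proof -
  obtain Y where Y: "Y \<in> SSYT n lam" "\<forall>c. col_set n lam Y c = K c"
    using exists_SSYT[OF lam K] by blast
  have "young_word n lam Y = young_word n lam Z"
    using young_word_eq[OF Y(1)] Y(2) w col_word_cong[of _ "col_set n lam Y" K] by simp
  then have "Y = Z" by (intro young_word_inj[OF SSYT_D(1)[OF Y(1)] Z])
  then show ?thesis using Y by simp
qed

lemma SSYT_raise_closed:
  assumes lam: "is_partition n lam" and Y: "Y \<in> SSYT n lam" and i: "1 \<le> i"
    and raise: "young_raise n lam i Y = Some Z"
  shows "Z \<in> SSYT n lam" and "word_raise i (young_word n lam Y) = Some (young_word n lam Z)"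
proof -
  show w: "word_raise i (young_word n lam Y) = Some (young_word n lam Z)"
    using young_raise_word[of n lam i Y] raise by simp
  show "Z \<in> SSYT n lam"
    using young_cols_raise[OF young_cols_col_set[OF Y] i w[unfolded young_word_eq[OF Y]]]
      SSYT_of_young_cols[OF lam _ young_raise_filling[OF SSYT_D(1)[OF Y] i raise]] by blast
qed

lemma SSYT_lower_closed:
  assumes lam: "is_partition n lam" and Y: "Y \<in> SSYT n lam" and i: "1 \<le> i" "i < n"
    and lower: "young_lower n lam i Y = Some Z"
  shows "Z \<in> SSYT n lam" and "word_lower i (young_word n lam Y) = Some (young_word n lam Z)"
proof -
  show w: "word_lower i (young_word n lam Y) = Some (young_word n lam Z)"
    using young_lower_word[of n lam i Y] lower by simp
  show "Z \<in> SSYT n lam"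
    using young_cols_lower[OF young_cols_col_set[OF Y] col_height_outside(2) i w[unfolded young_word_eq[OF Y]]]
      SSYT_of_young_cols[OF lam _ young_lower_filling[OF SSYT_D(1)[OF Y] lower]] by blast
qed

lemma young_raise_iff:
  assumes "is_partition n lam" "Y \<in> SSYT n lam" "Z \<in> SSYT n lam" "1 \<le> i"
  shows "young_raise n lam i Y = Some Z \<longleftrightarrow> word_raise i (young_word n lam Y) = Some (young_word n lam Z)"
  using young_raise_word[of n lam i Y] SSYT_raise_closed(1)[OF assms(1,2,4)]
    young_word_inj[OF SSYT_D(1) SSYT_D(1)[OF assms(3)]]
  by (cases "young_raise n lam i Y") auto

lemma young_lower_iff:
  assumes "is_partition n lam" "Y \<in> SSYT n lam" "Z \<in> SSYT n lam" "1 \<le> i" "i < n"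
  shows "young_lower n lam i Y = Some Z \<longleftrightarrow> word_lower i (young_word n lam Y) = Some (young_word n lam Z)"
  using young_lower_word[of n lam i Y] SSYT_lower_closed(1)[OF assms(1,2,4,5)]
    young_word_inj[OF SSYT_D(1) SSYT_D(1)[OF assms(3)]]
  by (cases "young_lower n lam i Y") auto

lemma highest_SSYT: "is_partition n lam \<Longrightarrow> highest_weight_tableau n lam \<in> SSYT n lam"
  by (auto simp: SSYT_def is_filling_def highest_weight_tableau_def diagram_iff)

section \<open>Reduced words of minimal sorting permutations\<close>

lemma word_perm_Cons: "word_perm (i # ws) = transpose i (Suc i) \<circ> word_perm ws"
  by (simp add: word_perm_def)

lemma inj_word_perm: "inj (word_perm ws)"
proof (induction ws)
  case Nil
  show ?case by (simp add: word_perm_def)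
next
  case (Cons i ws)
  have "inj (transpose i (Suc i))" by (rule injI) (metis transpose_involutory)
  then show ?case unfolding word_perm_Cons using Cons.IH by (rule inj_compose)
qed

lemma perm_length_le: "set ws \<subseteq> {1..<n} \<Longrightarrow> word_perm ws = w \<Longrightarrow> perm_length n w \<le> length ws"
  unfolding perm_length_def by (rule Least_le) blast

text \<open>
  The exchange property. The values \<open>i\<close> and \<open>i + 1\<close> change their relative order at some letter
  \<open>j\<close> of the word; multiplying by the transposition of \<open>i\<close> and \<open>i + 1\<close> amounts to deleting that letter.
\<close>

lemma word_exchange:
  assumes "word_perm ws x = i" "word_perm ws y = Suc i" "y < x"
  shows "\<exists>vs. set vs \<subseteq> set ws \<and> word_perm vs = transpose i (Suc i) \<circ> word_perm ws \<and> length vs < length ws"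
  using assms
proof (induction ws arbitrary: x y rule: rev_induct)
  case Nil
  then show ?case by (simp add: word_perm_def)
next
  case (snoc j ws)
  let ?t = "transpose j (Suc j)"
  have wj: "word_perm (ws @ [j]) = word_perm ws \<circ> ?t"
    by (simp add: word_perm_append) (simp add: word_perm_def)
  have x: "word_perm ws (?t x) = i" and y: "word_perm ws (?t y) = Suc i"
    using snoc.prems wj by auto
  show ?case
  proof (cases "?t y < ?t x")
    case True
    then obtain vs where vs: "set vs \<subseteq> set ws" "word_perm vs = transpose i (Suc i) \<circ> word_perm ws"
      "length vs < length ws"
      using snoc.IH[OF x y] by blast
    have "word_perm (vs @ [j]) = transpose i (Suc i) \<circ> word_perm (ws @ [j])"
      unfolding wj by (simp add: word_perm_append vs(2) comp_assoc) (simp add: word_perm_def)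
    then show ?thesis using vs by (intro exI[of _ "vs @ [j]"]) auto
  next
    case False
    then have "x = Suc j" "y = j" using snoc.prems(3) by (auto simp: transpose_def split: if_splits)
    then have j: "word_perm ws j = i" "word_perm ws (Suc j) = Suc i" using x y by auto
    have "transpose i (Suc i) (word_perm ws (?t k)) = word_perm ws k" for k
    proof -
      have "word_perm ws k \<noteq> i" "word_perm ws k \<noteq> Suc i" if "k \<noteq> j" "k \<noteq> Suc j"
        using that j inj_word_perm[of ws] by (metis injD)+
      then show ?thesis using j by (auto simp: transpose_def)
    qed
    then have "word_perm ws = transpose i (Suc i) \<circ> word_perm (ws @ [j])"
      unfolding wj by (simp add: fun_eq_iff)
    then show ?thesis by (intro exI[of _ ws]) auto
  qed
qed

text \<open>
  If \<open>a i = a (i + 1)\<close>, the remaining shorter word would sort \<open>a\<close> as well. If \<open>a i > a (i + 1)\<close>, then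
  \<open>\<lambda>\<close> being decreasing means that the remaining permutation has \<open>i + 1\<close> before \<open>i\<close>, and by the exchange
  property the first letter shortens it, although the word is reduced.
\<close>

lemma min_sorting_perm_step:
  assumes lam: "is_partition n lam" and red: "reduced_word n (i # ws) w" and min: "min_sorting_perm n a lam w"
  defines "b \<equiv> a \<circ> transpose i (Suc i)"
  shows "i \<in> {1..<n}" and "reduced_word n ws (word_perm ws)" and "min_sorting_perm n b lam (word_perm ws)"
    and "a i < a (Suc i)"
proof -
  let ?t = "transpose i (Suc i)" and ?v = "word_perm ws"
  have ws: "set ws \<subseteq> {1..<n}" and w: "w = ?t \<circ> ?v" and len: "Suc (length ws) = perm_length n w"
    using red by (auto simp: reduced_word_def word_perm_Cons)
  show i: "i \<in> {1..<n}" using red by (simp add: reduced_word_def)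
  have sort: "w permutes {1..n}" "\<And>j. j \<in> {1..n} \<Longrightarrow> lam j = a (w j)"
    and least: "\<And>u. sorting_perm n a lam u \<Longrightarrow> perm_length n w \<le> perm_length n u"
    using min by (auto simp: min_sorting_perm_def sorting_perm_def)
  have t: "?t permutes {1..n}" using i by (intro permutes_swap_id) auto
  have vw: "?v = ?t \<circ> w" unfolding w by (simp add: fun_eq_iff)
  have v: "?v permutes {1..n}" unfolding vw by (rule permutes_compose[OF sort(1) t])
  have up: "perm_length n (?t \<circ> u) \<le> Suc (perm_length n u)" if u: "u permutes {1..n}" for u
  proof -
    obtain us where "reduced_word n us u" using reduced_word_exists[OF u] by blast
    then show ?thesis
      using perm_length_le[of "i # us" n "?t \<circ> u"] i by (simp add: reduced_word_def word_perm_Cons)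
  qed
  have lv: "perm_length n ?v = length ws"
    using up[OF v] len w perm_length_le[OF ws refl] by simp
  then show "reduced_word n ws ?v" using ws by (simp add: reduced_word_def)
  show "min_sorting_perm n b lam ?v"
    unfolding min_sorting_perm_def
  proof (intro conjI allI impI)
    show "sorting_perm n b lam ?v" using v sort(2) by (auto simp: sorting_perm_def b_def w)
    fix u assume u: "sorting_perm n b lam u"
    then have "u permutes {1..n}" by (simp add: sorting_perm_def)
    moreover have "sorting_perm n a lam (?t \<circ> u)"
      using u permutes_compose[OF \<open>u permutes {1..n}\<close> t] by (auto simp: sorting_perm_def b_def)
    ultimately show "perm_length n ?v \<le> perm_length n u"
      using least up lv len by (metis Suc_le_mono le_trans)
  qed
  show "a i < a (Suc i)"
  proof (rule ccontr)
    assume "\<not> ?thesis"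
    then consider "a i = a (Suc i)" | "a (Suc i) < a i" by linarith
    then show False
    proof cases
      case 1
      then have "a (?t k) = a k" for k by (auto simp: transpose_def)
      then have "sorting_perm n a lam ?v"
        using v sort(2) by (auto simp: sorting_perm_def w)
      then show False using least lv len by fastforce
    next
      case 2
      obtain x y where x: "x \<in> {1..n}" "?v x = i" and y: "y \<in> {1..n}" "?v y = Suc i"
        using permutes_image[OF v] i by (metis (no_types, lifting) Suc_leI atLeastAtMost_iff atLeastLessThan_iff imageE le_SucI less_imp_le_nat)
      then have "lam x < lam y" using sort(2) 2 by (simp add: w)
      then have "y < x" using lam x(1) y(1) unfolding is_partition_def by (meson linorder_not_less)
      then obtain vs where "set vs \<subseteq> set ws" "word_perm vs = w" "length vs < length ws"
        using word_exchange[OF x(2) y(2)] w by blast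
      then show False using perm_length_le[of vs n w] ws len by auto
    qed
  qed
qed

lemma sorting_perm_columns:
  assumes "sorting_perm n a lam w"
  shows "col_height n a = col_height n lam" and "max_column n a = max_column n lam"
proof -
  have w: "w permutes {1..n}" and eq: "\<And>j. j \<in> {1..n} \<Longrightarrow> lam j = a (w j)"
    using assms by (auto simp: sorting_perm_def)
  have im: "w ` {1..n} = {1..n}" by (rule permutes_image[OF w])
  have "lam ` {1..n} = a ` (w ` {1..n})" using eq by (auto simp: image_image)
  then show "max_column n a = max_column n lam" by (simp only: max_column_def im)
  show "col_height n a = col_height n lam"
  proof
    fix c
    have "{r. (r, c) \<in> diagram n a} = {r \<in> w ` {1..n}. 1 \<le> c \<and> c \<le> a r}"
      unfolding im by (auto simp: diagram_iff)
    also have "\<dots> = w ` {r. (r, c) \<in> diagram n lam}"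
      using eq by (auto simp: diagram_iff)
    finally show "col_height n a c = col_height n lam c"
      using card_image[OF inj_on_subset[OF permutes_inj[OF w] subset_UNIV]]
      by (simp add: col_height_def)
  qed
qed

section \<open>Two models of the same crystal\<close>

text \<open>
  The sorted words of all key tableaux with entries at most \<open>n\<close>, for any shape that sorts to \<open>\<lambda>\<close>.
\<close>

definition anti_words :: "nat \<Rightarrow> (nat \<Rightarrow> nat) \<Rightarrow> nat list set" where
  "anti_words n lam = {col_word K (rev [1..<Suc (max_column n lam)]) |K. anti_cols n (col_height n lam) K}"

definition highest_anti_word :: "nat \<Rightarrow> (nat \<Rightarrow> nat) \<Rightarrow> nat list" where
  "highest_anti_word n lam = col_word (\<lambda>c. {1..col_height n lam c}) (rev [1..<Suc (max_column n lam)])"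

lemma anti_words_raise:
  assumes "w \<in> anti_words n lam" "i \<in> {1..<n}" "word_raise i w = Some w'"
  shows "w' \<in> anti_words n lam"
proof -
  obtain K where K: "anti_cols n (col_height n lam) K" "w = col_word K (rev [1..<Suc (max_column n lam)])"
    using assms(1) unfolding anti_words_def by blast
  have "1 \<le> i" using assms(2) by simp
  from anti_cols_raise[OF K(1) col_height_outside(2) this assms(3)[unfolded K(2)]]
  show ?thesis unfolding anti_words_def by blast
qed

lemma anti_words_highest:
  assumes "w \<in> anti_words n lam" "\<forall>i\<in>{1..<n}. word_eps i w = 0"
  shows "w = highest_anti_word n lam"
proof -
  obtain K where K: "anti_cols n (col_height n lam) K" "w = col_word K (rev [1..<Suc (max_column n lam)])"
    using assms(1) unfolding anti_words_def by blast
  have "K c = {1..col_height n lam c}" if "c \<in> {1..max_column n lam}" for c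
    by (rule anti_cols_highest[OF K(1) bspec[OF assms(2)[unfolded K(2)]] that])
  then show ?thesis
    unfolding K(2) highest_anti_word_def by (intro col_word_cong) auto
qed

lemma young_words_highest:
  assumes lam: "is_partition n lam" and Y: "Y \<in> SSYT n lam"
    and "\<forall>i\<in>{1..<n}. word_eps i (young_word n lam Y) = 0"
  shows "Y = highest_weight_tableau n lam"
proof (rule young_word_inj[OF SSYT_D(1)[OF Y] SSYT_D(1)[OF highest_SSYT[OF lam]]])
  show "young_word n lam Y = young_word n lam (highest_weight_tableau n lam)"
  proof -
    have "col_set n lam Y c = {1..col_height n lam c}" if "c \<in> {1..max_column n lam}" for c
      by (rule young_cols_highest[OF young_cols_col_set[OF Y]
          bspec[OF assms(3)[unfolded young_word_eq[OF Y]]] that])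
    then show ?thesis
      unfolding young_word_eq[OF Y] young_word_eq[OF highest_SSYT[OF lam]]
      by (intro col_word_cong) (auto simp: col_set_highest[OF lam])
  qed
qed

lemma plactic_highest:
  assumes "is_partition n lam"
  shows "plactic (highest_anti_word n lam) (young_word n lam (highest_weight_tableau n lam))"
proof -
  let ?cs = "[1..<Suc (max_column n lam)]"
  have eq: "col_word (\<lambda>c. {1..col_height n lam c}) cs =
      concat (map (\<lambda>k. rev [1..<Suc k]) (map (col_height n lam) cs))" for cs
    by (induction cs) (simp_all only: col_word_simps desc_initial list.map concat.simps)
  show ?thesis
    unfolding highest_anti_word_def young_word_eq[OF highest_SSYT[OF assms]] col_set_highest[OF assms, abs_def] eq
    using plactic_columns_rev[of "map (col_height n lam) (rev ?cs)"]
    by (simp only: rev_map rev_rev_ident)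
qed

lemma SSYT_plactic_unique:
  assumes lam: "is_partition n lam" and "Y \<in> SSYT n lam" "Z \<in> SSYT n lam"
    "plactic (young_word n lam Y) (young_word n lam Z)"
  shows "Y = Z"
proof (rule young_word_inj[OF SSYT_D(1) SSYT_D(1)])
  let ?W = "young_word n lam ` SSYT n lam"
  show "young_word n lam Y = young_word n lam Z"
  proof (rule plactic_unique[where W = ?W and I = "{1..<n}"])
    fix w i w' assume w: "w \<in> ?W" "i \<in> {1..<n}" "word_raise i w = Some w'"
    then obtain X where X: "X \<in> SSYT n lam" "w = young_word n lam X" by blast
    then obtain X' where "young_raise n lam i X = Some X'" "w' = young_word n lam X'"
      using young_raise_word[of n lam i X] w by auto
    then show "w' \<in> ?W" using SSYT_raise_closed(1)[OF lam X(1)] w(2) by auto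
  next
    show "w = young_word n lam (highest_weight_tableau n lam)"
      if "w \<in> ?W" "\<forall>i\<in>{1..<n}. word_eps i w = 0" for w
      using that young_words_highest[OF lam] by blast
  qed (use assms in auto)
qed (use assms in auto)

lemma anti_words_plactic_unique:
  "u \<in> anti_words n lam \<Longrightarrow> v \<in> anti_words n lam \<Longrightarrow> plactic u v \<Longrightarrow> u = v"
  by (rule plactic_unique[where W = "anti_words n lam" and I = "{1..<n}"])
    (blast intro: anti_words_raise anti_words_highest)+

lemma anti_word_SSYT:
  assumes lam: "is_partition n lam" and "w \<in> anti_words n lam"
  shows "\<exists>Y \<in> SSYT n lam. plactic w (young_word n lam Y)"
proof -
  let ?V = "young_word n lam ` SSYT n lam"
  have "\<exists>v\<in>?V. plactic w v"
  proof (rule plactic_transfer[where U = "anti_words n lam" and I = "{1..<n}"])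
    fix w i w' assume w: "w \<in> ?V" "i \<in> {1..<n}" "word_lower i w = Some w'"
    then obtain X where X: "X \<in> SSYT n lam" "w = young_word n lam X" by blast
    then obtain X' where "young_lower n lam i X = Some X'" "w' = young_word n lam X'"
      using young_lower_word[of n lam i X] w by auto
    then show "w' \<in> ?V" using SSYT_lower_closed(1)[OF lam X(1)] w(2) by auto
  next
    fix w assume "w \<in> anti_words n lam" "\<forall>i\<in>{1..<n}. word_eps i w = 0"
    then have "w = highest_anti_word n lam" by (rule anti_words_highest)
    then show "\<exists>v\<in>?V. plactic w v" using plactic_highest[OF lam] highest_SSYT[OF lam] by blast
  qed (use assms anti_words_raise in blast)+
  then show ?thesis by blast
qed

section \<open>Demazure subsets\<close>

lemma sorted_word_anti:
  assumes "sorting_perm n a lam w" "T \<in> SSKT n a"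
  shows "sorted_word n a T \<in> anti_words n lam"
  using anti_cols_col_set[OF assms(2)] sorting_perm_columns[OF assms(1)]
  unfolding anti_words_def sorted_word_def by auto

lemma iter_raise_0: "iter_raise n lam i 0 b = Some b"
  by (simp add: iter_raise_def)

lemma iter_raise_Suc:
  "iter_raise n lam i (Suc k) b =
     (case young_raise n lam i b of None \<Rightarrow> None | Some c \<Rightarrow> iter_raise n lam i k c)"
proof -
  have "((\<lambda>x. Option.bind x (young_raise n lam i)) ^^ k) None = None" for k
    by (induction k) auto
  then show ?thesis
    by (simp add: iter_raise_def funpow_swap1 del: funpow.simps(2) split: option.split)
      (simp add: funpow_Suc_right del: funpow.simps(2))
qed

lemma SSKT_cong:
  assumes "\<And>r. r \<in> {1..n} \<Longrightarrow> a r = b r"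
  shows "SSKT n a = SSKT n b" and "sorted_word n a = sorted_word n b"
proof -
  have d: "diagram n a = diagram n b" using assms by (auto simp: diagram_def)
  have "a ` {1..n} = b ` {1..n}" using assms by (auto simp: image_def)
  then have m: "max_column n a = max_column n b" by (simp only: max_column_def)
  show "SSKT n a = SSKT n b" by (simp add: SSKT_def key_tableau_def is_filling_def d)
  show "sorted_word n a = sorted_word n b"
    by (simp add: sorted_word_def col_set_def[abs_def] d m fun_eq_iff del: upt_Suc)
qed

lemma demazure_crystal_subset:
  "is_partition n lam \<Longrightarrow> demazure_crystal n lam ws \<subseteq> SSYT n lam"
  using highest_SSYT by (cases ws) (auto simp: demazure_crystal_def demazure_op_def)

text \<open>
  An element of the Demazure crystal is raised by \<open>i\<close> into the set for
  the exchanged shape, which is contained in the set for \<open>a\<close>, and lowering stays inside. Conversely, raising by \<open>i\<close>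
  stays inside the set for \<open>a\<close> and ends in the set for the exchanged shape.
\<close>

lemma demazure_crystal_SSKT:
  assumes lam: "is_partition n lam"
  shows "reduced_word n ws w \<Longrightarrow> min_sorting_perm n a lam w \<Longrightarrow> Y \<in> SSYT n lam \<Longrightarrow>
    Y \<in> demazure_crystal n lam ws \<longleftrightarrow> (\<exists>T \<in> SSKT n a. plactic (sorted_word n a T) (young_word n lam Y))"
proof (induction ws arbitrary: w a Y)
  case Nil
  then have "w = id" by (simp add: reduced_word_def word_perm_def)
  then have eq: "a r = lam r" if "r \<in> {1..n}" for r
    using Nil.prems(2) that by (auto simp: min_sorting_perm_def sorting_perm_def)
  have hw: "sorted_word n a (highest_weight_tableau n lam) = highest_anti_word n lam"
  proof -
    have "sorted_word n a = sorted_word n lam" by (rule SSKT_cong(2)) (rule eq)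
    then have "sorted_word n a (highest_weight_tableau n lam) = sorted_word n lam (highest_weight_tableau n lam)"
      by (rule fun_cong)
    also have "\<dots> = highest_anti_word n lam"
      unfolding sorted_word_def highest_anti_word_def by (intro col_word_cong col_set_highest[OF lam])
    finally show ?thesis .
  qed
  have "plactic (highest_anti_word n lam) (young_word n lam Y) \<longleftrightarrow> Y = highest_weight_tableau n lam"
    using plactic_highest[OF lam] SSYT_plactic_unique[OF lam Nil.prems(3) highest_SSYT[OF lam]]
    by (metis plactic_sym plactic_trans)
  moreover have "SSKT n a = SSKT n lam" by (rule SSKT_cong(1)) (rule eq)
  ultimately show ?case by (simp add: hw demazure_crystal_def SSKT_partition[OF lam])
next
  case (Cons i ws)
  let ?b = "a \<circ> transpose i (Suc i)"
  note step = min_sorting_perm_step[OF lam Cons.prems(1,2)]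
  have i: "1 \<le> i" "i < n" using step(1) by auto
  note IH = Cons.IH[OF step(2,3)]
  note sub = demazure_crystal_subset[OF lam, of ws]
  have dem: "Y \<in> demazure_crystal n lam (i # ws) \<longleftrightarrow>
      (\<exists>k. \<exists>X \<in> demazure_crystal n lam ws. iter_raise n lam i k Y = Some X)"
    using Cons.prems(3) by (simp add: demazure_crystal_def demazure_op_def)
  show ?case
  proof
    assume "Y \<in> demazure_crystal n lam (i # ws)"
    then obtain k X where kX: "iter_raise n lam i k Y = Some X" "X \<in> demazure_crystal n lam ws"
      using dem by blast
    then obtain S where S: "S \<in> SSKT n ?b" "plactic (sorted_word n ?b S) (young_word n lam X)"
      using IH sub by blast
    obtain T0 where T0: "T0 \<in> SSKT n a" "plactic (sorted_word n a T0) (young_word n lam X)"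
      using SSKT_swap_subset[OF i step(4) S(1)] S(2) by metis
    show "\<exists>T \<in> SSKT n a. plactic (sorted_word n a T) (young_word n lam Y)"
      using kX(1) Cons.prems(3)
    proof (induction k arbitrary: Y)
      case 0
      then show ?case using T0 by (auto simp: iter_raise_0)
    next
      case (Suc k)
      then obtain Z where Z: "young_raise n lam i Y = Some Z" "iter_raise n lam i k Z = Some X"
        by (auto simp: iter_raise_Suc split: option.splits)
      note ZY = SSYT_raise_closed[OF lam Suc.prems(2) i(1) Z(1)]
      obtain T where T: "T \<in> SSKT n a" "plactic (sorted_word n a T) (young_word n lam Z)"
        using Suc.IH[OF Z(2) ZY(1)] by blast
      have "word_lower i (young_word n lam Z) = Some (young_word n lam Y)"
        using ZY(2) by (simp add: word_raise_lower_inverse)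
      then obtain w' where w': "word_lower i (sorted_word n a T) = Some w'" "plactic w' (young_word n lam Y)"
        using plactic_lower[OF T(2), of i] by (auto simp: option_rel_Some2)
      then show ?case
        using SSKT_lower_closed[OF T(1) i _ w'(1)] step(4) by fastforce
    qed
  next
    assume "\<exists>T \<in> SSKT n a. plactic (sorted_word n a T) (young_word n lam Y)"
    then obtain T where T: "T \<in> SSKT n a" "plactic (sorted_word n a T) (young_word n lam Y)" by blast
    have "\<exists>k. \<exists>X \<in> demazure_crystal n lam ws. iter_raise n lam i k Y = Some X"
      using T Cons.prems(3)
    proof (induction "sum_list (sorted_word n a T)" arbitrary: T Y rule: less_induct)
      case less
      have kt: "key_tableau n a T" using less.prems(1) by (simp add: SSKT_def)
      show ?case
      proof (cases "key_raise n a i T")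
        case None
        then have "word_eps i (sorted_word n a T) = 0"
          using key_raise_None[OF kt] word_raise_None_iff by metis
        then obtain S where "S \<in> SSKT n ?b" "sorted_word n ?b S = sorted_word n a T"
          using SSKT_highest_in_swap[OF less.prems(1) i step(4)] by blast
        then have "Y \<in> demazure_crystal n lam ws" using IH[OF less.prems(3)] less.prems(2) by metis
        then show ?thesis using iter_raise_0 by blast
      next
        case (Some S)
        note r = key_raise_step(1,2)[OF kt i(1) Some]
        obtain w' where "word_raise i (young_word n lam Y) = Some w'" and w': "plactic (sorted_word n a S) w'"
          using plactic_raise[OF less.prems(2), of i] r(2) by (auto simp: option_rel_Some1)
        then obtain Z where Z: "young_raise n lam i Y = Some Z" "w' = young_word n lam Z"
          using young_raise_word[of n lam i Y] by auto
        have "S \<in> SSKT n a" by (rule SSKT_raise_closed[OF less.prems(1) i(1) Some])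
        moreover have "Z \<in> SSYT n lam" by (rule SSYT_raise_closed(1)[OF lam less.prems(3) i(1) Z(1)])
        moreover have "sum_list (sorted_word n a S) < sum_list (sorted_word n a T)"
          using word_raise_sum[OF r(2)] by simp
        ultimately obtain k X where "X \<in> demazure_crystal n lam ws" "iter_raise n lam i k Z = Some X"
          using less.hyps[of S Z] w' Z(2) by blast
        then have "iter_raise n lam i (Suc k) Y = Some X" using Z(1) by (simp add: iter_raise_Suc)
        then show ?thesis using \<open>X \<in> demazure_crystal n lam ws\<close> by blast
      qed
    qed
    then show "Y \<in> demazure_crystal n lam (i # ws)" using dem by blast
  qed
qed

section \<open>Weights\<close>

lemma count_list_map_distinct: "distinct xs \<Longrightarrow> count_list (map f xs) i = card {x \<in> set xs. f x = i}"
proof (induction xs)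
  case (Cons x xs)
  have "{y \<in> set (x # xs). f y = i} = (if f x = i then insert x {y \<in> set xs. f y = i} else {y \<in> set xs. f y = i})"
    by auto
  then show ?case using Cons by simp
qed simp

lemma weight_young: "weight n lam Y i = count_list (young_word n lam Y) i"
  by (simp add: weight_def young_word_def count_list_map_distinct[OF distinct_young_cells] set_young_cells)

lemma weight_key:
  assumes T: "key_tableau n a T"
  shows "weight n a T i = count_list (sorted_word n a T) i"
proof -
  have "count_list (map T (cells_of n a cs)) i = count_list (col_word (col_set n a T) cs) i" for cs
  proof (induction cs)
    case (Cons c cs)
    have "count_list (map T (column_cells n a c)) i = count_list (desc (col_set n a T c)) i"
      using distinct_count_list[OF distinct_column[OF T, of c], of i]
        distinct_count_list[of "desc (col_set n a T c)" i] set_map_column_cells[of T n a c]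
      by (simp add: desc_def)
    then show ?case using Cons by simp
  qed simp
  then have "count_list (sorted_word n a T) i = count_list (map T (key_cells n a)) i"
    by (simp add: sorted_word_def key_cells_eq del: upt_Suc)
  then show ?thesis
    by (simp add: weight_def count_list_map_distinct[OF distinct_key_cells] set_key_cells)
qed

theorem theorem3p14:
  fixes n :: nat and a lam w :: "nat \<Rightarrow> nat" and ws :: "nat list"
  assumes "is_partition n lam"
    and "min_sorting_perm n a lam w"
    and "reduced_word n ws w"
  shows "(\<forall>T \<in> SSKT n a. \<forall>i \<in> {1..<n}.
            set_option (key_raise n a i T) \<subseteq> SSKT n a \<and>
            set_option (key_lower n a i T) \<subseteq> SSKT n a) \<and>
         (\<exists>\<phi>. bij_betw \<phi> (SSKT n a) (demazure_crystal n lam ws) \<and>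
            (\<forall>T \<in> SSKT n a.
               (\<forall>i \<in> {1..n}. weight n lam (\<phi> T) i = weight n a T i) \<and>
               (\<forall>i \<in> {1..<n}.
                  map_option \<phi> (key_raise n a i T) =
                    restrict_op (demazure_crystal n lam ws) (young_raise n lam i) (\<phi> T) \<and>
                  map_option \<phi> (key_lower n a i T) =
                    restrict_op (demazure_crystal n lam ws) (young_lower n lam i) (\<phi> T))))"
proof -
  note lam = assms(1)
  let ?D = "demazure_crystal n lam ws"
  have sort: "sorting_perm n a lam w" using assms(2) by (simp add: min_sorting_perm_def)
  note dem = demazure_crystal_SSKT[OF lam assms(3,2)]
  note sub = demazure_crystal_subset[OF lam, of ws]
  have kt: "key_tableau n a T" if "T \<in> SSKT n a" for T using that by (simp add: SSKT_def)
  define \<phi> where "\<phi> T = (SOME Y. Y \<in> SSYT n lam \<and> plactic (sorted_word n a T) (young_word n lam Y))" for T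
  have \<phi>: "\<phi> T \<in> SSYT n lam" "plactic (sorted_word n a T) (young_word n lam (\<phi> T))" if "T \<in> SSKT n a" for T
    using someI_ex[of "\<lambda>Y. Y \<in> SSYT n lam \<and> plactic (sorted_word n a T) (young_word n lam Y)"]
      anti_word_SSYT[OF lam sorted_word_anti[OF sort that]] unfolding \<phi>_def by blast+
  have \<phi>_eq: "\<phi> T = Y" if "T \<in> SSKT n a" "Y \<in> SSYT n lam" "plactic (sorted_word n a T) (young_word n lam Y)" for T Y
    using SSYT_plactic_unique[OF lam \<phi>(1)[OF that(1)] that(2)] \<phi>(2)[OF that(1)] that(3)
    by (metis plactic_sym plactic_trans)
  have \<phi>_D: "\<phi> T \<in> ?D" if "T \<in> SSKT n a" for T using dem \<phi>[OF that] that by blast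
  have inj: "T = S" if "T \<in> SSKT n a" "S \<in> SSKT n a" "\<phi> T = \<phi> S" for T S
  proof (rule sorted_word_inj[OF kt[OF that(1)] kt[OF that(2)]])
    show "sorted_word n a T = sorted_word n a S"
    proof (rule anti_words_plactic_unique[OF sorted_word_anti[OF sort that(1)] sorted_word_anti[OF sort that(2)]])
      show "plactic (sorted_word n a T) (sorted_word n a S)"
        using plactic_trans[OF \<phi>(2)[OF that(1)]] plactic_sym[OF \<phi>(2)[OF that(2)]] that(3) by simp
    qed
  qed
  have bij: "bij_betw \<phi> (SSKT n a) ?D"
    unfolding bij_betw_def
  proof (intro conjI inj_onI equalityI subsetI)
    show "T = S" if "T \<in> SSKT n a" "S \<in> SSKT n a" "\<phi> T = \<phi> S" for T S using inj[OF that] .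
    show "Y \<in> ?D" if "Y \<in> \<phi> ` SSKT n a" for Y using that \<phi>_D by blast
    show "Y \<in> \<phi> ` SSKT n a" if "Y \<in> ?D" for Y
      using that dem[of Y] sub \<phi>_eq by blast
  qed
  have raise_closed: "S \<in> SSKT n a" if "T \<in> SSKT n a" "i \<in> {1..<n}" "key_raise n a i T = Some S" for T i S
    using SSKT_raise_closed[OF that(1) _ that(3)] that(2) by simp
  have raise: "map_option \<phi> (key_raise n a i T) = young_raise n lam i (\<phi> T)"
    if T: "T \<in> SSKT n a" and i: "i \<in> {1..<n}" for T i
  proof (cases "key_raise n a i T")
    case None
    then have "word_raise i (young_word n lam (\<phi> T)) = None"
      using key_raise_None[OF kt[OF T]] plactic_raise[OF \<phi>(2)[OF T], of i] by auto
    then show ?thesis using None young_raise_word[of n lam i "\<phi> T"] by simp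
  next
    case (Some S)
    have "word_raise i (sorted_word n a T) = Some (sorted_word n a S)"
      using key_raise_step(2)[OF kt[OF T] _ Some] i by simp
    then obtain w' where w': "word_raise i (young_word n lam (\<phi> T)) = Some w'" "plactic (sorted_word n a S) w'"
      using plactic_raise[OF \<phi>(2)[OF T], of i] by (auto simp: option_rel_Some1)
    then obtain Z where Z: "young_raise n lam i (\<phi> T) = Some Z" "w' = young_word n lam Z"
      using young_raise_word[of n lam i "\<phi> T"] by auto
    have "Z \<in> SSYT n lam" using SSYT_raise_closed(1)[OF lam \<phi>(1)[OF T] _ Z(1)] i by simp
    then have "\<phi> S = Z" using \<phi>_eq[OF raise_closed[OF T i Some]] w'(2) Z(2) by simp
    then show ?thesis using Some Z(1) by simp
  qed
  have inverse: "young_lower n lam i Y = Some Z \<longleftrightarrow> young_raise n lam i Z = Some Y"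
    if "Y \<in> SSYT n lam" "Z \<in> SSYT n lam" "i \<in> {1..<n}" for i Y Z
    using young_raise_iff[OF lam that(2,1)] young_lower_iff[OF lam that(1,2)] that(3)
    by (simp add: word_raise_lower_inverse)
  have key_lower_iff: "key_lower n a i T = Some S \<longleftrightarrow> S \<in> SSKT n a \<and> key_raise n a i S = Some T"
    if T: "T \<in> SSKT n a" and i: "i \<in> {1..<n}" for T S i
  proof -
    have unique: "S = S'" if "S \<in> SSKT n a" "key_raise n a i S = Some T"
      "S' \<in> SSKT n a" "key_raise n a i S' = Some T" for S S'
    proof -
      have "word_raise i (sorted_word n a S) = Some (sorted_word n a T)"
        "word_raise i (sorted_word n a S') = Some (sorted_word n a T)"
        using key_raise_step(2)[OF kt] that i by auto
      then have "sorted_word n a S = sorted_word n a S'" by (simp add: word_raise_lower_inverse)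
      then show ?thesis using sorted_word_inj kt that by blast
    qed
    show ?thesis
    proof (cases "\<exists>S \<in> SSKT n a. key_raise n a i S = Some T")
      case True
      then obtain S0 where S0: "S0 \<in> SSKT n a" "key_raise n a i S0 = Some T" by blast
      then have "(THE S. S \<in> SSKT n a \<and> key_raise n a i S = Some T) = S0"
        using unique by (intro the_equality) blast+
      then have "key_lower n a i T = Some S0" using True by (simp add: key_lower_def)
      then show ?thesis using S0 unique by auto
    next
      case False
      then show ?thesis by (auto simp: key_lower_def)
    qed
  qed
  have lower: "map_option \<phi> (key_lower n a i T) = restrict_op ?D (young_lower n lam i) (\<phi> T)"
    if T: "T \<in> SSKT n a" and i: "i \<in> {1..<n}" for T i
  proof (cases "key_lower n a i T")
    case (Some S)
    then have S: "S \<in> SSKT n a" "key_raise n a i S = Some T" using key_lower_iff[OF T i] by auto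
    then have "young_raise n lam i (\<phi> S) = Some (\<phi> T)" using raise[OF S(1) i] by simp
    then have "young_lower n lam i (\<phi> T) = Some (\<phi> S)"
      using inverse[OF \<phi>(1)[OF T] \<phi>(1)[OF S(1)] i] by simp
    then show ?thesis using Some \<phi>_D[OF S(1)] by (simp add: restrict_op_def)
  next
    case None
    have "Z \<notin> ?D" if Z: "young_lower n lam i (\<phi> T) = Some Z" for Z
    proof
      assume "Z \<in> ?D"
      then obtain S where S: "S \<in> SSKT n a" "Z = \<phi> S" using bij by (auto simp: bij_betw_def)
      then have "map_option \<phi> (key_raise n a i S) = Some (\<phi> T)"
        using raise[OF S(1) i] inverse[OF \<phi>(1)[OF T] \<phi>(1)[OF S(1)] i] Z by simp
      then obtain T' where "key_raise n a i S = Some T'" "\<phi> T' = \<phi> T" by auto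
      then have "key_raise n a i S = Some T" using inj[OF raise_closed[OF S(1) i] T] by blast
      then show False using None key_lower_iff[OF T i, of S] S(1) by simp
    qed
    then show ?thesis using None by (auto simp: restrict_op_def split: option.split)
  qed
  have raise': "map_option \<phi> (key_raise n a i T) = restrict_op ?D (young_raise n lam i) (\<phi> T)"
    if T: "T \<in> SSKT n a" and i: "i \<in> {1..<n}" for T i
  proof (cases "key_raise n a i T")
    case None
    then show ?thesis using raise[OF T i, symmetric] by (simp add: restrict_op_def)
  next
    case (Some S)
    then show ?thesis
      using raise[OF T i, symmetric] \<phi>_D[OF raise_closed[OF T i Some]] by (simp add: restrict_op_def)
  qed
  have weight: "weight n lam (\<phi> T) i = weight n a T i" if T: "T \<in> SSKT n a" for T i
    using plactic_count[OF \<phi>(2)[OF T], of i] weight_key[OF kt[OF T]] by (simp add: weight_young)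
  show ?thesis
  proof (intro conjI ballI exI[of _ \<phi>])
    fix T i assume T: "T \<in> SSKT n a" "i \<in> {1..<n}"
    show "set_option (key_raise n a i T) \<subseteq> SSKT n a" using raise_closed[OF T] by auto
    show "set_option (key_lower n a i T) \<subseteq> SSKT n a" using key_lower_iff[OF T] by auto
  qed (use bij weight raise' lower in auto)
qed

end
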